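(* Let $\pi\colon(N,h)\to(M,g)$ be a Riemannian submersion and let $(M,g,\mathcal{F})$ be a module SRF. Then $(N,h,\pi^{-1}\mathcal{F})$ is a module SRF as well. The same statement holds true for geometric SRFs: if $(M,g,\mathcal{F})$ is a geometric SRF, then $(N,h,\pi^{-1}\mathcal{F})$ is a geometric SRF.
   Context: A singular foliation (SF) on a smooth manifold $M$ is a $C^\infty(M)$-submodule $\mathcal{F}$ of the compactly supported vector fields $\mathfrak{X}_c(M)$ that is closed under the Lie bracket and locally finitely generated: every $q\in M$ has an open neighborhood $U$ such that $\{X\in\mathcal{F}:\mathrm{supp}(X)\subset U\}=\langle X_1,\dots,X_N\rangle_{C_c^\infty(U)}$ for finitely many $X_a\in\mathfrak{X}(U)$. An SF partitions $M$ into connected injectively immersed submanifolds called leaves; the tangent space at $q$ of the leaf through $q$ is $F_q=\{X|_q:X\in\mathcal{F}\}$. For a submersion $\pi\colon N\to M$, $\pi^{-1}\mathcal{F}$ is the SF on $N$ given by the $C_c^\infty(N)$-span of all vector fields $V$ on $N$ for which there is $X\in\mathcal{F}$ with $\mathrm{d}_q\pi(V|_q)=X|_{\pi(q)}$ for all $q\in N$. $(M,g,\mathcal{F})$ is a module SRF if $\mathcal{L}_Xg\in\Omega^1(M)\odot g_\flat(\mathcal{F})$ for every $X\in\mathcal{F}$, where $g_\flat(Y)=g(Y,\cdot)$, $\odot$ is the symmetric tensor product, and the right-hand side consists of finite sums of products. $(M,g,\mathcal{F})$ is a geometric SRF if every geodesic orthogonal to a leaf at one point is orthogonal to all the leaves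 it meets. A smooth submersion $\pi\colon(N,h)\to(M,g)$ between Riemannian manifolds is a Riemannian submersion if for every $q\in N$ the restriction of $\mathrm{d}_q\pi$ to $(\ker\mathrm{d}_q\pi)^{\perp_h}\subset T_qN$ is a linear isometry onto $T_{\pi(q)}M$. *)

theory Defs
  imports "HOL-Analysis.Analysis"
begin

section \<open>Model spaces and smooth maps between them\<close>

text \<open>
  The spaces \<open>\<real>\<^sup>n\<close> including \<open>n = 0\<close>: unlike \<^class>\<open>euclidean_space\<close>, the class does not exclude
  the zero space, so that zero-dimensional manifolds are not ruled out.
\<close>

class finite_dimensional_inner = real_inner +
  assumes finite_dimensional: "\<exists>B. finite B \<and> (\<forall>x. \<exists>r. x = (\<Sum>b\<in>B. r b *\<^sub>R b))"

instance euclidean_space \<subseteq> finite_dimensional_inner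
proof
  have "x = (\<Sum>b\<in>Basis. (x \<bullet> b) *\<^sub>R b)" for x :: 'a
    by (simp add: euclidean_representation)
  then show "\<exists>B::'a set. finite B \<and> (\<forall>x. \<exists>r. x = (\<Sum>b\<in>B. r b *\<^sub>R b))"
    using finite_Basis by blast
qed

primrec Ck_on ::
  "nat \<Rightarrow> 'a::real_normed_vector set \<Rightarrow> ('a \<Rightarrow> 'b::real_normed_vector) \<Rightarrow> bool" where
  "Ck_on 0 S f \<longleftrightarrow> continuous_on S f"
| "Ck_on (Suc k) S f \<longleftrightarrow>
     (\<forall>x\<in>S. f differentiable (at x)) \<and> (\<forall>v. Ck_on k S (\<lambda>x. frechet_derivative f (at x) v))"

text \<open>Only used for open sets \<open>S\<close> in finite-dimensional spaces.\<close>

definition smooth_on ::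
  "'a::real_normed_vector set \<Rightarrow> ('a \<Rightarrow> 'b::real_normed_vector) \<Rightarrow> bool" where
  "smooth_on S f \<longleftrightarrow> (\<forall>k. Ck_on k S f)"

section \<open>Smooth manifolds and tangent spaces\<close>

type_synonym ('a, 'e) chart = "'a set \<times> ('a \<Rightarrow> 'e)"

abbreviation cdom :: "('a, 'e) chart \<Rightarrow> 'a set" where "cdom c \<equiv> fst c"
abbreviation coord :: "('a, 'e) chart \<Rightarrow> 'a \<Rightarrow> 'e" where "coord c \<equiv> snd c"

definition coord_inv :: "('a, 'e) chart \<Rightarrow> 'e \<Rightarrow> 'a" where
  "coord_inv c = inv_into (cdom c) (coord c)"

text \<open>
  A manifold consists of all points of a type. Besides the atlas, the structure carries a choice of
  a preferred chart \<open>chart_at M p\<close> around each point \<open>p\<close>. The tangent space \<open>T\<^sub>pM\<close> is the model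
  space \<open>'e\<close>, a tangent vector being represented by its components in the preferred chart at \<open>p\<close>;
  its components in any other chart are obtained with the derivative of the transition map
  (\<open>to_chart\<close>, \<open>from_chart\<close> below). So vector fields are functions \<open>'a \<Rightarrow> 'e\<close>, one-forms are
  functions \<open>'a \<Rightarrow> 'e \<Rightarrow> real\<close>, and so on; smoothness is always tested in the charts of the atlas.
\<close>

record ('a, 'e) manifold =
  atlas :: "('a, 'e) chart set"
  chart_at :: "'a \<Rightarrow> ('a, 'e) chart"

definition smooth_manifold ::
  "('a::{t2_space,second_countable_topology}, 'e::finite_dimensional_inner) manifold \<Rightarrow> bool" where
  "smooth_manifold M \<longleftrightarrow>
     (\<forall>c\<in>atlas M. open (cdom c) \<and> open (coord c ` cdom c) \<and> inj_on (coord c) (cdom c) \<and>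
        continuous_on (cdom c) (coord c) \<and> continuous_on (coord c ` cdom c) (coord_inv c)) \<and>
     (\<forall>p. chart_at M p \<in> atlas M \<and> p \<in> cdom (chart_at M p)) \<and>
     (\<forall>c\<in>atlas M. \<forall>d\<in>atlas M.
        smooth_on (coord c ` (cdom c \<inter> cdom d)) (coord d \<circ> coord_inv c))"

definition to_chart ::
  "('a, 'e::real_normed_vector) manifold \<Rightarrow> ('a, 'e) chart \<Rightarrow> 'a \<Rightarrow> 'e \<Rightarrow> 'e" where
  "to_chart M c p =
     frechet_derivative (coord c \<circ> coord_inv (chart_at M p)) (at (coord (chart_at M p) p))"

definition from_chart ::
  "('a, 'e::real_normed_vector) manifold \<Rightarrow> ('a, 'e) chart \<Rightarrow> 'a \<Rightarrow> 'e \<Rightarrow> 'e" where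
  "from_chart M c p =
     frechet_derivative (coord (chart_at M p) \<circ> coord_inv c) (at (coord c p))"

section \<open>Functions, vector fields and one-forms\<close>

definition supp :: "('a::topological_space \<Rightarrow> 'b::zero) \<Rightarrow> 'a set" where
  "supp f = closure {p. f p \<noteq> 0}"

definition smooth_fun ::
  "('a, 'e::real_normed_vector) manifold \<Rightarrow> ('a \<Rightarrow> real) \<Rightarrow> bool" where
  "smooth_fun M f \<longleftrightarrow> (\<forall>c\<in>atlas M. smooth_on (coord c ` cdom c) (f \<circ> coord_inv c))"

text \<open>\<open>C\<^sub>c\<^sup>\<infinity>(U)\<close>, its elements being extended by zero to all of \<open>M\<close>.\<close>

definition Cc_smooth ::
  "('a::topological_space, 'e::real_normed_vector) manifold \<Rightarrow> 'a set \<Rightarrow> ('a \<Rightarrow> real) set" where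
  "Cc_smooth M U = {f. smooth_fun M f \<and> compact (supp f) \<and> supp f \<subseteq> U}"

definition vf_rep ::
  "('a, 'e::real_normed_vector) manifold \<Rightarrow> ('a, 'e) chart \<Rightarrow> ('a \<Rightarrow> 'e) \<Rightarrow> 'e \<Rightarrow> 'e" where
  "vf_rep M c X x = to_chart M c (coord_inv c x) (X (coord_inv c x))"

definition smooth_vf_on ::
  "('a, 'e::real_normed_vector) manifold \<Rightarrow> 'a set \<Rightarrow> ('a \<Rightarrow> 'e) \<Rightarrow> bool" where
  "smooth_vf_on M U X \<longleftrightarrow> (\<forall>c\<in>atlas M. smooth_on (coord c ` (cdom c \<inter> U)) (vf_rep M c X))"

definition compact_vfs ::
  "('a::topological_space, 'e::real_normed_vector) manifold \<Rightarrow> ('a \<Rightarrow> 'e) set" where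
  "compact_vfs M = {X. smooth_vf_on M UNIV X \<and> compact (supp X)}"

text \<open>The sign is that of \<open>[X,Y] = XY - YX\<close> for vector fields acting on functions.\<close>

definition lie_bracket ::
  "('a, 'e::real_normed_vector) manifold \<Rightarrow> ('a \<Rightarrow> 'e) \<Rightarrow> ('a \<Rightarrow> 'e) \<Rightarrow> 'a \<Rightarrow> 'e" where
  "lie_bracket M X Y p =
     (let c = chart_at M p; x = coord c p in
        frechet_derivative (vf_rep M c Y) (at x) (vf_rep M c X x)
        - frechet_derivative (vf_rep M c X) (at x) (vf_rep M c Y x))"

definition smooth_one_form ::
  "('a, 'e::real_normed_vector) manifold \<Rightarrow> ('a \<Rightarrow> 'e \<Rightarrow> real) \<Rightarrow> bool" where
  "smooth_one_form M \<alpha> \<longleftrightarrow>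
     (\<forall>p. linear (\<alpha> p)) \<and>
     (\<forall>c\<in>atlas M. \<forall>u. smooth_on (coord c ` cdom c)
        (\<lambda>x. \<alpha> (coord_inv c x) (from_chart M c (coord_inv c x) u)))"

section \<open>Riemannian metrics\<close>

definition metric_rep ::
  "('a, 'e::real_normed_vector) manifold \<Rightarrow> ('a \<Rightarrow> 'e \<Rightarrow> 'e \<Rightarrow> real) \<Rightarrow> ('a, 'e) chart
     \<Rightarrow> 'e \<Rightarrow> 'e \<Rightarrow> 'e \<Rightarrow> real" where
  "metric_rep M g c x u v =
     (let p = coord_inv c x in g p (from_chart M c p u) (from_chart M c p v))"

definition riemannian_manifold ::
  "('a::{t2_space,second_countable_topology}, 'e::finite_dimensional_inner) manifold
     \<Rightarrow> ('a \<Rightarrow> 'e \<Rightarrow> 'e \<Rightarrow> real) \<Rightarrow> bool" where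
  "riemannian_manifold M g \<longleftrightarrow>
     smooth_manifold M \<and>
     (\<forall>p. bilinear (g p) \<and> (\<forall>u v. g p u v = g p v u) \<and> (\<forall>u. u \<noteq> 0 \<longrightarrow> g p u u > 0)) \<and>
     (\<forall>c\<in>atlas M. \<forall>u v. smooth_on (coord c ` cdom c) (\<lambda>x. metric_rep M g c x u v))"

text \<open>
  In coordinates,
  \<open>(\<L>\<^sub>X g)\<^sub>i\<^sub>j = X\<^sup>k \<partial>\<^sub>k g\<^sub>i\<^sub>j + g\<^sub>k\<^sub>j \<partial>\<^sub>i X\<^sup>k + g\<^sub>i\<^sub>k \<partial>\<^sub>j X\<^sup>k\<close>;
  it is evaluated at \<open>p\<close> in the preferred chart at \<open>p\<close>.
\<close>

definition lie_deriv_metric ::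
  "('a, 'e::real_normed_vector) manifold \<Rightarrow> ('a \<Rightarrow> 'e) \<Rightarrow> ('a \<Rightarrow> 'e \<Rightarrow> 'e \<Rightarrow> real)
     \<Rightarrow> 'a \<Rightarrow> 'e \<Rightarrow> 'e \<Rightarrow> real" where
  "lie_deriv_metric M X g p u v =
     (let c = chart_at M p; x = coord c p; DX = frechet_derivative (vf_rep M c X) (at x) in
        frechet_derivative (\<lambda>y. metric_rep M g c y u v) (at x) (vf_rep M c X x)
        + metric_rep M g c x (DX u) v + metric_rep M g c x u (DX v))"

text \<open>
  The Christoffel symbols of the Levi-Civita connection in the chart \<open>c\<close>, as the bilinear map
  \<open>(u, v) \<mapsto> (\<Gamma>\<^sup>k\<^sub>i\<^sub>j u\<^sup>i v\<^sup>j)\<^sub>k\<close>: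
  \<open>2 g\<^sub>k\<^sub>l \<Gamma>\<^sup>k\<^sub>i\<^sub>j = \<partial>\<^sub>i g\<^sub>j\<^sub>l + \<partial>\<^sub>j g\<^sub>i\<^sub>l - \<partial>\<^sub>l g\<^sub>i\<^sub>j\<close>.
\<close>

definition christoffel ::
  "('a, 'e::real_normed_vector) manifold \<Rightarrow> ('a \<Rightarrow> 'e \<Rightarrow> 'e \<Rightarrow> real) \<Rightarrow> ('a, 'e) chart
     \<Rightarrow> 'e \<Rightarrow> 'e \<Rightarrow> 'e \<Rightarrow> 'e" where
  "christoffel M g c x u v =
     (THE z. \<forall>w. 2 * metric_rep M g c x z w =
        frechet_derivative (\<lambda>y. metric_rep M g c y v w) (at x) u
        + frechet_derivative (\<lambda>y. metric_rep M g c y u w) (at x) v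
        - frechet_derivative (\<lambda>y. metric_rep M g c y u v) (at x) w)"

section \<open>Curves and geodesics\<close>

definition smooth_curve ::
  "('a::topological_space, 'e::real_normed_vector) manifold \<Rightarrow> real set \<Rightarrow> (real \<Rightarrow> 'a) \<Rightarrow> bool"
  where
  "smooth_curve M I \<gamma> \<longleftrightarrow>
     continuous_on I \<gamma> \<and>
     (\<forall>c\<in>atlas M. smooth_on {t\<in>I. \<gamma> t \<in> cdom c} (coord c \<circ> \<gamma>))"

definition velocity ::
  "('a, 'e::real_normed_vector) manifold \<Rightarrow> (real \<Rightarrow> 'a) \<Rightarrow> real \<Rightarrow> 'e" where
  "velocity M \<gamma> t = vector_derivative (coord (chart_at M (\<gamma> t)) \<circ> \<gamma>) (at t)"

definition geodesic ::
  "('a::topological_space, 'e::real_normed_vector) manifold \<Rightarrow> ('a \<Rightarrow> 'e \<Rightarrow> 'e \<Rightarrow> real)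
     \<Rightarrow> real set \<Rightarrow> (real \<Rightarrow> 'a) \<Rightarrow> bool" where
  "geodesic M g I \<gamma> \<longleftrightarrow>
     open I \<and> is_interval I \<and> smooth_curve M I \<gamma> \<and>
     (\<forall>c\<in>atlas M. \<forall>t\<in>I. \<gamma> t \<in> cdom c \<longrightarrow>
        (let x = coord c \<circ> \<gamma>; x' = (\<lambda>s. vector_derivative x (at s)) in
           vector_derivative x' (at t) + christoffel M g c (x t) (x' t) (x' t) = 0))"

section \<open>Singular foliations and their leaves\<close>

definition fun_span ::
  "('a \<Rightarrow> real) set \<Rightarrow> ('a \<Rightarrow> 'e::real_vector) set \<Rightarrow> ('a \<Rightarrow> 'e) set" where
  "fun_span R S =
     {Y. \<exists>(k::nat) f X. (\<forall>i<k. f i \<in> R \<and> X i \<in> S) \<and> Y = (\<lambda>p. \<Sum>i<k. f i p *\<^sub>R X i p)}"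

text \<open>
  The local generators \<open>X \<in> \<XX>(U)\<close> are total functions whose values outside \<open>U\<close> are irrelevant,
  as the coefficients in \<open>C\<^sub>c\<^sup>\<infinity>(U)\<close> vanish there.
\<close>

definition singular_foliation ::
  "('a::topological_space, 'e::real_normed_vector) manifold \<Rightarrow> ('a \<Rightarrow> 'e) set \<Rightarrow> bool" where
  "singular_foliation M F \<longleftrightarrow>
     F \<subseteq> compact_vfs M \<and>
     (\<lambda>p. 0) \<in> F \<and>
     (\<forall>X\<in>F. \<forall>Y\<in>F. (\<lambda>p. X p + Y p) \<in> F) \<and>
     (\<forall>f. \<forall>X\<in>F. smooth_fun M f \<longrightarrow> (\<lambda>p. f p *\<^sub>R X p) \<in> F) \<and>
     (\<forall>X\<in>F. \<forall>Y\<in>F. lie_bracket M X Y \<in> F) \<and>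
     (\<forall>q. \<exists>U G. open U \<and> q \<in> U \<and> finite G \<and> (\<forall>X\<in>G. smooth_vf_on M U X) \<and>
        {X\<in>F. supp X \<subseteq> U} = fun_span (Cc_smooth M U) G)"

definition integral_curve ::
  "('a::topological_space, 'e::real_normed_vector) manifold \<Rightarrow> ('a \<Rightarrow> 'e) \<Rightarrow> (real \<Rightarrow> 'a) \<Rightarrow> bool"
  where
  "integral_curve M X \<gamma> \<longleftrightarrow>
     continuous_on UNIV \<gamma> \<and>
     (\<forall>t. ((coord (chart_at M (\<gamma> t)) \<circ> \<gamma>) has_vector_derivative X (\<gamma> t)) (at t))"

text \<open>
  The leaves are the orbits of the flows of elements of \<open>F\<close> (which are complete, having compact
  support); flow times other than \<open>1\<close> are obtained by rescaling \<open>X\<close>. By the Stefan--Sussmann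
  theorem they are immersed submanifolds, and the tangent space at \<open>q\<close> of the leaf through \<open>q\<close> is
  \<open>F\<^sub>q = {X q | X \<in> F}\<close>, which is what \<open>leaf_tangent\<close> is defined to be.
\<close>

definition leaf ::
  "('a::topological_space, 'e::real_normed_vector) manifold \<Rightarrow> ('a \<Rightarrow> 'e) set \<Rightarrow> 'a \<Rightarrow> 'a set"
  where
  "leaf M F p = {q. (\<lambda>a b. \<exists>X\<in>F. \<exists>\<gamma>. integral_curve M X \<gamma> \<and> \<gamma> 0 = a \<and> \<gamma> 1 = b)\<^sup>*\<^sup>* p q}"

definition leaves ::
  "('a::topological_space, 'e::real_normed_vector) manifold \<Rightarrow> ('a \<Rightarrow> 'e) set \<Rightarrow> 'a set set" where
  "leaves M F = range (leaf M F)"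

definition leaf_tangent :: "('a \<Rightarrow> 'e) set \<Rightarrow> 'a \<Rightarrow> 'e set" where
  "leaf_tangent F q = {X q |X. X \<in> F}"

section \<open>Singular Riemannian foliations\<close>

text \<open>
  The last condition says \<open>\<L>\<^sub>X g = \<Sum>i<k. \<alpha>\<^sub>i \<odot> g\<^sub>\<flat>(Y\<^sub>i)\<close>. A normalising factor
  in the symmetric product \<open>\<odot>\<close> could be absorbed in the one-forms \<open>\<alpha>\<^sub>i\<close>.
\<close>

definition module_SRF ::
  "('a::{t2_space,second_countable_topology}, 'e::finite_dimensional_inner) manifold
     \<Rightarrow> ('a \<Rightarrow> 'e \<Rightarrow> 'e \<Rightarrow> real) \<Rightarrow> ('a \<Rightarrow> 'e) set \<Rightarrow> bool" where
  "module_SRF M g F \<longleftrightarrow>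
     riemannian_manifold M g \<and> singular_foliation M F \<and>
     (\<forall>X\<in>F. \<exists>(k::nat) \<alpha> Y. (\<forall>i<k. smooth_one_form M (\<alpha> i) \<and> Y i \<in> F) \<and>
        (\<forall>p u v. lie_deriv_metric M X g p u v =
           (\<Sum>i<k. \<alpha> i p u * g p (Y i p) v + \<alpha> i p v * g p (Y i p) u)))"

definition orthogonal_to_leaf_at ::
  "('a, 'e::real_normed_vector) manifold \<Rightarrow> ('a \<Rightarrow> 'e \<Rightarrow> 'e \<Rightarrow> real) \<Rightarrow> ('a \<Rightarrow> 'e) set
     \<Rightarrow> (real \<Rightarrow> 'a) \<Rightarrow> 'a set \<Rightarrow> real \<Rightarrow> bool" where
  "orthogonal_to_leaf_at M g F \<gamma> L t \<longleftrightarrow>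
     \<gamma> t \<in> L \<and> (\<forall>v\<in>leaf_tangent F (\<gamma> t). g (\<gamma> t) (velocity M \<gamma> t) v = 0)"

definition geometric_SRF ::
  "('a::{t2_space,second_countable_topology}, 'e::finite_dimensional_inner) manifold
     \<Rightarrow> ('a \<Rightarrow> 'e \<Rightarrow> 'e \<Rightarrow> real) \<Rightarrow> ('a \<Rightarrow> 'e) set \<Rightarrow> bool" where
  "geometric_SRF M g F \<longleftrightarrow>
     riemannian_manifold M g \<and> singular_foliation M F \<and>
     (\<forall>I \<gamma>. geodesic M g I \<gamma> \<longrightarrow>
        (\<exists>L\<in>leaves M F. \<exists>t\<in>I. orthogonal_to_leaf_at M g F \<gamma> L t) \<longrightarrow>
        (\<forall>L\<in>leaves M F. \<forall>t\<in>I. \<gamma> t \<in> L \<longrightarrow> orthogonal_to_leaf_at M g F \<gamma> L t))"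

section \<open>Riemannian submersions and pullback of singular foliations\<close>

definition smooth_map ::
  "('b::topological_space, 'f::real_normed_vector) manifold
     \<Rightarrow> ('a::topological_space, 'e::real_normed_vector) manifold \<Rightarrow> ('b \<Rightarrow> 'a) \<Rightarrow> bool" where
  "smooth_map N M \<pi> \<longleftrightarrow>
     continuous_on UNIV \<pi> \<and>
     (\<forall>c\<in>atlas N. \<forall>d\<in>atlas M.
        smooth_on (coord c ` (cdom c \<inter> \<pi> -` cdom d)) (coord d \<circ> \<pi> \<circ> coord_inv c))"

definition differential ::
  "('b, 'f::real_normed_vector) manifold \<Rightarrow> ('a, 'e::real_normed_vector) manifold
     \<Rightarrow> ('b \<Rightarrow> 'a) \<Rightarrow> 'b \<Rightarrow> 'f \<Rightarrow> 'e" where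
  "differential N M \<pi> q =
     frechet_derivative (coord (chart_at M (\<pi> q)) \<circ> \<pi> \<circ> coord_inv (chart_at N q))
       (at (coord (chart_at N q) q))"

definition smooth_submersion ::
  "('b::topological_space, 'f::real_normed_vector) manifold
     \<Rightarrow> ('a::topological_space, 'e::real_normed_vector) manifold \<Rightarrow> ('b \<Rightarrow> 'a) \<Rightarrow> bool" where
  "smooth_submersion N M \<pi> \<longleftrightarrow> smooth_map N M \<pi> \<and> (\<forall>q. surj (differential N M \<pi> q))"

definition horizontal_space ::
  "('b, 'f::real_normed_vector) manifold \<Rightarrow> ('b \<Rightarrow> 'f \<Rightarrow> 'f \<Rightarrow> real)
     \<Rightarrow> ('a, 'e::real_normed_vector) manifold \<Rightarrow> ('b \<Rightarrow> 'a) \<Rightarrow> 'b \<Rightarrow> 'f set" where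
  "horizontal_space N h M \<pi> q = {u. \<forall>v. differential N M \<pi> q v = 0 \<longrightarrow> h q u v = 0}"

definition riemannian_submersion ::
  "('b::{t2_space,second_countable_topology}, 'f::finite_dimensional_inner) manifold
     \<Rightarrow> ('b \<Rightarrow> 'f \<Rightarrow> 'f \<Rightarrow> real)
     \<Rightarrow> ('a::{t2_space,second_countable_topology}, 'e::finite_dimensional_inner) manifold
     \<Rightarrow> ('a \<Rightarrow> 'e \<Rightarrow> 'e \<Rightarrow> real) \<Rightarrow> ('b \<Rightarrow> 'a) \<Rightarrow> bool" where
  "riemannian_submersion N h M g \<pi> \<longleftrightarrow>
     riemannian_manifold N h \<and> riemannian_manifold M g \<and> smooth_submersion N M \<pi> \<and>
     (\<forall>q. differential N M \<pi> q ` horizontal_space N h M \<pi> q = UNIV \<and>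
        (\<forall>u\<in>horizontal_space N h M \<pi> q. \<forall>v\<in>horizontal_space N h M \<pi> q.
           g (\<pi> q) (differential N M \<pi> q u) (differential N M \<pi> q v) = h q u v))"

definition pullback_foliation ::
  "('b::topological_space, 'f::real_normed_vector) manifold
     \<Rightarrow> ('a, 'e::real_normed_vector) manifold \<Rightarrow> ('b \<Rightarrow> 'a) \<Rightarrow> ('a \<Rightarrow> 'e) set \<Rightarrow> ('b \<Rightarrow> 'f) set"
  where
  "pullback_foliation N M \<pi> F =
     fun_span (Cc_smooth N UNIV)
       {V. smooth_vf_on N UNIV V \<and> (\<exists>X\<in>F. \<forall>q. differential N M \<pi> q (V q) = X (\<pi> q))}"

end

theory Submission
  imports Defs
begin

text \<open>
  Everything rests on one local computation. If \<open>V\<close> on \<open>N\<close> projects to \<open>X\<close> on \<open>M\<close>, then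
  \<open>(\<L>\<^sub>V h)(u, v) = (\<L>\<^sub>X g)(d\<pi> u, d\<pi> v)\<close> for horizontal \<open>u\<close> and \<open>v\<close>: the form \<open>h - \<pi>\<^sup>*g\<close> is
  positive semidefinite and vanishes on horizontal vectors, so its derivative does so, too.

  Module case: \<open>\<L>\<^sub>V h - \<pi>\<^sup>*(\<L>\<^sub>X g)\<close> vanishes on pairs of horizontal vectors, so each of its terms has
  a vertical factor, and vertical vector fields belong to \<open>\<pi>\<^sup>-\<^sup>1F\<close>.

  Geometric case: along a geodesic \<open>\<gamma>\<close> of \<open>N\<close>, the products \<open>m\<^sub>b = h(\<gamma>', W\<^sub>b)\<close> with vertical fields
  \<open>W\<^sub>b\<close> have the derivatives \<open>(\<L>\<^sub>W\<^sub>b h)(\<gamma>', \<gamma>') / 2\<close>, which are linear in the \<open>m\<^sub>b\<close>. Hence a geodesic which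
  is horizontal once is always horizontal. It then projects to a geodesic of \<open>M\<close>, since
  \<open>g((\<pi>\<gamma>)', X) = h(\<gamma>', V)\<close> for the horizontal lift \<open>V\<close> of \<open>X\<close>. The leaf of \<open>\<pi>\<^sup>-\<^sup>1F\<close> through \<open>q\<close> is tangent
  to the preimage under \<open>d\<pi>\<close> of the tangent space of the leaf through \<open>\<pi> q\<close>, so that orthogonality
  to leaves is transported between \<open>\<gamma>\<close> and \<open>\<pi>\<gamma>\<close>.
\<close>

section \<open>Finite-dimensional inner product spaces\<close>

text \<open>The fibres of \<open>\<pi>\<close> need not be compact, so neither lifts of fields in
  \<open>F\<close> nor functions pulled back along \<open>\<pi>\<close> have compact support in
  general. They enter \<open>PF\<close> only after multiplication by a function \<open>f\<close> in
  \<open>Cc_smooth N UNIV\<close>. Often a second function, \<open>\<phi>\<close> or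
  \<open>\<rho>\<close>, is 1 where \<open>f\<close> lives; it turns a local object, or one without
  compact support, into a global admissible one without changing the product. In the module case the
  cutoff costs an extra term, the symmetric product of the differential of \<open>f\<close> with the
  metric dual of the field.

  The vertical space varies with the point and has no preferred frame. The coordinate fields of a
  chart are projected to it instead; they give smooth vertical fields that span but are in general
  linearly dependent. Coefficients are therefore found by expanding in coordinates before
  projecting, or by metric duality (\<open>sharp\<close>), never by inverting a frame.

  In the geometric case no geodesic is lifted or continued: a Gronwall estimate for the sum of the
  squared momenta takes the place of uniqueness of geodesics.\<close>

lemma orthonormal_extension:
  fixes B :: "'a::real_inner set"
  assumes "finite B"
  shows "\<exists>C. finite C \<and> (\<forall>b\<in>C. \<forall>c\<in>C. b \<bullet> c = (if b = c then 1 else 0)) \<and> B \<subseteq> span C"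
  using assms
proof (induction B rule: finite_induct)
  case empty
  show ?case by (rule exI[of _ "{}"]) auto
next
  case (insert b B)
  then obtain C where C: "finite C" "\<forall>b\<in>C. \<forall>c\<in>C. b \<bullet> c = (if b = c then 1 else 0)" "B \<subseteq> span C"
    by blast
  \<comment> \<open>Gram-Schmidt: if the residual of \<open>b\<close> vanishes, \<open>C\<close>
    already spans \<open>b\<close>; otherwise the normalised residual joins
    \<open>C\<close>.\<close>
  define d where "d = b - (\<Sum>c\<in>C. (b \<bullet> c) *\<^sub>R c)"
  have s: "(\<Sum>c\<in>C. (b \<bullet> c) *\<^sub>R c) \<in> span C"
    by (intro span_sum span_scale span_base)
  have dC: "d \<bullet> c = 0" if "c \<in> C" for c
  proof -
    have "(\<Sum>e\<in>C. (b \<bullet> e) * (e \<bullet> c)) = (\<Sum>e\<in>C. if e = c then b \<bullet> e else 0)"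
      using C(2) that by (intro sum.cong) auto
    then show ?thesis
      using that C(1) by (simp add: d_def inner_diff_left inner_sum_left)
  qed
  show ?case
  proof (cases "d = 0")
    case True
    then have "b \<in> span C" using s by (simp add: d_def)
    with C show ?thesis by (intro exI[of _ C] conjI) (simp_all only: insert_subset)
  next
    case False
    define e where "e = (1 / norm d) *\<^sub>R d"
    have "norm e = 1" using False by (simp add: e_def)
    then have e: "e \<bullet> e = 1" by (simp add: norm_eq_1)
    have eC: "e \<bullet> c = 0" if "c \<in> C" for c using dC[OF that] by (simp add: e_def)
    have "e \<notin> C" using e eC by force
    have "b = (\<Sum>c\<in>C. (b \<bullet> c) *\<^sub>R c) + norm d *\<^sub>R e"
      using False by (simp add: e_def d_def)
    also have "\<dots> \<in> span (insert e C)"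
      using s span_mono[of C "insert e C"] span_base[of e "insert e C"]
      by (intro span_add span_scale) auto
    finally have "b \<in> span (insert e C)" .
    moreover have "B \<subseteq> span (insert e C)" using C(3) span_mono[of C "insert e C"] by blast
    moreover have "b' \<bullet> c' = (if b' = c' then 1 else 0)"
      if bc: "b' \<in> insert e C" "c' \<in> insert e C" for b' c'
    proof -
      consider "b' = e" "c' = e" | "b' = e" "c' \<in> C" | "b' \<in> C" "c' = e" | "b' \<in> C" "c' \<in> C"
        using bc by blast
      then show ?thesis
      proof cases
        case 3
        then show ?thesis using eC[of b'] \<open>e \<notin> C\<close> inner_commute[of e b'] by metis
      qed (use C(2) e eC \<open>e \<notin> C\<close> in metis)+
    qed
    ultimately show ?thesis
      using C(1) by (intro exI[of _ "insert e C"] conjI ballI) (simp_all only: insert_subset finite_insert)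
  qed
qed

text \<open>Takes the place of \<open>Basis\<close> for the wider class of model spaces. For the
  zero space it is empty, and the expansions below remain valid as empty sums.\<close>

definition onb :: "'a::finite_dimensional_inner set" where
  "onb = (SOME B. finite B \<and> (\<forall>b\<in>B. \<forall>c\<in>B. b \<bullet> c = (if b = c then 1 else 0)) \<and>
     (\<forall>x. x = (\<Sum>b\<in>B. (x \<bullet> b) *\<^sub>R b)))"

lemma onb_spec:
  "finite (onb::'a::finite_dimensional_inner set) \<and>
   (\<forall>b\<in>(onb::'a set). \<forall>c\<in>onb. b \<bullet> c = (if b = c then 1 else 0)) \<and>
   (\<forall>x::'a. x = (\<Sum>b\<in>onb. (x \<bullet> b) *\<^sub>R b))"
proof -
  obtain B :: "'a set" where B: "finite B" "\<And>x. \<exists>r. x = (\<Sum>b\<in>B. r b *\<^sub>R b)"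
    using finite_dimensional by blast
  obtain C where C: "finite C" "\<forall>b\<in>C. \<forall>c\<in>C. b \<bullet> c = (if b = c then 1 else 0)" "B \<subseteq> span C"
    using orthonormal_extension[OF B(1)] by blast
  have "x = (\<Sum>c\<in>C. (x \<bullet> c) *\<^sub>R c)" for x
  proof -
    obtain r where "x = (\<Sum>b\<in>B. r b *\<^sub>R b)" using B(2) by blast
    then have "x \<in> span C"
      using C(3) by (auto intro!: span_sum span_scale)
    then obtain s where s: "x = (\<Sum>c\<in>C. s c *\<^sub>R c)"
      using C(1) by (auto simp: span_finite)
    have "x \<bullet> c = s c" if "c \<in> C" for c
    proof -
      have "(\<Sum>e\<in>C. s e * (e \<bullet> c)) = (\<Sum>e\<in>C. if e = c then s e else 0)"
        using C(2) that by (intro sum.cong) auto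
      then show ?thesis using that C(1) by (simp add: s inner_sum_left)
    qed
    then show ?thesis by (subst s) (auto intro: sum.cong)
  qed
  with C have "\<exists>B::'a set. finite B \<and> (\<forall>b\<in>B. \<forall>c\<in>B. b \<bullet> c = (if b = c then 1 else 0)) \<and>
     (\<forall>x. x = (\<Sum>b\<in>B. (x \<bullet> b) *\<^sub>R b))" by blast
  then show ?thesis unfolding onb_def by (rule someI_ex)
qed

lemma finite_onb [simp]: "finite (onb::'a::finite_dimensional_inner set)"
  by (rule onb_spec[THEN conjunct1])

lemma onb_inner: "b \<in> onb \<Longrightarrow> c \<in> onb \<Longrightarrow> b \<bullet> c = (if b = c then 1 else 0)"
  by (rule onb_spec[THEN conjunct2, THEN conjunct1, rule_format])

lemma onb_expand: "x = (\<Sum>b\<in>onb. (x \<bullet> b) *\<^sub>R b)"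
  by (rule onb_spec[THEN conjunct2, THEN conjunct2, rule_format])

lemma linear_onb_expand:
  fixes f :: "'a::finite_dimensional_inner \<Rightarrow> 'b::real_vector"
  assumes "linear f"
  shows "f x = (\<Sum>b\<in>onb. (x \<bullet> b) *\<^sub>R f b)"
  by (subst (1) onb_expand[of x]) (simp add: linear_sum[OF assms] linear_scale[OF assms])

text \<open>The box is a Minkowski sum of segments, and sums of compact sets are compact.\<close>

lemma compact_coordinate_box:
  fixes B :: "'a::real_normed_vector set"
  assumes "finite B"
  shows "compact {(\<Sum>b\<in>B. s b *\<^sub>R b) |s. \<forall>b\<in>B. \<bar>s b\<bar> \<le> r}"
  using assms
proof (induction B rule: finite_induct)
  case (insert b B)
  let ?K = "\<lambda>B::'a set. {(\<Sum>b\<in>B. s b *\<^sub>R b) |s. \<forall>b\<in>B. \<bar>s b\<bar> \<le> r}"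
  have "compact ((\<lambda>t. t *\<^sub>R b) ` {-r..r})"
    by (intro compact_continuous_image continuous_intros) auto
  then have c: "compact {x + y |x y. x \<in> (\<lambda>t. t *\<^sub>R b) ` {-r..r} \<and> y \<in> ?K B}"
    using compact_sums insert.IH by blast
  have 1: "{x + y |x y. x \<in> (\<lambda>t. t *\<^sub>R b) ` {-r..r} \<and> y \<in> ?K B} \<subseteq> ?K (insert b B)"
  proof
    fix z assume "z \<in> {x + y |x y. x \<in> (\<lambda>t. t *\<^sub>R b) ` {-r..r} \<and> y \<in> ?K B}"
    then obtain t s where "z = t *\<^sub>R b + (\<Sum>b\<in>B. s b *\<^sub>R b)" "\<bar>t\<bar> \<le> r" "\<forall>b\<in>B. \<bar>s b\<bar> \<le> r"
      by auto
    moreover have "(\<Sum>c\<in>B. s c *\<^sub>R c) = (\<Sum>c\<in>B. (s(b := t)) c *\<^sub>R c)"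
      using insert.hyps by (intro sum.cong) auto
    ultimately show "z \<in> ?K (insert b B)"
      using insert.hyps by (auto intro!: exI[of _ "s(b := t)"])
  qed
  have 2: "?K (insert b B) \<subseteq> {x + y |x y. x \<in> (\<lambda>t. t *\<^sub>R b) ` {-r..r} \<and> y \<in> ?K B}"
  proof
    fix z assume "z \<in> ?K (insert b B)"
    then obtain s where "z = (\<Sum>c\<in>insert b B. s c *\<^sub>R c)" "\<forall>c\<in>insert b B. \<bar>s c\<bar> \<le> r" by blast
    then have "z = s b *\<^sub>R b + (\<Sum>c\<in>B. s c *\<^sub>R c)" "s b \<in> {-r..r}" "\<forall>c\<in>B. \<bar>s c\<bar> \<le> r"
      using insert.hyps by (auto simp: abs_le_iff minus_le_iff)
    then show "z \<in> {x + y |x y. x \<in> (\<lambda>t. t *\<^sub>R b) ` {-r..r} \<and> y \<in> ?K B}" by blast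
  qed
  show ?case using c equalityI[OF 1 2] by simp
next
  case empty
  have "{(\<Sum>b\<in>{}. s b *\<^sub>R b) |s::'a \<Rightarrow> real. \<forall>b\<in>{}. \<bar>s b\<bar> \<le> r} = {0}" by simp
  then show ?case by (simp only: compact_sing)
qed

text \<open>Coordinates in an orthonormal basis are bounded by the norm, so the ball is a closed
  subset of a compact box. Bump functions owe their compact support to this.\<close>

lemma compact_cball_finite_dimensional:
  fixes a :: "'a::finite_dimensional_inner"
  shows "compact (cball a r)"
proof -
  have "cball (0::'a) r \<subseteq> {(\<Sum>b\<in>onb. s b *\<^sub>R b) |s. \<forall>b\<in>onb. \<bar>s b\<bar> \<le> r}"
  proof
    fix x :: 'a assume "x \<in> cball 0 r"
    moreover have "norm b = 1" if "b \<in> onb" for b :: 'a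
      using that by (simp add: norm_eq_1 onb_inner)
    ultimately have "\<forall>b\<in>onb. \<bar>x \<bullet> b\<bar> \<le> r"
      by (metis Cauchy_Schwarz_ineq2 mem_cball_0 mult.right_neutral order_trans)
    then show "x \<in> {(\<Sum>b\<in>onb. s b *\<^sub>R b) |s. \<forall>b\<in>onb. \<bar>s b\<bar> \<le> r}"
      using onb_expand[of x] by blast
  qed
  then have e: "{(\<Sum>b\<in>onb. s b *\<^sub>R b) |s. \<forall>b\<in>onb. \<bar>s b\<bar> \<le> r} \<inter> cball (0::'a) r = cball 0 r"
    by (rule Int_absorb1)
  have "compact (cball (0::'a) r)"
    using compact_Int_closed[OF compact_coordinate_box[OF finite_onb, of r] closed_cball[of "0::'a" r]] unfolding e .
  then have "compact ((+) a ` cball 0 r)"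
    by (rule compact_translation)
  then show ?thesis using cball_translation[of a 0 r] by simp
qed

section \<open>Calculus of smooth functions\<close>

abbreviation Dv :: "('a::real_normed_vector \<Rightarrow> 'b::real_normed_vector) \<Rightarrow> 'a \<Rightarrow> 'a \<Rightarrow> 'b" where
  "Dv f x \<equiv> frechet_derivative f (at x)"

lemma DvI: "(f has_derivative f') (at x) \<Longrightarrow> Dv f x = f'"
  using frechet_derivative_at by metis

lemma has_derivative_cong_nhds:
  assumes "\<forall>\<^sub>F y in nhds x. f y = g y"
  shows "(f has_derivative f') (at x) \<longleftrightarrow> (g has_derivative f') (at x)"
proof -
  obtain U where "open U" "x \<in> U" "\<forall>y\<in>U. f y = g y"
    using assms by (auto simp: eventually_nhds)
  then show ?thesis
    using has_derivative_transform_within_open[of _ f' x UNIV U] by metis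
qed

text \<open>\<open>frechet_derivative\<close> is a choice from the set of derivatives, and this set
  depends only on the germ; the equality therefore holds also where neither function is
  differentiable.\<close>

lemma Dv_cong: "\<forall>\<^sub>F y in nhds x. f y = g y \<Longrightarrow> Dv f x = Dv g x"
  by (simp add: frechet_derivative_def has_derivative_cong_nhds)

lemma differentiable_cong_nhds:
  "\<forall>\<^sub>F y in nhds x. f y = g y \<Longrightarrow> f differentiable (at x) \<longleftrightarrow> g differentiable (at x)"
  by (simp add: differentiable_def has_derivative_cong_nhds)

lemma Dv_works: "f differentiable (at x) \<Longrightarrow> (f has_derivative Dv f x) (at x)"
  using frechet_derivative_works by blast

lemma linear_Dv: "f differentiable (at x) \<Longrightarrow> linear (Dv f x)"
  using linear_frechet_derivative by blast

lemma Ck_on_cong: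
  assumes "open S" "\<And>x. x \<in> S \<Longrightarrow> f x = g x" "Ck_on k S f"
  shows "Ck_on k S g"
  using assms(2,3)
proof (induction k arbitrary: f g)
  case 0
  then show ?case by (simp cong: continuous_on_cong)
next
  case (Suc k)
  have ev: "\<forall>\<^sub>F y in nhds x. f y = g y" if "x \<in> S" for x
    using assms(1) that Suc.prems(1) by (auto simp: eventually_nhds)
  have "Ck_on k S (\<lambda>x. Dv g x v)" for v
    by (rule Suc.IH[of "\<lambda>x. Dv f x v"]) (use Suc.prems Dv_cong[OF ev] in auto)
  then show ?case
    using Suc.prems ev differentiable_cong_nhds by fastforce
qed

lemma Ck_on_subset: "Ck_on k S f \<Longrightarrow> T \<subseteq> S \<Longrightarrow> Ck_on k T f"
  by (induction k arbitrary: f) (auto intro: continuous_on_subset)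

lemma Ck_on_Suc_imp: "Ck_on (Suc k) S f \<Longrightarrow> Ck_on k S f"
proof (induction k arbitrary: f)
  case 0
  then show ?case
    by (auto intro!: continuous_at_imp_continuous_on differentiable_imp_continuous_within)
next
  case (Suc k)
  from Suc.prems have 1: "\<forall>x\<in>S. f differentiable (at x)" "\<And>v. Ck_on (Suc k) S (\<lambda>x. Dv f x v)"
    using Ck_on.simps(2) by blast+
  show ?case
    unfolding Ck_on.simps(2)[of k S f] using 1 Suc.IH by blast
qed

lemma Ck_on_local:
  assumes "\<And>x. x \<in> S \<Longrightarrow> \<exists>U. open U \<and> x \<in> U \<and> Ck_on k U f"
  shows "Ck_on k S f"
  using assms
proof (induction k arbitrary: f)
  case 0
  show ?case unfolding Ck_on.simps
  proof (rule continuous_at_imp_continuous_on, rule ballI)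
    fix x assume "x \<in> S"
    with 0 obtain U where "open U" "x \<in> U" "continuous_on U f" by auto
    then show "isCont f x" by (simp add: continuous_on_eq_continuous_at)
  qed
next
  case (Suc k)
  have "Ck_on k S (\<lambda>x. Dv f x v)" for v
    by (rule Suc.IH) (use Suc.prems in fastforce)
  then show ?case using Suc.prems by fastforce
qed

lemma Ck_on_const: "Ck_on k S (\<lambda>x. c)"
  by (induction k arbitrary: c) auto

lemma Ck_on_bounded_linear:
  assumes "bounded_linear L" "open S" "Ck_on k S f"
  shows "Ck_on k S (\<lambda>x. L (f x))"
  using assms(3)
proof (induction k arbitrary: f)
  case 0
  then show ?case using assms(1) by (auto intro: bounded_linear.continuous_on)
next
  case (Suc k)
  have d: "((\<lambda>x. L (f x)) has_derivative (\<lambda>v. L (Dv f x v))) (at x)" if "x \<in> S" for x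
    using that Suc.prems Dv_works bounded_linear.has_derivative[OF assms(1)] by fastforce
  have "Ck_on k S (\<lambda>x. Dv (\<lambda>x. L (f x)) x v)" for v
    by (rule Ck_on_cong[OF assms(2) _ Suc.IH[of "\<lambda>x. Dv f x v"]])
      (use Suc.prems DvI[OF d] in auto)
  then show ?case using d by (auto simp: differentiable_def)
qed

lemma Ck_on_id: "open S \<Longrightarrow> Ck_on k S (\<lambda>x. x)"
  by (cases k) (auto intro: Ck_on_const)

lemma Ck_on_add:
  assumes "open S" "Ck_on k S f" "Ck_on k S g"
  shows "Ck_on k S (\<lambda>x. f x + g x)"
  using assms(2,3)
proof (induction k arbitrary: f g)
  case 0
  then show ?case by (auto intro: continuous_intros)
next
  case (Suc k)
  have d: "((\<lambda>x. f x + g x) has_derivative (\<lambda>v. Dv f x v + Dv g x v)) (at x)" if "x \<in> S" for x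
    using that Suc.prems by (intro has_derivative_add Dv_works) auto
  have "Ck_on k S (\<lambda>x. Dv (\<lambda>x. f x + g x) x v)" for v
    by (rule Ck_on_cong[OF assms(1) _ Suc.IH[of "\<lambda>x. Dv f x v" "\<lambda>x. Dv g x v"]])
      (use Suc.prems DvI[OF d] in auto)
  then show ?case using d by (auto simp: differentiable_def)
qed

lemma Ck_on_sum:
  assumes "open S" "\<And>i. i \<in> I \<Longrightarrow> Ck_on k S (f i)"
  shows "Ck_on k S (\<lambda>x. \<Sum>i\<in>I. f i x)"
  using assms(2)
  by (induction I rule: infinite_finite_induct) (auto intro: Ck_on_const Ck_on_add[OF assms(1)])

lemma Ck_on_bilinear:
  assumes "bounded_bilinear P" "open S" "Ck_on k S f" "Ck_on k S g"
  shows "Ck_on k S (\<lambda>x. P (f x) (g x))"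
  using assms(3,4)
proof (induction k arbitrary: f g)
  case 0
  then show ?case using bounded_bilinear.continuous_on[OF assms(1)] by auto
next
  case (Suc k)
  have d: "((\<lambda>x. P (f x) (g x)) has_derivative (\<lambda>v. P (f x) (Dv g x v) + P (Dv f x v) (g x))) (at x)"
    if "x \<in> S" for x
    using that Suc.prems by (intro bounded_bilinear.FDERIV[OF assms(1)] Dv_works) auto
  have "Ck_on k S (\<lambda>x. P (f x) (Dv g x v) + P (Dv f x v) (g x))" for v
    using Suc.prems Ck_on_Suc_imp[OF Suc.prems(1)] Ck_on_Suc_imp[OF Suc.prems(2)]
    by (intro Ck_on_add[OF assms(2)] Suc.IH) auto
  then have "Ck_on k S (\<lambda>x. Dv (\<lambda>x. P (f x) (g x)) x v)" for v
    by (rule Ck_on_cong[OF assms(2), rotated]) (use DvI[OF d] in auto)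
  then show ?case using d by (auto simp: differentiable_def)
qed

text \<open>\<open>Ck_on\<close> speaks of derivatives in fixed directions, whereas the chain rule
  differentiates \<open>g\<close> in the moving direction \<open>Dv f x v\<close>. Expanding this
  direction in \<open>onb\<close> leaves fixed directions with scalar coefficients, to which the
  product rule and the induction hypothesis apply.\<close>

lemma Ck_on_compose:
  fixes f :: "'a::real_normed_vector \<Rightarrow> 'b::finite_dimensional_inner"
    and g :: "'b \<Rightarrow> 'c::real_normed_vector"
  assumes "open S" "Ck_on k S f" "Ck_on k T g" "f ` S \<subseteq> T"
  shows "Ck_on k S (\<lambda>x. g (f x))"
  using assms(2,3)
proof (induction k arbitrary: g)
  case 0
  then show ?case using continuous_on_compose2[of T g S f] assms(4) by auto
next
  case (Suc k)
  have d: "((\<lambda>x. g (f x)) has_derivative (\<lambda>v. Dv g (f x) (Dv f x v))) (at x)" if "x \<in> S" for x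
    using that Suc.prems assms(4)
    by (intro has_derivative_compose[where g = g and f = f] Dv_works) auto
  have 1: "Ck_on k S (\<lambda>x. Dv g (f x) b)" for b
    using Suc.IH[of "\<lambda>y. Dv g y b"] Suc.prems(2) Ck_on_Suc_imp[OF Suc.prems(1)] by auto
  have 2: "Ck_on k S (\<lambda>x. Dv f x v \<bullet> b)" for v b
    using Suc.prems(1)
    by (intro Ck_on_bounded_linear[OF bounded_linear_inner_left assms(1)]) auto
  have "Ck_on k S (\<lambda>x. \<Sum>b\<in>onb. (Dv f x v \<bullet> b) *\<^sub>R Dv g (f x) b)" for v
    by (intro Ck_on_sum[OF assms(1)] Ck_on_bilinear[OF bounded_bilinear_scaleR assms(1)] 1 2)
  then have "Ck_on k S (\<lambda>x. Dv (\<lambda>x. g (f x)) x v)" for v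
  proof (rule Ck_on_cong[OF assms(1), rotated])
    fix x assume x: "x \<in> S"
    then have "linear (Dv g (f x))"
      using Suc.prems(2) assms(4) by (intro linear_Dv) auto
    then show "(\<Sum>b\<in>onb. (Dv f x v \<bullet> b) *\<^sub>R Dv g (f x) b) = Dv (\<lambda>x. g (f x)) x v"
      using fun_cong[OF DvI[OF d[OF x]], of v] linear_onb_expand[of "Dv g (f x)" "Dv f x v"] by metis
  qed
  then show ?case using d by (auto simp: differentiable_def)
qed

text \<open>The derivative is a product of \<open>Dv f\<close> with two factors
  \<open>inverse f\<close>, so the induction hypothesis for \<open>inverse f\<close> itself closes
  the step.\<close>

lemma Ck_on_inverse:
  fixes f :: "'a::real_normed_vector \<Rightarrow> real"
  assumes "open S" "Ck_on k S f" "\<And>x. x \<in> S \<Longrightarrow> f x \<noteq> 0"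
  shows "Ck_on k S (\<lambda>x. inverse (f x))"
  using assms(2)
proof (induction k)
  case 0
  then show ?case using assms(3) by (auto intro: continuous_intros)
next
  case (Suc k)
  have d: "((\<lambda>x. inverse (f x)) has_derivative
      (\<lambda>v. - (inverse (f x) * Dv f x v * inverse (f x)))) (at x)" if "x \<in> S" for x
    using that Suc.prems assms(3) by (intro Deriv.has_derivative_inverse Dv_works) auto
  have "Ck_on k S (\<lambda>x. - (inverse (f x) * Dv f x v * inverse (f x)))" for v
    using Suc.prems Suc.IH[OF Ck_on_Suc_imp[OF Suc.prems]]
    by (intro Ck_on_bounded_linear[OF bounded_linear_minus[OF bounded_linear_ident] assms(1)]
        Ck_on_bilinear[OF bounded_bilinear_mult assms(1)]) auto
  then have "Ck_on k S (\<lambda>x. Dv (\<lambda>x. inverse (f x)) x v)" for v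
    by (rule Ck_on_cong[OF assms(1), rotated]) (use DvI[OF d] in auto)
  then show ?case using d by (auto simp: differentiable_def)
qed

text \<open>Smoothness as a property of germs: facts from charts with different domains can then be
  combined by \<open>eventually\<close> in \<open>nhds\<close> instead of by tracking open
  sets.\<close>

definition smooth_at :: "'a::real_normed_vector \<Rightarrow> ('a \<Rightarrow> 'b::real_normed_vector) \<Rightarrow> bool" where
  "smooth_at x f \<longleftrightarrow> (\<exists>U. open U \<and> x \<in> U \<and> smooth_on U f)"

lemma smooth_on_iff_smooth_at:
  assumes "open S"
  shows "smooth_on S f \<longleftrightarrow> (\<forall>x\<in>S. smooth_at x f)"
proof
  assume "\<forall>x\<in>S. smooth_at x f"
  then show "smooth_on S f"
    unfolding smooth_on_def smooth_at_def by (intro allI Ck_on_local) blast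
next
  assume "smooth_on S f"
  with assms show "\<forall>x\<in>S. smooth_at x f" unfolding smooth_at_def by blast
qed

lemma smooth_at_eventually: "smooth_at x f \<Longrightarrow> \<forall>\<^sub>F y in nhds x. smooth_at y f"
  unfolding smooth_at_def eventually_nhds by blast

lemma smooth_at_differentiable: "smooth_at x f \<Longrightarrow> f differentiable (at x)"
  unfolding smooth_at_def smooth_on_def by (metis Ck_on.simps(2))

lemma smooth_at_has_derivative: "smooth_at x f \<Longrightarrow> (f has_derivative Dv f x) (at x)"
  using smooth_at_differentiable Dv_works by blast

lemma smooth_at_linear_Dv: "smooth_at x f \<Longrightarrow> linear (Dv f x)"
  using smooth_at_differentiable linear_Dv by blast

lemma smooth_at_isCont: "smooth_at x f \<Longrightarrow> isCont f x"
  using smooth_at_differentiable differentiable_imp_continuous_within by blast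

lemma isCont_tendsto_nhds: "isCont f x \<Longrightarrow> (f \<longlongrightarrow> f x) (nhds x)"
  by (simp add: isCont_def tendsto_at_iff_tendsto_nhds)

lemma smooth_at_nbhd:
  assumes "smooth_at x f"
  obtains U where "open U" "x \<in> U" "\<forall>k. Ck_on k U f"
proof -
  from assms obtain U where "open U \<and> x \<in> U \<and> (\<forall>k. Ck_on k U f)"
    unfolding smooth_at_def smooth_on_def ..
  then show ?thesis by (intro that[of U]) simp_all
qed

lemma smooth_atI: "open U \<Longrightarrow> x \<in> U \<Longrightarrow> (\<And>k. Ck_on k U f) \<Longrightarrow> smooth_at x f"
  unfolding smooth_at_def smooth_on_def by blast

lemma smooth_at_Dv: "smooth_at x f \<Longrightarrow> smooth_at x (\<lambda>y. Dv f y v)"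
proof (erule smooth_at_nbhd)
  fix U assume "open U" "x \<in> U" "\<forall>k. Ck_on k U f"
  then show ?thesis by (intro smooth_atI[of U]) (metis Ck_on.simps(2))+
qed

lemma smooth_at_nbhd2:
  assumes "smooth_at x f" "smooth_at x g"
  obtains U where "open U" "x \<in> U" "\<forall>k. Ck_on k U f" "\<forall>k. Ck_on k U g"
proof -
  obtain U where U: "open U" "x \<in> U" "\<forall>k. Ck_on k U f" by (rule smooth_at_nbhd[OF assms(1)])
  obtain V where V: "open V" "x \<in> V" "\<forall>k. Ck_on k V g" by (rule smooth_at_nbhd[OF assms(2)])
  show ?thesis
    by (rule that[of "U \<inter> V"])
      (use U V Ck_on_subset[OF U(3)[rule_format] Int_lower1]
        Ck_on_subset[OF V(3)[rule_format] Int_lower2] in auto)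
qed

lemma smooth_at_cong:
  assumes "\<forall>\<^sub>F y in nhds x. f y = g y" "smooth_at x f"
  shows "smooth_at x g"
proof -
  obtain V where V: "open V" "x \<in> V" "\<forall>y\<in>V. f y = g y"
    using assms(1) unfolding eventually_nhds by blast
  obtain U where U: "open U" "x \<in> U" "\<forall>k. Ck_on k U f"
    by (rule smooth_at_nbhd[OF assms(2)])
  have "Ck_on k (U \<inter> V) g" for k
    by (rule Ck_on_cong[OF _ _ Ck_on_subset[OF U(3)[rule_format]]]) (use U(1) V in auto)
  then show ?thesis using U V by (intro smooth_atI[of "U \<inter> V"]) auto
qed

lemma smooth_at_const [simp, intro]: "smooth_at x (\<lambda>y. c)"
  unfolding smooth_at_def smooth_on_def by (auto intro: Ck_on_const)

lemma smooth_at_ident [simp, intro]: "smooth_at x (\<lambda>y. y)"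
  unfolding smooth_at_def smooth_on_def by (auto intro: Ck_on_id)

lemma smooth_at_bounded_linear:
  "bounded_linear L \<Longrightarrow> smooth_at x f \<Longrightarrow> smooth_at x (\<lambda>y. L (f y))"
  unfolding smooth_at_def smooth_on_def by (blast intro: Ck_on_bounded_linear)

lemma smooth_at_bilinear:
  assumes "bounded_bilinear P" "smooth_at x f" "smooth_at x g"
  shows "smooth_at x (\<lambda>y. P (f y) (g y))"
proof -
  obtain U where "open U" "x \<in> U" "\<forall>k. Ck_on k U f" "\<forall>k. Ck_on k U g"
    by (rule smooth_at_nbhd2[OF assms(2,3)])
  then show ?thesis by (intro smooth_atI[of U] Ck_on_bilinear[OF assms(1)]) auto
qed

lemma smooth_at_add [intro]:
  assumes "smooth_at x f" "smooth_at x g"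
  shows "smooth_at x (\<lambda>y. f y + g y)"
proof -
  obtain U where "open U" "x \<in> U" "\<forall>k. Ck_on k U f" "\<forall>k. Ck_on k U g"
    by (rule smooth_at_nbhd2[OF assms])
  then show ?thesis by (intro smooth_atI[of U] Ck_on_add) auto
qed

lemmas smooth_at_scaleR [intro] = smooth_at_bilinear[OF bounded_bilinear_scaleR]
  and smooth_at_inner [intro] = smooth_at_bilinear[OF bounded_bilinear_inner]

lemma smooth_at_mult [intro]:
  fixes f g :: "'a::real_normed_vector \<Rightarrow> real"
  shows "smooth_at x f \<Longrightarrow> smooth_at x g \<Longrightarrow> smooth_at x (\<lambda>y. f y * g y)"
  by (rule smooth_at_bilinear[OF bounded_bilinear_mult])

lemma smooth_at_minus [intro]: "smooth_at x f \<Longrightarrow> smooth_at x (\<lambda>y. - f y)"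
  by (rule smooth_at_bounded_linear[OF bounded_linear_minus[OF bounded_linear_ident]])

lemma smooth_at_diff [intro]: "smooth_at x f \<Longrightarrow> smooth_at x g \<Longrightarrow> smooth_at x (\<lambda>y. f y - g y)"
  using smooth_at_add[of x f "\<lambda>y. - g y"] by auto

lemma smooth_at_sum [intro]:
  "(\<And>i. i \<in> I \<Longrightarrow> smooth_at x (f i)) \<Longrightarrow> smooth_at x (\<lambda>y. \<Sum>i\<in>I. f i y)"
  by (induction I rule: infinite_finite_induct) auto

lemma smooth_at_compose:
  fixes f :: "'a::real_normed_vector \<Rightarrow> 'b::finite_dimensional_inner"
  assumes "smooth_at x f" "smooth_at (f x) g"
  shows "smooth_at x (\<lambda>y. g (f y))"
proof -
  obtain V where V: "open V" "f x \<in> V" "\<forall>k. Ck_on k V g"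
    by (rule smooth_at_nbhd[OF assms(2)])
  obtain W where W: "open W" "x \<in> W" "\<forall>k. Ck_on k W f"
    by (rule smooth_at_nbhd[OF assms(1)])
  have "continuous_on W f" using spec[OF W(3), of 0] by simp
  with W V have o: "open (W \<inter> f -` V)" by (simp add: continuous_open_preimage)
  have "Ck_on k (W \<inter> f -` V) (\<lambda>y. g (f y))" for k
    by (rule Ck_on_compose[OF o Ck_on_subset[OF W(3)[rule_format]] V(3)[rule_format]]) auto
  with o V W show ?thesis by (intro smooth_atI[of "W \<inter> f -` V"]) auto
qed

lemma smooth_at_inverse:
  fixes f :: "'a::real_normed_vector \<Rightarrow> real"
  assumes "smooth_at x f" "f x \<noteq> 0"
  shows "smooth_at x (\<lambda>y. inverse (f y))"
proof -
  obtain W where W: "open W" "x \<in> W" "\<forall>k. Ck_on k W f"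
    by (rule smooth_at_nbhd[OF assms(1)])
  have "continuous_on W f" using spec[OF W(3), of 0] by simp
  with W have o: "open (W \<inter> f -` (- {0}))" by (intro continuous_open_preimage) auto
  have "Ck_on k (W \<inter> f -` (- {0})) (\<lambda>y. inverse (f y))" for k
    by (rule Ck_on_inverse[OF o Ck_on_subset[OF W(3)[rule_format]]]) auto
  with o W assms(2) show ?thesis by (intro smooth_atI[of "W \<inter> f -` (- {0})"]) auto
qed

lemma smooth_at_divide:
  fixes f g :: "'a::real_normed_vector \<Rightarrow> real"
  shows "smooth_at x f \<Longrightarrow> smooth_at x g \<Longrightarrow> g x \<noteq> 0 \<Longrightarrow> smooth_at x (\<lambda>y. f y / g y)"
  unfolding divide_inverse by (intro smooth_at_mult smooth_at_inverse)

section \<open>Rules of differentiation\<close>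

lemma Dv_add:
  "f differentiable (at x) \<Longrightarrow> g differentiable (at x) \<Longrightarrow> Dv (\<lambda>y. f y + g y) x v = Dv f x v + Dv g x v"
  by (rule fun_cong[OF DvI]) (intro has_derivative_add Dv_works)

lemma Dv_diff:
  "f differentiable (at x) \<Longrightarrow> g differentiable (at x) \<Longrightarrow> Dv (\<lambda>y. f y - g y) x v = Dv f x v - Dv g x v"
  by (rule fun_cong[OF DvI]) (intro has_derivative_diff Dv_works)

lemma Dv_sum:
  "(\<And>i. i \<in> I \<Longrightarrow> f i differentiable (at x)) \<Longrightarrow> Dv (\<lambda>y. \<Sum>i\<in>I. f i y) x v = (\<Sum>i\<in>I. Dv (f i) x v)"
  by (rule fun_cong[OF DvI]) (intro has_derivative_sum Dv_works)

lemma Dv_bilinear: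
  "bounded_bilinear P \<Longrightarrow> f differentiable (at x) \<Longrightarrow> g differentiable (at x) \<Longrightarrow>
   Dv (\<lambda>y. P (f y) (g y)) x v = P (f x) (Dv g x v) + P (Dv f x v) (g x)"
  by (rule fun_cong[OF DvI]) (intro bounded_bilinear.FDERIV Dv_works)

lemmas Dv_scaleR = Dv_bilinear[OF bounded_bilinear_scaleR]
  and Dv_mult = Dv_bilinear[OF bounded_bilinear_mult]

lemma Dv_bounded_linear:
  "bounded_linear L \<Longrightarrow> f differentiable (at x) \<Longrightarrow> Dv (\<lambda>y. L (f y)) x v = L (Dv f x v)"
  by (rule fun_cong[OF DvI[OF bounded_linear.has_derivative[OF _ Dv_works]]])

lemma Dv_compose:
  "f differentiable (at x) \<Longrightarrow> g differentiable (at (f x)) \<Longrightarrow>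
   Dv (\<lambda>y. g (f y)) x v = Dv g (f x) (Dv f x v)"
  by (rule fun_cong[OF DvI[OF has_derivative_compose[OF Dv_works Dv_works]]])

lemma Dv_eq_vector_derivative:
  "f differentiable (at t) \<Longrightarrow> Dv f t r = r *\<^sub>R vector_derivative f (at t)"
  by (simp add: frechet_derivative_eq_vector_derivative)

text \<open>Metrics, one-forms and derivatives are controlled only on constant vectors; the
  expansion in \<open>onb\<close> extends this to vectors that move with the point.\<close>

lemma smooth_at_linear_family:
  fixes v :: "'a::real_normed_vector \<Rightarrow> 'b::finite_dimensional_inner"
    and A :: "'a \<Rightarrow> 'b \<Rightarrow> 'c::real_normed_vector"
  assumes "\<forall>\<^sub>F y in nhds x. linear (A y)" "\<And>u. smooth_at x (\<lambda>y. A y u)" "smooth_at x v"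
  shows "smooth_at x (\<lambda>y. A y (v y))"
proof (rule smooth_at_cong)
  show "\<forall>\<^sub>F y in nhds x. (\<Sum>b\<in>onb. (v y \<bullet> b) *\<^sub>R A y b) = A y (v y)"
    using assms(1)
  proof eventually_elim
    case (elim y)
    show ?case by (rule linear_onb_expand[OF elim, symmetric])
  qed
  show "smooth_at x (\<lambda>y. \<Sum>b\<in>onb. (v y \<bullet> b) *\<^sub>R A y b)"
    by (intro smooth_at_sum smooth_at_scaleR smooth_at_inner smooth_at_const assms)
qed

text \<open>The Leibniz rule for evaluation. \<open>A\<close> is smooth only argument by argument,
  so the rule is reduced to the product rule for the scalar coefficients of
  \<open>v\<close>.\<close>

lemma Dv_linear_family:
  fixes v :: "'a::real_normed_vector \<Rightarrow> 'b::finite_dimensional_inner"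
    and A :: "'a \<Rightarrow> 'b \<Rightarrow> 'c::real_normed_vector"
  assumes lin: "\<forall>\<^sub>F y in nhds x. linear (A y)" and A: "\<And>u. smooth_at x (\<lambda>y. A y u)"
    and v: "smooth_at x v"
  shows "Dv (\<lambda>y. A y (v y)) x w = Dv (\<lambda>y. A y (v x)) x w + A x (Dv v x w)"
proof -
  note d = smooth_at_differentiable
  have lx: "linear (A x)" using lin eventually_nhds_x_imp_x by blast
  have ev: "\<forall>\<^sub>F y in nhds x. A y (u y) = (\<Sum>b\<in>onb. (u y \<bullet> b) *\<^sub>R A y b)" for u
    using lin
  proof eventually_elim
    case (elim y)
    show ?case by (rule linear_onb_expand[OF elim])
  qed
  have "Dv (\<lambda>y. A y (v y)) x w = Dv (\<lambda>y. \<Sum>b\<in>onb. (v y \<bullet> b) *\<^sub>R A y b) x w"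
    by (rule fun_cong[OF Dv_cong[OF ev]])
  also have "\<dots> = (\<Sum>b\<in>onb. Dv (\<lambda>y. (v y \<bullet> b) *\<^sub>R A y b) x w)"
    by (intro Dv_sum d smooth_at_scaleR smooth_at_inner smooth_at_const A v)
  also have "\<dots> = (\<Sum>b\<in>onb. (v x \<bullet> b) *\<^sub>R Dv (\<lambda>y. A y b) x w + (Dv v x w \<bullet> b) *\<^sub>R A x b)"
  proof (rule sum.cong[OF refl])
    fix b
    have "smooth_at x (\<lambda>y. v y \<bullet> b)" by (intro smooth_at_inner smooth_at_const v)
    then show "Dv (\<lambda>y. (v y \<bullet> b) *\<^sub>R A y b) x w =
        (v x \<bullet> b) *\<^sub>R Dv (\<lambda>y. A y b) x w + (Dv v x w \<bullet> b) *\<^sub>R A x b"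
      by (subst Dv_scaleR[OF d d[OF A]])
        (simp_all add: Dv_bounded_linear[OF bounded_linear_inner_left d[OF v]])
  qed
  also have "\<dots> = (\<Sum>b\<in>onb. (v x \<bullet> b) *\<^sub>R Dv (\<lambda>y. A y b) x w) + A x (Dv v x w)"
    by (subst linear_onb_expand[OF lx, of "Dv v x w"]) (rule sum.distrib)
  also have "(\<Sum>b\<in>onb. (v x \<bullet> b) *\<^sub>R Dv (\<lambda>y. A y b) x w) =
      (\<Sum>b\<in>onb. Dv (\<lambda>y. (v x \<bullet> b) *\<^sub>R A y b) x w)"
    by (intro sum.cong refl Dv_bounded_linear[OF bounded_linear_scaleR_right d[OF A], symmetric])
  also have "\<dots> = Dv (\<lambda>y. \<Sum>b\<in>onb. (v x \<bullet> b) *\<^sub>R A y b) x w"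
    by (intro Dv_sum[symmetric] d smooth_at_scaleR smooth_at_const A)
  also have "\<dots> = Dv (\<lambda>y. A y (v x)) x w"
    by (rule fun_cong[OF Dv_cong[OF ev], symmetric])
  finally show ?thesis .
qed

lemma smooth_at_Dv_family:
  fixes f :: "'a::finite_dimensional_inner \<Rightarrow> 'b::real_normed_vector"
  assumes "smooth_at x f" "smooth_at x v"
  shows "smooth_at x (\<lambda>y. Dv f y (v y))"
proof (rule smooth_at_linear_family[where A = "Dv f", OF _ smooth_at_Dv[OF assms(1)] assms(2)])
  show "\<forall>\<^sub>F y in nhds x. linear (Dv f y)"
    using smooth_at_eventually[OF assms(1)] by eventually_elim (rule smooth_at_linear_Dv)
qed

lemma Dv_Dv_family:
  fixes f :: "'a::finite_dimensional_inner \<Rightarrow> 'b::real_normed_vector"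
  assumes "smooth_at x f" "smooth_at x v"
  shows "Dv (\<lambda>y. Dv f y (v y)) x w = Dv (\<lambda>y. Dv f y (v x)) x w + Dv f x (Dv v x w)"
proof (rule Dv_linear_family[where A = "Dv f", OF _ smooth_at_Dv[OF assms(1)] assms(2)])
  show "\<forall>\<^sub>F y in nhds x. linear (Dv f y)"
    using smooth_at_eventually[OF assms(1)] by eventually_elim (rule smooth_at_linear_Dv)
qed

subsection \<open>Symmetry of second derivatives\<close>

text \<open>Two applications of the mean value theorem, first along \<open>u\<close>, then along
  \<open>v\<close>. The left-hand side is symmetric in \<open>u\<close> and \<open>v\<close>, which
  is the source of the symmetry of second derivatives. The bound on \<open>h\<close> keeps the
  parallelogram inside the ball.\<close>

lemma second_difference_mean_value:
  fixes f :: "'a::real_normed_vector \<Rightarrow> real"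
  assumes sm: "\<And>y. y \<in> ball x r \<Longrightarrow> smooth_at y f"
    and h: "0 < h" "h * (norm u + norm v) < r"
  shows "\<exists>s t. 0 < s \<and> s < h \<and> 0 < t \<and> t < h \<and>
    f (x + h *\<^sub>R u + h *\<^sub>R v) - f (x + h *\<^sub>R u) - f (x + h *\<^sub>R v) + f x =
    h * h * Dv (\<lambda>y. Dv f y u) (x + s *\<^sub>R u + t *\<^sub>R v) v"
proof -
  have inb: "x + s *\<^sub>R u + t *\<^sub>R v \<in> ball x r" if "0 \<le> s" "s \<le> h" "0 \<le> t" "t \<le> h" for s t
  proof -
    have "norm (s *\<^sub>R u + t *\<^sub>R v) \<le> s * norm u + t * norm v"
      using norm_triangle_ineq[of "s *\<^sub>R u" "t *\<^sub>R v"] that by simp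
    also have "\<dots> \<le> h * norm u + h * norm v"
      using that by (intro add_mono mult_right_mono) auto
    finally show ?thesis using h(2) by (simp add: dist_norm algebra_simps norm_minus_commute)
  qed
  have d1: "((\<lambda>s. f (x + s *\<^sub>R u + t *\<^sub>R v)) has_real_derivative Dv f (x + s *\<^sub>R u + t *\<^sub>R v) u) (at s)"
    if "0 \<le> s" "s \<le> h" "0 \<le> t" "t \<le> h" for s t
  proof -
    let ?y = "x + s *\<^sub>R u + t *\<^sub>R v"
    have "((\<lambda>s. x + s *\<^sub>R u + t *\<^sub>R v) has_derivative (\<lambda>k. k *\<^sub>R u)) (at s)"
      by (auto intro!: derivative_eq_intros)
    from has_derivative_compose[OF this smooth_at_has_derivative[OF sm[OF inb[OF that]]]]
    have "((\<lambda>s. f (x + s *\<^sub>R u + t *\<^sub>R v)) has_derivative (\<lambda>k. Dv f ?y (k *\<^sub>R u))) (at s)" .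
    moreover have "Dv f ?y (k *\<^sub>R u) = Dv f ?y u * k" for k
      using linear_scale[OF smooth_at_linear_Dv[OF sm[OF inb[OF that]]]] by simp
    ultimately show ?thesis by (simp add: has_field_derivative_def)
  qed
  have d2: "((\<lambda>t. Dv f (x + s *\<^sub>R u + t *\<^sub>R v) u) has_real_derivative
      Dv (\<lambda>y. Dv f y u) (x + s *\<^sub>R u + t *\<^sub>R v) v) (at t)"
    if "0 \<le> s" "s \<le> h" "0 \<le> t" "t \<le> h" for s t
  proof -
    let ?y = "x + s *\<^sub>R u + t *\<^sub>R v"
    let ?g = "\<lambda>y. Dv f y u"
    have g: "smooth_at ?y ?g" by (intro smooth_at_Dv sm inb that)
    have "((\<lambda>t. x + s *\<^sub>R u + t *\<^sub>R v) has_derivative (\<lambda>k. k *\<^sub>R v)) (at t)"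
      by (auto intro!: derivative_eq_intros)
    from has_derivative_compose[OF this smooth_at_has_derivative[OF g]]
    have "((\<lambda>t. ?g (x + s *\<^sub>R u + t *\<^sub>R v)) has_derivative (\<lambda>k. Dv ?g ?y (k *\<^sub>R v))) (at t)" .
    moreover have "Dv ?g ?y (k *\<^sub>R v) = Dv ?g ?y v * k" for k
      using linear_scale[OF smooth_at_linear_Dv[OF g]] by simp
    ultimately show ?thesis by (simp add: has_field_derivative_def)
  qed
  \<comment> \<open>The mean value theorem is applied to the difference of \<open>f\<close> between
    the edges at heights \<open>h\<close> and \<open>0\<close>; the terms with factor
    \<open>0\<close> give both edges the shape of \<open>d1\<close>.\<close>
  obtain s where s: "0 < s" "s < h" and
    1: "(f (x + h *\<^sub>R u + h *\<^sub>R v) - f (x + h *\<^sub>R u + 0 *\<^sub>R v))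
       - (f (x + 0 *\<^sub>R u + h *\<^sub>R v) - f (x + 0 *\<^sub>R u + 0 *\<^sub>R v)) =
      (h - 0) * (Dv f (x + s *\<^sub>R u + h *\<^sub>R v) u - Dv f (x + s *\<^sub>R u + 0 *\<^sub>R v) u)"
    using MVT2[of 0 h "\<lambda>s. f (x + s *\<^sub>R u + h *\<^sub>R v) - f (x + s *\<^sub>R u + 0 *\<^sub>R v)"
        "\<lambda>s. Dv f (x + s *\<^sub>R u + h *\<^sub>R v) u - Dv f (x + s *\<^sub>R u + 0 *\<^sub>R v) u"] h(1)
      DERIV_diff[OF d1[of _ h] d1[of _ 0]]
    by auto
  obtain t where t: "0 < t" "t < h" and
    2: "Dv f (x + s *\<^sub>R u + h *\<^sub>R v) u - Dv f (x + s *\<^sub>R u + 0 *\<^sub>R v) u =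
      (h - 0) * Dv (\<lambda>y. Dv f y u) (x + s *\<^sub>R u + t *\<^sub>R v) v"
    using MVT2[of 0 h "\<lambda>t. Dv f (x + s *\<^sub>R u + t *\<^sub>R v) u"
        "\<lambda>t. Dv (\<lambda>y. Dv f y u) (x + s *\<^sub>R u + t *\<^sub>R v) v"] h(1) d2[of s] s by auto
  show ?thesis
    using 1 2 s t by - (rule exI[of _ s], rule exI[of _ t], simp add: algebra_simps)
qed

text \<open>Both mixed derivatives, taken at suitable points of a small parallelogram, equal the
  same second difference divided by \<open>h * h\<close>. Continuity keeps each of them within half
  of the supposed gap from its value at \<open>x\<close>, a contradiction.\<close>

lemma Dv_Dv_commute_real:
  fixes f :: "'a::real_normed_vector \<Rightarrow> real"
  assumes "smooth_at x f"
  shows "Dv (\<lambda>y. Dv f y u) x v = Dv (\<lambda>y. Dv f y v) x u"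
proof (rule ccontr)
  let ?P = "\<lambda>y. Dv (\<lambda>y. Dv f y u) y v" and ?Q = "\<lambda>y. Dv (\<lambda>y. Dv f y v) y u"
  assume "?P x \<noteq> ?Q x"
  define e where "e = \<bar>?P x - ?Q x\<bar> / 2"
  have e: "e > 0" using \<open>?P x \<noteq> ?Q x\<close> by (simp add: e_def)
  have "isCont ?P x" "isCont ?Q x" using assms by (intro smooth_at_isCont smooth_at_Dv; assumption)+
  from this[THEN isCont_tendsto_nhds, THEN tendstoD, OF e]
  have "\<forall>\<^sub>F y in nhds x. dist (?P y) (?P x) < e" "\<forall>\<^sub>F y in nhds x. dist (?Q y) (?Q x) < e" .
  with smooth_at_eventually[OF assms]
  have "\<forall>\<^sub>F y in nhds x. smooth_at y f \<and> dist (?P y) (?P x) < e \<and> dist (?Q y) (?Q x) < e"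
    by eventually_elim auto
  then obtain r where r: "r > 0" and
    R: "\<And>y. dist y x < r \<Longrightarrow> smooth_at y f \<and> dist (?P y) (?P x) < e \<and> dist (?Q y) (?Q x) < e"
    unfolding eventually_nhds_metric by blast
  \<comment> \<open>The summand \<open>1\<close> keeps the denominator positive when
    \<open>u\<close> and \<open>v\<close> vanish.\<close>
  define h where "h = r / (2 * (norm u + norm v + 1))"
  have n: "norm u + norm v + 1 > 0" by (smt (verit) norm_ge_zero)
  have h: "h > 0" using r n by (simp add: h_def)
  have "h * (norm u + norm v + 1) = r / 2" using n by (simp add: h_def field_simps)
  then have hr: "h * (norm u + norm v) < r" using r h by (simp add: algebra_simps)
  have sm: "\<And>y. y \<in> ball x r \<Longrightarrow> smooth_at y f" using R by (simp add: dist_commute)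
  have hr': "h * (norm v + norm u) < r" using hr by (simp add: add.commute)
  have db: "dist (x + s *\<^sub>R u + t *\<^sub>R v) x < r" if "0 < s" "s < h" "0 < t" "t < h" for s t
  proof -
    have "norm (s *\<^sub>R u + t *\<^sub>R v) \<le> s * norm u + t * norm v"
      using norm_triangle_ineq[of "s *\<^sub>R u" "t *\<^sub>R v"] that by simp
    also have "\<dots> \<le> h * norm u + h * norm v"
      using that by (intro add_mono mult_right_mono) auto
    finally show ?thesis using hr by (simp add: dist_norm algebra_simps)
  qed
  obtain s t where st: "0 < s" "s < h" "0 < t" "t < h" and
    1: "f (x + h *\<^sub>R u + h *\<^sub>R v) - f (x + h *\<^sub>R u) - f (x + h *\<^sub>R v) + f x =
    h * h * ?P (x + s *\<^sub>R u + t *\<^sub>R v)"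
    using second_difference_mean_value[OF sm h hr] by blast
  obtain s' t' where st': "0 < s'" "s' < h" "0 < t'" "t' < h" and
    2: "f (x + h *\<^sub>R v + h *\<^sub>R u) - f (x + h *\<^sub>R v) - f (x + h *\<^sub>R u) + f x =
    h * h * ?Q (x + s' *\<^sub>R v + t' *\<^sub>R u)"
    using second_difference_mean_value[OF sm h hr'] by blast
  have "h * h * ?P (x + s *\<^sub>R u + t *\<^sub>R v) = h * h * ?Q (x + t' *\<^sub>R u + s' *\<^sub>R v)"
    using 1 2 by (simp add: algebra_simps)
  then have "?P (x + s *\<^sub>R u + t *\<^sub>R v) = ?Q (x + t' *\<^sub>R u + s' *\<^sub>R v)" using h by simp
  moreover have "\<bar>?P (x + s *\<^sub>R u + t *\<^sub>R v) - ?P x\<bar> < e"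
    using R[OF db[OF st]] by (simp add: dist_real_def)
  moreover have "\<bar>?Q (x + t' *\<^sub>R u + s' *\<^sub>R v) - ?Q x\<bar> < e"
    using R[OF db[OF st'(3,4,1,2)]] by (simp add: dist_real_def)
  ultimately have "\<bar>?P x - ?Q x\<bar> < 2 * e" unfolding abs_less_iff by linarith
  then show False by (simp add: e_def)
qed

lemma Dv_Dv_commute:
  fixes f :: "'a::real_normed_vector \<Rightarrow> 'b::real_inner"
  assumes "smooth_at x f"
  shows "Dv (\<lambda>y. Dv f y u) x v = Dv (\<lambda>y. Dv f y v) x u"
proof -
  note bl = bounded_linear_inner_left and d = smooth_at_differentiable
  have *: "Dv (\<lambda>y. Dv f y u) x v \<bullet> w = Dv (\<lambda>y. Dv (\<lambda>z. f z \<bullet> w) y u) x v" for u v w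
  proof -
    have "\<forall>\<^sub>F y in nhds x. Dv f y u \<bullet> w = Dv (\<lambda>z. f z \<bullet> w) y u"
      using smooth_at_eventually[OF assms]
      by eventually_elim (rule Dv_bounded_linear[OF bl d, symmetric])
    from fun_cong[OF Dv_cong[OF this]] show ?thesis
      by (simp only: Dv_bounded_linear[OF bl d[OF smooth_at_Dv[OF assms]]])
  qed
  have "smooth_at x (\<lambda>z. f z \<bullet> w)" for w
    by (rule smooth_at_bounded_linear[OF bl assms])
  then have "Dv (\<lambda>y. Dv f y u) x v \<bullet> w = Dv (\<lambda>y. Dv f y v) x u \<bullet> w" for w
    unfolding * by (rule Dv_Dv_commute_real)
  then show ?thesis by (rule vector_eq_rdot[THEN iffD1, OF allI])
qed

subsection \<open>A smooth step function\<close>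

text \<open>The family over all \<open>n\<close> is closed under differentiation up to linear
  combinations, so one induction on the order gives smoothness of all members at once.\<close>

definition flat_exp :: "nat \<Rightarrow> real \<Rightarrow> real" where
  "flat_exp n t = (if t > 0 then inverse t ^ n * exp (- inverse t) else 0)"

lemma flat_exp_tendsto_0: "(flat_exp n \<longlongrightarrow> 0) (at_right 0)"
proof -
  have "((\<lambda>t. (inverse t) ^ n / exp (inverse t)) \<longlongrightarrow> 0) (at_right (0::real))"
    using filterlim_compose[OF tendsto_power_div_exp_0 filterlim_inverse_at_top_right] .
  then show ?thesis
    by (rule Lim_transform_eventually)
      (simp add: flat_exp_def eventually_at_right_less exp_minus divide_inverse
        eventually_mono[OF eventually_at_right_less])
qed

lemma flat_exp_deriv:
  "(flat_exp n has_real_derivative (flat_exp (n + 2) t - n * flat_exp (n + 1) t)) (at t)"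
proof -
  consider "t > 0" | "t < 0" | "t = 0" by linarith
  then show ?thesis
  proof cases
    case 1
    have "((\<lambda>t. inverse t ^ n) has_real_derivative - (real n * inverse t ^ (n + 1))) (at t)"
    proof (rule DERIV_cong[OF DERIV_power[OF DERIV_inverse]])
      show "real n * (- (inverse t ^ Suc (Suc 0)) * inverse t ^ (n - Suc 0)) =
          - (real n * inverse t ^ (n + 1))"
        by (cases n) auto
    qed (use 1 in simp)
    moreover have "((\<lambda>t. exp (- inverse t)) has_real_derivative exp (- inverse t) * inverse t ^ 2) (at t)"
      using 1 by (auto intro!: derivative_eq_intros simp: power2_eq_square)
    ultimately have "((\<lambda>t. inverse t ^ n * exp (- inverse t)) has_real_derivative
        (flat_exp (n + 2) t - n * flat_exp (n + 1) t)) (at t)"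
      by (rule DERIV_cong[OF DERIV_mult])
        (use 1 in \<open>simp add: flat_exp_def algebra_simps power2_eq_square\<close>)
    then show ?thesis
      by (rule has_field_derivative_transform_within_open[of _ _ _ "{0<..}"])
        (use 1 in \<open>auto simp: flat_exp_def\<close>)
  next
    case 2
    have "((\<lambda>t. 0) has_real_derivative 0) (at t)" by simp
    then have "(flat_exp n has_real_derivative 0) (at t)"
      by (rule has_field_derivative_transform_within_open[of _ _ _ "{..<0}"])
        (use 2 in \<open>auto simp: flat_exp_def\<close>)
    then show ?thesis using 2 by (simp add: flat_exp_def)
  next
    case 3
    \<comment> \<open>From the right the difference quotient at \<open>0\<close> is
      \<open>flat_exp (Suc n)\<close>; from the left it vanishes.\<close>
    have "((\<lambda>h. (flat_exp n (0 + h) - flat_exp n 0) / h) \<longlongrightarrow> 0) (at 0)"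
    proof (rule filterlim_split_at_real)
      show "((\<lambda>h. (flat_exp n (0 + h) - flat_exp n 0) / h) \<longlongrightarrow> 0) (at_left 0)"
        by (rule Lim_transform_eventually[OF tendsto_const])
          (auto simp: flat_exp_def eventually_at_filter)
      show "((\<lambda>h. (flat_exp n (0 + h) - flat_exp n 0) / h) \<longlongrightarrow> 0) (at_right 0)"
        by (rule Lim_transform_eventually[OF flat_exp_tendsto_0[of "Suc n"]])
          (auto simp: flat_exp_def eventually_at_filter divide_inverse)
    qed
    then show ?thesis using 3 by (simp add: DERIV_def flat_exp_def)
  qed
qed

lemma smooth_at_flat_exp: "smooth_at t (flat_exp n)"
proof -
  have "Ck_on k UNIV (flat_exp n)" for k
  proof (induction k arbitrary: n)
    case 0
    show ?case
      using DERIV_isCont[OF flat_exp_deriv] by (simp add: continuous_at_imp_continuous_on)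
  next
    case (Suc k)
    have d: "(flat_exp n has_derivative (\<lambda>v. (flat_exp (n + 2) t - n * flat_exp (n + 1) t) * v)) (at t)"
      for t using flat_exp_deriv[of n t] by (simp add: has_field_derivative_def)
    have "Ck_on k UNIV (\<lambda>t. (flat_exp (n + 2) t + (- real n) * flat_exp (n + 1) t) * v)" for v
      by (intro Ck_on_bilinear[OF bounded_bilinear_mult] Ck_on_add Ck_on_const Suc.IH) auto
    then have "Ck_on k UNIV (\<lambda>t. Dv (flat_exp n) t v)" for v
      using DvI[OF d] by simp
    then show ?case using d by (auto simp: differentiable_def)
  qed
  then show ?thesis unfolding smooth_at_def smooth_on_def by blast
qed

definition smooth_step :: "real \<Rightarrow> real" where
  "smooth_step t = flat_exp 0 t / (flat_exp 0 t + flat_exp 0 (1 - t))"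

lemma smooth_step_eq: "t \<le> 0 \<Longrightarrow> smooth_step t = 0" "t \<ge> 1 \<Longrightarrow> smooth_step t = 1"
  by (auto simp: smooth_step_def flat_exp_def)

lemma smooth_at_smooth_step: "smooth_at t smooth_step"
proof -
  have "smooth_at t (\<lambda>s. flat_exp 0 (1 - s))"
    by (rule smooth_at_compose[of t "\<lambda>s. 1 - s", OF _ smooth_at_flat_exp]) auto
  \<comment> \<open>At least one of \<open>t\<close> and \<open>1 - t\<close> is positive, and
    neither summand is negative.\<close>
  moreover have "flat_exp 0 t + flat_exp 0 (1 - t) \<noteq> 0"
    by (auto simp: flat_exp_def) (smt (verit) exp_gt_zero)+
  ultimately show ?thesis
    unfolding smooth_step_def[abs_def] by (intro smooth_at_divide smooth_at_add smooth_at_flat_exp)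
qed

section \<open>Smooth families of inner products\<close>

definition inner_form :: "('a::real_vector \<Rightarrow> 'a \<Rightarrow> real) \<Rightarrow> bool" where
  "inner_form h \<longleftrightarrow> bilinear h \<and> (\<forall>u v. h u v = h v u) \<and> (\<forall>u. u \<noteq> 0 \<longrightarrow> h u u > 0)"

lemma inner_formD:
  assumes "inner_form h"
  shows inner_form_bilinear: "bilinear h" and inner_form_sym: "h u v = h v u"
    and inner_form_pos: "u \<noteq> 0 \<Longrightarrow> h u u > 0" and inner_form_nonneg: "h u u \<ge> 0"
proof -
  show b: "bilinear h" "h u v = h v u" "u \<noteq> 0 \<Longrightarrow> h u u > 0"
    using assms by (auto simp: inner_form_def)
  show "h u u \<ge> 0"
    using b(1,3) bilinear_lzero by (cases "u = 0") (force, simp add: less_imp_le)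
qed

lemma inner_form_eqI:
  assumes "inner_form h" "\<And>w. h z w = h z' w"
  shows "z = z'"
proof (rule ccontr)
  assume "z \<noteq> z'"
  then have "h (z - z') (z - z') > 0" using assms(1) inner_form_pos by force
  moreover have "h (z - z') (z - z') = h z (z - z') - h z' (z - z')"
    using assms(1) by (simp add: bilinear_lsub inner_form_bilinear)
  ultimately show False using assms(2) by simp
qed

text \<open>Kept apart from \<open>metric_at\<close> because pullbacks under submersions and Lie
  derivatives of metrics are not positive definite.\<close>

definition bilin_at ::
  "'a::real_normed_vector \<Rightarrow> ('a \<Rightarrow> 'b::finite_dimensional_inner \<Rightarrow> 'b \<Rightarrow> real) \<Rightarrow> bool" where
  "bilin_at x h \<longleftrightarrow> (\<forall>\<^sub>F y in nhds x. bilinear (h y)) \<and> (\<forall>u v. smooth_at x (\<lambda>y. h y u v))"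

definition metric_at ::
  "'a::real_normed_vector \<Rightarrow> ('a \<Rightarrow> 'b::finite_dimensional_inner \<Rightarrow> 'b \<Rightarrow> real) \<Rightarrow> bool" where
  "metric_at x h \<longleftrightarrow> (\<forall>\<^sub>F y in nhds x. inner_form (h y)) \<and> (\<forall>u v. smooth_at x (\<lambda>y. h y u v))"

lemma metric_at_bilin_at: "metric_at x h \<Longrightarrow> bilin_at x h"
  unfolding metric_at_def bilin_at_def by (blast intro: eventually_mono inner_form_bilinear)

lemma metric_at_inner_form: "metric_at x h \<Longrightarrow> inner_form (h x)"
  unfolding metric_at_def using eventually_nhds_x_imp_x by blast

lemma bilin_at_bilinear: "bilin_at x h \<Longrightarrow> bilinear (h x)"
  unfolding bilin_at_def using eventually_nhds_x_imp_x by blast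

lemma bilin_at_eventually: "bilin_at x h \<Longrightarrow> \<forall>\<^sub>F y in nhds x. bilinear (h y)"
  unfolding bilin_at_def by blast

lemma bilin_at_linear:
  assumes "bilin_at x h"
  shows "\<forall>\<^sub>F y in nhds x. linear (h y (v y))" "\<forall>\<^sub>F y in nhds x. linear (\<lambda>a. h y a (v y))"
proof -
  show "\<forall>\<^sub>F y in nhds x. linear (h y (v y))"
    using bilin_at_eventually[OF assms] by eventually_elim (simp add: bilinear_def)
  show "\<forall>\<^sub>F y in nhds x. linear (\<lambda>a. h y a (v y))"
    using bilin_at_eventually[OF assms] by eventually_elim (simp add: bilinear_def)
qed

lemma smooth_at_bilin:
  assumes h: "bilin_at x h" and v: "smooth_at x v" and w: "smooth_at x w"
  shows "smooth_at x (\<lambda>y. h y (v y) (w y))"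
proof -
  have s: "smooth_at x (\<lambda>y. h y a u)" for a u using h by (simp add: bilin_at_def)
  have 1: "smooth_at x (\<lambda>y. h y (v y) u)" for u
    by (rule smooth_at_linear_family[where A = "\<lambda>y a. h y a u", OF bilin_at_linear(2)[OF h] s v])
  show ?thesis
    by (rule smooth_at_linear_family[where A = "\<lambda>y. h y (v y)", OF bilin_at_linear(1)[OF h] 1 w])
qed

lemma Dv_bilin:
  assumes h: "bilin_at x h" and v: "smooth_at x v" and w: "smooth_at x w"
  shows "Dv (\<lambda>y. h y (v y) (w y)) x a =
    Dv (\<lambda>y. h y (v x) (w x)) x a + h x (Dv v x a) (w x) + h x (v x) (Dv w x a)"
proof -
  have s: "smooth_at x (\<lambda>y. h y a u)" for a u using h by (simp add: bilin_at_def)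
  have 1: "Dv (\<lambda>y. h y (v y) (w y)) x a = Dv (\<lambda>y. h y (v y) (w x)) x a + h x (v x) (Dv w x a)"
    by (rule Dv_linear_family[where A = "\<lambda>y. h y (v y)",
          OF bilin_at_linear(1)[OF h] smooth_at_bilin[OF h v smooth_at_const] w])
  have 2: "Dv (\<lambda>y. h y (v y) (w x)) x a = Dv (\<lambda>y. h y (v x) (w x)) x a + h x (Dv v x a) (w x)"
    by (rule Dv_linear_family[where A = "\<lambda>y a. h y a (w x)", OF bilin_at_linear(2)[OF h] s v])
  from 1 2 show ?thesis by simp
qed

lemma orthonormal_span_disjoint:
  fixes A :: "'a::finite_dimensional_inner set"
  assumes "A \<subseteq> onb" "b \<in> onb" "b \<notin> A" "y \<in> span A"
  shows "y \<bullet> b = 0"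
proof -
  have *: "a \<bullet> b = 0" if "a \<in> A" for a using assms(1-3) that onb_inner[of a b] by auto
  from assms(4) show ?thesis
    by (induction rule: span_induct_alt) (simp_all add: inner_left_distrib *)
qed

text \<open>Smooth dependence of the solution of a linear system, by Gram-Schmidt with respect to
  the varying form \<open>h y\<close> instead of a matrix inverse. The new vector \<open>b\<close>
  is replaced by its part \<open>c\<close> orthogonal to \<open>span A\<close>, and the old solution
  \<open>z\<close> is corrected by a multiple of \<open>c\<close>, which leaves the pairings with
  \<open>span A\<close> unchanged.\<close>

lemma solve_on_span:
  fixes h :: "'a::real_normed_vector \<Rightarrow> 'b::finite_dimensional_inner \<Rightarrow> 'b \<Rightarrow> real"
  assumes h: "metric_at x h" and "finite A" "A \<subseteq> (onb::'b set)"
    and "\<forall>\<^sub>F y in nhds x. linear (\<omega> y)" "\<And>u. smooth_at x (\<lambda>y. \<omega> y u)"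
  shows "\<exists>z. smooth_at x z \<and>
    (\<forall>\<^sub>F y in nhds x. z y \<in> span A \<and> (\<forall>w\<in>span A. h y (z y) w = \<omega> y w))"
  using assms(2-5)
proof (induction A arbitrary: \<omega> rule: finite_induct)
  case empty
  have "\<forall>\<^sub>F y in nhds x. h y 0 0 = \<omega> y 0"
    using bilin_at_eventually[OF metric_at_bilin_at[OF h]] empty.prems(2)
    by eventually_elim (simp add: linear_0 bilinear_lzero)
  then show ?case
    by (intro exI[of _ "\<lambda>_. 0"]) simp
next
  case (insert b A)
  have ip: "\<forall>\<^sub>F y in nhds x. inner_form (h y)" using h metric_at_def by blast
  obtain z where z: "smooth_at x z"
    "\<forall>\<^sub>F y in nhds x. z y \<in> span A \<and> (\<forall>w\<in>span A. h y (z y) w = \<omega> y w)"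
    using insert.IH[OF _ insert.prems(2,3)] insert.prems(1) by auto
  have hb: "smooth_at x (\<lambda>y. h y b u)" for u using h by (simp add: metric_at_def)
  \<comment> \<open>\<open>a\<close> is the \<open>h\<close>-orthogonal projection of
    \<open>b\<close> to \<open>span A\<close>: the induction hypothesis with \<open>h y b\<close> as
    right-hand side.\<close>
  obtain a where a: "smooth_at x a"
    "\<forall>\<^sub>F y in nhds x. a y \<in> span A \<and> (\<forall>w\<in>span A. h y (a y) w = h y b w)"
    using insert.IH[OF _ bilin_at_linear(1)[OF metric_at_bilin_at[OF h], of "\<lambda>_. b"] hb]
      insert.prems(1) by auto
  define c where "c = (\<lambda>y. b - a y)"
  have c: "smooth_at x c" unfolding c_def using a by auto
  have ev: "\<forall>\<^sub>F y in nhds x. h y (c y) (c y) \<noteq> 0 \<and> (\<forall>w\<in>span A. h y (c y) w = 0)"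
    using a(2) ip
  proof eventually_elim
    case (elim y)
    \<comment> \<open>Two inner products are in play: orthogonality of \<open>b\<close> to
      \<open>span A\<close> in the inner product of the model space shows that \<open>c y\<close>,
      built with \<open>h y\<close>, is not zero.\<close>
    have "a y \<bullet> b = 0" using orthonormal_span_disjoint elim insert by blast
    moreover have "b \<bullet> b = 1" using onb_inner[of b b] insert.prems by auto
    ultimately have "c y \<noteq> 0" unfolding c_def by (metis eq_iff_diff_eq_0 zero_neq_one)
    with elim have "h y (c y) (c y) \<noteq> 0" using inner_form_pos[of "h y" "c y"] by simp
    moreover have "\<forall>w\<in>span A. h y (c y) w = 0"
      using elim by (simp add: c_def bilinear_lsub[OF inner_form_bilinear])
    ultimately show ?case by simp
  qed
  \<comment> \<open>The coefficient is forced by the pairing with \<open>c y\<close>, to which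
    \<open>z y\<close> contributes nothing.\<close>
  define s where "s = (\<lambda>y. \<omega> y (c y) / h y (c y) (c y))"
  have "h x (c x) (c x) \<noteq> 0" using eventually_nhds_x_imp_x[OF ev] by blast
  then have "smooth_at x s"
    unfolding s_def
    by (intro smooth_at_divide smooth_at_linear_family[OF insert.prems(2,3) c]
        smooth_at_bilin[OF metric_at_bilin_at[OF h] c c])
  then have "smooth_at x (\<lambda>y. z y + s y *\<^sub>R c y)"
    by (intro smooth_at_add smooth_at_scaleR z(1) c)
  moreover have "\<forall>\<^sub>F y in nhds x. z y + s y *\<^sub>R c y \<in> span (insert b A) \<and>
    (\<forall>w\<in>span (insert b A). h y (z y + s y *\<^sub>R c y) w = \<omega> y w)"
    using z(2) a(2) ev ip insert.prems(2)
  proof eventually_elim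
    case (elim y)
    have sub: "span A \<subseteq> span (insert b A)" by (intro span_mono) auto
    have cs: "c y \<in> span (insert b A)"
      unfolding c_def using elim sub by (intro span_diff) (auto intro: span_base)
    have B: "bilinear (h y)" and L: "linear (\<omega> y)" using elim inner_form_bilinear by auto
    have hc: "h y (z y + s y *\<^sub>R c y) (c y) = \<omega> y (c y)"
      using elim inner_form_sym[of "h y" "z y" "c y"]
      by (simp add: bilinear_ladd[OF B] bilinear_lmul[OF B] s_def)
    have hA: "h y (z y + s y *\<^sub>R c y) w = \<omega> y w" if "w \<in> span A" for w
      using elim that by (simp add: bilinear_ladd[OF B] bilinear_lmul[OF B])
    have "h y (z y + s y *\<^sub>R c y) w = \<omega> y w" if ws: "w \<in> span (insert b A)" for w
    proof -
      obtain k where k: "w - k *\<^sub>R b \<in> span A" using ws by (auto simp: span_insert)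
      have "k *\<^sub>R a y \<in> span A" using elim by (auto intro: span_scale)
      define p where "p = w - k *\<^sub>R b + k *\<^sub>R a y"
      have "p \<in> span A" unfolding p_def using k \<open>k *\<^sub>R a y \<in> span A\<close> by (rule span_add)
      then have hp: "h y (z y + s y *\<^sub>R c y) p = \<omega> y p" by (rule hA)
      have w: "w = p + k *\<^sub>R c y" by (simp add: c_def p_def algebra_simps)
      show ?thesis
        unfolding w bilinear_radd[OF B] bilinear_rmul[OF B] linear_add[OF L] linear_scale[OF L] hc hp ..
    qed
    moreover have "z y + s y *\<^sub>R c y \<in> span (insert b A)"
      using elim sub cs by (intro span_add span_scale) auto
    ultimately show ?case by blast
  qed
  ultimately show ?case by blast
qed

lemma span_onb: "span (onb::'a::finite_dimensional_inner set) = UNIV"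
proof -
  have "x \<in> span onb" for x :: 'a
    by (subst onb_expand) (intro span_sum span_scale span_base)
  then show ?thesis by auto
qed

text \<open>The inverse musical isomorphism: the vector that represents the one-form with respect to
  \<open>h\<close>.\<close>

definition sharp :: "('a \<Rightarrow> 'a \<Rightarrow> real) \<Rightarrow> ('a \<Rightarrow> real) \<Rightarrow> 'a" where
  "sharp h \<omega> = (THE z. \<forall>w. h z w = \<omega> w)"

lemma sharp_eqI: "inner_form h \<Longrightarrow> (\<And>w. h z w = \<omega> w) \<Longrightarrow> sharp h \<omega> = z"
  unfolding sharp_def by (rule the_equality) (auto intro: inner_form_eqI)

lemma metric_at_const: "inner_form h \<Longrightarrow> metric_at x (\<lambda>_. h)"
  by (auto simp: metric_at_def)

lemma sharp_works:
  fixes h :: "'a::finite_dimensional_inner \<Rightarrow> 'a \<Rightarrow> real"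
  assumes "inner_form h" "linear \<omega>"
  shows "h (sharp h \<omega>) w = \<omega> w"
proof -
  \<comment> \<open>A constant family over the real line turns smooth solvability into solvability
    for a single form.\<close>
  obtain z :: "real \<Rightarrow> 'a" where "\<forall>\<^sub>F y in nhds 0. \<forall>w. h (z y) w = \<omega> w"
    using solve_on_span[OF metric_at_const[OF assms(1)] finite_onb order_refl, of "\<lambda>_. \<omega>"] assms(2)
    by (auto simp: span_onb)
  then have "\<forall>w. h (z 0) w = \<omega> w" using eventually_nhds_x_imp_x by blast
  then show ?thesis using sharp_eqI[OF assms(1)] by metis
qed

lemma smooth_at_sharp:
  fixes h :: "'a::real_normed_vector \<Rightarrow> 'b::finite_dimensional_inner \<Rightarrow> 'b \<Rightarrow> real"
  assumes h: "metric_at x h" and "\<forall>\<^sub>F y in nhds x. linear (\<omega> y)" "\<And>u. smooth_at x (\<lambda>y. \<omega> y u)"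
  shows "smooth_at x (\<lambda>y. sharp (h y) (\<omega> y))"
proof -
  obtain z where z: "smooth_at x z" "\<forall>\<^sub>F y in nhds x. \<forall>w. h y (z y) w = \<omega> y w"
    using solve_on_span[OF h finite_onb order_refl assms(2,3)] by (auto simp: span_onb)
  have "\<forall>\<^sub>F y in nhds x. inner_form (h y)" using h metric_at_def by blast
  with z(2) have "\<forall>\<^sub>F y in nhds x. z y = sharp (h y) (\<omega> y)"
    by eventually_elim (metis sharp_eqI)
  then show ?thesis by (rule smooth_at_cong) (rule z(1))
qed

section \<open>Brackets and Lie derivatives in coordinates\<close>

text \<open>Together with \<open>ld\<close>, the coordinate expressions behind
  \<open>lie_bracket\<close> and \<open>lie_deriv_metric\<close>, freed from manifolds. Naturality
  can then be proved once for a smooth map \<open>f\<close> and used both for transition maps and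
  for \<open>\<pi>\<close> in charts.\<close>

definition lb ::
  "('a::real_normed_vector \<Rightarrow> 'a) \<Rightarrow> ('a \<Rightarrow> 'a) \<Rightarrow> 'a \<Rightarrow> 'a" where
  "lb V W x = Dv W x (V x) - Dv V x (W x)"

definition ld ::
  "('a::real_normed_vector \<Rightarrow> 'a) \<Rightarrow> ('a \<Rightarrow> 'a \<Rightarrow> 'a \<Rightarrow> real) \<Rightarrow> 'a \<Rightarrow> 'a \<Rightarrow> 'a \<Rightarrow> real" where
  "ld V h x u v = Dv (\<lambda>y. h y u v) x (V x) + h x (Dv V x u) v + h x u (Dv V x v)"

text \<open>The derivative of the relation between \<open>W\<close> and \<open>Y\<close>. It brings
  in second derivatives of \<open>f\<close>, whose symmetry makes them cancel or recombine in
  \<open>lb_related\<close> and \<open>ld_related\<close>.\<close>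

lemma Dv_related:
  fixes f :: "'a::finite_dimensional_inner \<Rightarrow> 'b::finite_dimensional_inner"
  assumes f: "smooth_at x f" and W: "smooth_at x W" and Y: "smooth_at (f x) Y"
    and rel: "\<forall>\<^sub>F y in nhds x. Dv f y (W y) = Y (f y)"
  shows "Dv (\<lambda>y. Dv f y (W x)) x a + Dv f x (Dv W x a) = Dv Y (f x) (Dv f x a)"
proof -
  have "Dv (\<lambda>y. Dv f y (W y)) x a = Dv (\<lambda>y. Y (f y)) x a"
    by (rule fun_cong[OF Dv_cong[OF rel]])
  then show ?thesis
    using Dv_Dv_family[OF f W] Dv_compose[of f x Y a] f Y smooth_at_differentiable by metis
qed

text \<open>The second derivatives of \<open>f\<close> enter the two halves of the bracket with
  opposite signs and are symmetric, so they cancel.\<close>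

lemma lb_related:
  fixes f :: "'a::finite_dimensional_inner \<Rightarrow> 'b::finite_dimensional_inner"
  assumes f: "smooth_at x f" and V: "smooth_at x V" and W: "smooth_at x W"
    and X: "smooth_at (f x) X" and Y: "smooth_at (f x) Y"
    and "\<forall>\<^sub>F y in nhds x. Dv f y (V y) = X (f y)" "\<forall>\<^sub>F y in nhds x. Dv f y (W y) = Y (f y)"
  shows "Dv f x (lb V W x) = lb X Y (f x)"
proof -
  have "Dv f x (V x) = X (f x)" "Dv f x (W x) = Y (f x)"
    using assms(6,7) eventually_nhds_x_imp_x by blast+
  then have 1: "Dv X (f x) (Y (f x)) = Dv (\<lambda>y. Dv f y (V x)) x (W x) + Dv f x (Dv V x (W x))"
    and 2: "Dv Y (f x) (X (f x)) = Dv (\<lambda>y. Dv f y (W x)) x (V x) + Dv f x (Dv W x (V x))"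
    using Dv_related[OF f V X assms(6), of "W x"] Dv_related[OF f W Y assms(7), of "V x"]
    by simp_all
  show ?thesis
    unfolding lb_def linear_diff[OF smooth_at_linear_Dv[OF f]] 1 2 Dv_Dv_commute[OF f, of "V x" "W x"]
    by simp
qed

lemma smooth_at_lb:
  fixes V W :: "'a::finite_dimensional_inner \<Rightarrow> 'a"
  shows "smooth_at x V \<Longrightarrow> smooth_at x W \<Longrightarrow> smooth_at x (lb V W)"
  unfolding lb_def[abs_def] by (intro smooth_at_diff smooth_at_Dv_family)

lemma smooth_at_eventually_compose:
  "smooth_at x f \<Longrightarrow> \<forall>\<^sub>F z in nhds (f x). P z \<Longrightarrow> \<forall>\<^sub>F y in nhds x. P (f y)"
  by (rule eventually_compose_filterlim[OF _ isCont_tendsto_nhds[OF smooth_at_isCont]])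

lemma bilin_at_pullback:
  fixes f :: "'a::finite_dimensional_inner \<Rightarrow> 'b::finite_dimensional_inner"
  assumes f: "smooth_at x f" and g: "bilin_at (f x) g"
  shows "bilin_at x (\<lambda>y. g (f y))"
proof -
  have "\<forall>\<^sub>F y in nhds x. bilinear (g (f y))"
    by (rule smooth_at_eventually_compose[OF f bilin_at_eventually[OF g]])
  then show ?thesis
    using smooth_at_compose[OF f] g by (auto simp: bilin_at_def)
qed

lemma bilinear_compose_linear:
  "bilinear g \<Longrightarrow> linear A \<Longrightarrow> bilinear (\<lambda>u v. g (A u) (A v))"
  unfolding bilinear_def by (auto intro: linear_compose[of A, unfolded o_def])

lemma bilin_at_pullback_form:
  fixes f :: "'a::finite_dimensional_inner \<Rightarrow> 'b::finite_dimensional_inner"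
  assumes f: "smooth_at x f" and g: "bilin_at (f x) g"
  shows "bilin_at x (\<lambda>y u v. g (f y) (Dv f y u) (Dv f y v))"
proof -
  have "\<forall>\<^sub>F y in nhds x. bilinear (\<lambda>u v. g (f y) (Dv f y u) (Dv f y v))"
    using bilin_at_eventually[OF bilin_at_pullback[OF f g]] smooth_at_eventually[OF f]
  proof eventually_elim
    case (elim y)
    show ?case by (rule bilinear_compose_linear[OF elim(1) smooth_at_linear_Dv[OF elim(2)]])
  qed
  moreover have "smooth_at x (\<lambda>y. g (f y) (Dv f y u) (Dv f y v))" for u v
    by (rule smooth_at_bilin[OF bilin_at_pullback[OF f g] smooth_at_Dv[OF f] smooth_at_Dv[OF f]])
  ultimately show ?thesis unfolding bilin_at_def by simp
qed

text \<open>Naturality of the Lie derivative for related fields; \<open>f\<close> need not be a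
  diffeomorphism. The second derivatives of \<open>f\<close> that arise from the pulled back form
  combine with \<open>Dv f x (Dv V x a)\<close> to \<open>Dv X (f x) (Dv f x a)\<close>.\<close>

lemma ld_related:
  fixes f :: "'a::finite_dimensional_inner \<Rightarrow> 'b::finite_dimensional_inner"
  assumes f: "smooth_at x f" and V: "smooth_at x V" and X: "smooth_at (f x) X"
    and g: "bilin_at (f x) g"
    and rel: "\<forall>\<^sub>F y in nhds x. Dv f y (V y) = X (f y)"
  shows "ld V (\<lambda>y u v. g (f y) (Dv f y u) (Dv f y v)) x u v = ld X g (f x) (Dv f x u) (Dv f x v)"
proof -
  let ?D = "\<lambda>u w. Dv (\<lambda>y. Dv f y u) x w"
  have Vx: "Dv f x (V x) = X (f x)" using rel eventually_nhds_x_imp_x by blast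
  have B: "bilinear (g (f x))" using bilin_at_bilinear[OF g] .
  have 1: "Dv (\<lambda>y. g (f y) (Dv f y u) (Dv f y v)) x (V x) =
      Dv (\<lambda>z. g z (Dv f x u) (Dv f x v)) (f x) (X (f x))
      + g (f x) (?D u (V x)) (Dv f x v) + g (f x) (Dv f x u) (?D v (V x))"
  proof -
    have "Dv (\<lambda>y. g (f y) (Dv f x u) (Dv f x v)) x (V x) =
        Dv (\<lambda>z. g z (Dv f x u) (Dv f x v)) (f x) (Dv f x (V x))"
      by (rule Dv_compose[OF smooth_at_differentiable[OF f] smooth_at_differentiable])
        (use g in \<open>simp add: bilin_at_def\<close>)
    then show ?thesis
      using Dv_bilin[OF bilin_at_pullback[OF f g] smooth_at_Dv[OF f] smooth_at_Dv[OF f]] Vx by simp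
  qed
  have 2: "Dv X (f x) (Dv f x a) = ?D a (V x) + Dv f x (Dv V x a)" for a
    using Dv_related[OF f V X rel, of a] Dv_Dv_commute[OF f, of "V x" a] by simp
  show ?thesis
    unfolding ld_def 1 2 by (simp add: bilinear_ladd[OF B] bilinear_radd[OF B])
qed

lemma ld_cong:
  assumes "\<forall>\<^sub>F y in nhds x. V y = V' y" "\<forall>\<^sub>F y in nhds x. h y u v = h' y u v"
    "h x = h' x"
  shows "ld V h x u v = ld V' h' x u v"
  unfolding ld_def using Dv_cong[OF assms(1)] Dv_cong[OF assms(2)] assms(3)
    eventually_nhds_x_imp_x[OF assms(1)] by simp

lemma smooth_at_ld:
  fixes V :: "'a::finite_dimensional_inner \<Rightarrow> 'a"
  assumes "smooth_at x V" "bilin_at x h"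
  shows "smooth_at x (\<lambda>y. ld V h y u v)"
proof -
  have h: "smooth_at x (\<lambda>y. h y u v)" for u v using assms(2) by (simp add: bilin_at_def)
  show ?thesis
    unfolding ld_def
    by (intro smooth_at_add smooth_at_Dv_family[OF h assms(1)]
        smooth_at_bilin[OF assms(2) smooth_at_Dv[OF assms(1)] smooth_at_const]
        smooth_at_bilin[OF assms(2) smooth_at_const smooth_at_Dv[OF assms(1)]])
qed

lemma bilinear_ld:
  fixes V :: "'a::finite_dimensional_inner \<Rightarrow> 'a"
  assumes V: "smooth_at x V" and h: "bilin_at x h"
  shows "bilinear (ld V h x)"
proof -
  note d = smooth_at_differentiable
  have hs: "smooth_at x (\<lambda>y. h y u v)" for u v using h by (simp add: bilin_at_def)
  have B: "bilinear (h x)" by (rule bilin_at_bilinear[OF h])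
  have L: "linear (Dv V x)" by (rule smooth_at_linear_Dv[OF V])
  have a: "Dv (\<lambda>y. h y (u + u') v) x w = Dv (\<lambda>y. h y u v) x w + Dv (\<lambda>y. h y u' v) x w"
    "Dv (\<lambda>y. h y v (u + u')) x w = Dv (\<lambda>y. h y v u) x w + Dv (\<lambda>y. h y v u') x w"
    "Dv (\<lambda>y. h y (r *\<^sub>R u) v) x w = r * Dv (\<lambda>y. h y u v) x w"
    "Dv (\<lambda>y. h y v (r *\<^sub>R u)) x w = r * Dv (\<lambda>y. h y v u) x w" for u u' v w r
  proof -
    note e = bilin_at_eventually[OF h]
    show "Dv (\<lambda>y. h y (u + u') v) x w = Dv (\<lambda>y. h y u v) x w + Dv (\<lambda>y. h y u' v) x w"
      by (subst Dv_add[symmetric, OF d[OF hs] d[OF hs]], rule fun_cong[OF Dv_cong])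
        (use e in eventually_elim, simp add: bilinear_ladd)
    show "Dv (\<lambda>y. h y v (u + u')) x w = Dv (\<lambda>y. h y v u) x w + Dv (\<lambda>y. h y v u') x w"
      by (subst Dv_add[symmetric, OF d[OF hs] d[OF hs]], rule fun_cong[OF Dv_cong])
        (use e in eventually_elim, simp add: bilinear_radd)
    show "Dv (\<lambda>y. h y (r *\<^sub>R u) v) x w = r * Dv (\<lambda>y. h y u v) x w"
      by (subst Dv_bounded_linear[symmetric, OF bounded_linear_mult_right d[OF hs]],
          rule fun_cong[OF Dv_cong]) (use e in eventually_elim, simp add: bilinear_lmul)
    show "Dv (\<lambda>y. h y v (r *\<^sub>R u)) x w = r * Dv (\<lambda>y. h y v u) x w"
      by (subst Dv_bounded_linear[symmetric, OF bounded_linear_mult_right d[OF hs]],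
          rule fun_cong[OF Dv_cong]) (use e in eventually_elim, simp add: bilinear_rmul)
  qed
  show ?thesis
    unfolding bilinear_def ld_def
    by (auto intro!: linearI simp: a linear_add[OF L] linear_scale[OF L] bilinear_ladd[OF B]
        bilinear_radd[OF B] bilinear_lmul[OF B] bilinear_rmul[OF B] algebra_simps)
qed

lemma ld_sym:
  assumes "\<forall>\<^sub>F y in nhds x. inner_form (h y)"
  shows "ld V h x u v = ld V h x v u"
proof -
  have "\<forall>\<^sub>F y in nhds x. h y u v = h y v u"
    using assms
  proof eventually_elim
    case (elim y)
    then show ?case by (rule inner_form_sym)
  qed
  from fun_cong[OF Dv_cong[OF this]] have "Dv (\<lambda>y. h y u v) x (V x) = Dv (\<lambda>y. h y v u) x (V x)" .
  then show ?thesis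
    using inner_form_sym[OF eventually_nhds_x_imp_x[OF assms]] by (simp add: ld_def)
qed

lemma ld_add:
  assumes "smooth_at x V" "smooth_at x W" "bilin_at x h"
  shows "ld (\<lambda>y. V y + W y) h x u v = ld V h x u v + ld W h x u v"
proof -
  note B = bilin_at_bilinear[OF assms(3)]
  have "smooth_at x (\<lambda>y. h y u v)" using assms(3) by (simp add: bilin_at_def)
  from linear_add[OF smooth_at_linear_Dv[OF this]] show ?thesis
    unfolding ld_def
    by (simp add: Dv_add assms smooth_at_differentiable bilinear_ladd[OF B] bilinear_radd[OF B])
qed

lemma ld_zero: "bilin_at x h \<Longrightarrow> ld (\<lambda>y. 0) h x u v = 0"
proof -
  assume h: "bilin_at x h"
  note B = bilin_at_bilinear[OF h]
  have "smooth_at x (\<lambda>y. h y u v)" using h by (simp add: bilin_at_def)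
  from linear_0[OF smooth_at_linear_Dv[OF this]] show ?thesis
    unfolding ld_def by (simp add: bilinear_lzero[OF B] bilinear_rzero[OF B])
qed

lemma ld_scale:
  assumes "smooth_at x \<phi>" "smooth_at x V" "bilin_at x h"
  shows "ld (\<lambda>y. \<phi> y *\<^sub>R V y) h x u v =
    \<phi> x * ld V h x u v + Dv \<phi> x u * h x (V x) v + Dv \<phi> x v * h x u (V x)"
proof -
  note B = bilin_at_bilinear[OF assms(3)]
  have "smooth_at x (\<lambda>y. h y u v)" using assms(3) by (simp add: bilin_at_def)
  from linear_scale[OF smooth_at_linear_Dv[OF this]] show ?thesis
    unfolding ld_def
    by (simp add: Dv_scaleR assms smooth_at_differentiable bilinear_ladd[OF B] bilinear_radd[OF B]
        bilinear_lmul[OF B] bilinear_rmul[OF B] algebra_simps)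
qed

section \<open>Riemannian submersions in coordinates\<close>

text \<open>\<open>u\<close> is the image of \<open>a\<close> under the adjoint of \<open>A\<close>,
  and the condition says that \<open>A\<close> composed with its adjoint is the identity. For
  \<open>A w = 0\<close> it gives orthogonality of \<open>u\<close> to the kernel; for
  \<open>w\<close> another such lift it gives the isometry property.\<close>

definition riem_sub ::
  "('f \<Rightarrow> 'f \<Rightarrow> real) \<Rightarrow> ('e \<Rightarrow> 'e \<Rightarrow> real) \<Rightarrow> ('f \<Rightarrow> 'e) \<Rightarrow> bool" where
  "riem_sub h g A \<longleftrightarrow> (\<forall>a. \<exists>u. A u = a \<and> (\<forall>w. h u w = g a (A w)))"

text \<open>Pythagoras: the difference of the two sides is the squared length of
  \<open>u - u'\<close>, the vertical part of \<open>u\<close>.\<close>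

lemma riem_sub_contraction:
  assumes "inner_form h" "linear A" "riem_sub h g A"
  shows "g (A u) (A u) \<le> h u u"
proof -
  obtain u' where u': "A u' = A u" "\<And>w. h u' w = g (A u) (A w)"
    using assms(3) unfolding riem_sub_def by blast
  note B = inner_form_bilinear[OF assms(1)]
  have "0 \<le> h (u - u') (u - u')" using inner_form_nonneg[OF assms(1)] .
  also have "\<dots> = h u u - g (A u) (A u)"
    using inner_form_sym[OF assms(1), of u u'] u'
    by (simp add: bilinear_lsub[OF B] bilinear_rsub[OF B])
  finally show ?thesis by simp
qed

text \<open>
  The form \<open>K = h - f\<^sup>*g\<close> is positive semidefinite and vanishes on horizontal vectors, so
  \<open>y \<mapsto> K\<^sub>y(u, u)\<close> has a minimum at \<open>x\<close> and its derivative drops out.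
\<close>

lemma ld_horizontal:
  fixes f :: "'a::finite_dimensional_inner \<Rightarrow> 'b::finite_dimensional_inner"
  assumes h: "metric_at x h" and g: "metric_at (f x) g" and f: "smooth_at x f"
    and rs: "\<forall>\<^sub>F y in nhds x. riem_sub (h y) (g (f y)) (Dv f y)"
    and V: "smooth_at x V" and X: "smooth_at (f x) X"
    and rel: "\<forall>\<^sub>F y in nhds x. Dv f y (V y) = X (f y)"
    and u: "\<And>w. h x u w = g (f x) (Dv f x u) (Dv f x w)"
    and v: "\<And>w. h x v w = g (f x) (Dv f x v) (Dv f x w)"
  shows "ld V h x u v = ld X g (f x) (Dv f x u) (Dv f x v)"
proof -
  let ?G = "\<lambda>y u v. g (f y) (Dv f y u) (Dv f y v)"
  let ?K = "\<lambda>y u v. h y u v - ?G y u v"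
  have hb: "bilin_at x h" and gb: "bilin_at (f x) g" using h g metric_at_bilin_at by auto
  have Gb: "bilin_at x ?G" by (rule bilin_at_pullback_form[OF f gb])
  have G: "smooth_at x (\<lambda>y. ?G y a b)" for a b using Gb by (simp add: bilin_at_def)
  have hs: "smooth_at x (\<lambda>y. h y a b)" for a b using hb by (simp add: bilin_at_def)
  have Bh: "bilinear (h x)" and BG: "bilinear (?G x)"
    using bilin_at_bilinear[OF hb] bilin_at_bilinear[OF Gb] by auto
  have ip: "\<forall>\<^sub>F y in nhds x. inner_form (h y)" using h metric_at_def by blast
  have ipg: "\<forall>\<^sub>F y in nhds x. inner_form (g (f y))"
    by (rule smooth_at_eventually_compose[OF f]) (use g in \<open>simp add: metric_at_def\<close>)
  have dK: "Dv (\<lambda>y. ?K y a a) x w = 0" if "\<And>b. ?K x a b = 0" for a w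
  proof -
    have "\<forall>\<^sub>F y in nhds x. 0 \<le> ?K y a a"
      using ip rs smooth_at_eventually[OF f]
      by eventually_elim (use riem_sub_contraction smooth_at_linear_Dv in force)
    then obtain S where "open S" "x \<in> S" "\<forall>y\<in>S. 0 \<le> ?K y a a"
      unfolding eventually_nhds by blast
    moreover have "((\<lambda>y. ?K y a a) has_derivative Dv (\<lambda>y. ?K y a a) x) (at x)"
      using hs G by (intro smooth_at_has_derivative smooth_at_diff)
    ultimately have "Dv (\<lambda>y. ?K y a a) x = (\<lambda>v. 0)"
      using that by (intro differential_zero_maxmin[of x S]) auto
    then show ?thesis by simp
  qed
  have Ku: "?K x u b = 0" and Kv: "?K x v b = 0" for b using u v by auto
  have Kuv: "?K x (u + v) b = 0" for b
    using u v by (simp only: bilinear_ladd[OF Bh] bilinear_ladd[OF BG])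
  \<comment> \<open>Polarisation: the minimum argument \<open>dK\<close> only reaches the diagonal,
    and it applies to \<open>u\<close>, \<open>v\<close> and \<open>u + v\<close>, all of which are
    horizontal at \<open>x\<close>.\<close>
  have "Dv (\<lambda>y. ?K y u v) x (V x) = 0"
  proof -
    have "Dv (\<lambda>y. ?K y (u + v) (u + v)) x (V x) =
        Dv (\<lambda>y. ?K y u u + 2 * ?K y u v + ?K y v v) x (V x)"
    proof (rule fun_cong[OF Dv_cong], use ip ipg smooth_at_eventually[OF f] in eventually_elim)
      case (elim y)
      note B = inner_form_bilinear[OF elim(1)] inner_form_bilinear[OF elim(2)]
      show ?case
        using inner_form_sym[OF elim(1), of u v] inner_form_sym[OF elim(2), of "Dv f y u" "Dv f y v"]
        by (simp add: linear_add[OF smooth_at_linear_Dv[OF elim(3)]] bilinear_ladd[OF B(1)]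
            bilinear_radd[OF B(1)] bilinear_ladd[OF B(2)] bilinear_radd[OF B(2)])
    qed
    also have "\<dots> = Dv (\<lambda>y. ?K y u u) x (V x) + 2 * Dv (\<lambda>y. ?K y u v) x (V x)
        + Dv (\<lambda>y. ?K y v v) x (V x)"
    proof -
      note d = smooth_at_differentiable
      have K: "smooth_at x (\<lambda>y. ?K y a b)" for a b by (rule smooth_at_diff[OF hs G])
      have K2: "smooth_at x (\<lambda>y. 2 * ?K y u v)" by (rule smooth_at_mult[OF smooth_at_const K])
      show ?thesis
        using Dv_add[OF d[OF smooth_at_add[OF K K2]] d[OF K], of u u v v "V x"]
          Dv_add[OF d[OF K] d[OF K2], of u u "V x"]
          Dv_bounded_linear[OF bounded_linear_mult_right[of 2] d[OF K], of u v "V x"]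
        by linarith
    qed
    finally show ?thesis using dK[OF Ku] dK[OF Kv] dK[OF Kuv] by simp
  qed
  then have 1: "Dv (\<lambda>y. h y u v) x (V x) = Dv (\<lambda>y. ?G y u v) x (V x)"
    using hs G by (subst (asm) Dv_diff) (auto intro: smooth_at_differentiable)
  \<comment> \<open>At \<open>x\<close> itself the two forms agree as soon as one argument is
    horizontal, so the terms of \<open>ld\<close> that contain \<open>Dv V x\<close> agree as
    well.\<close>
  have 2: "h x a v = ?G x a v" for a
    using v[of a] inner_form_sym[OF metric_at_inner_form[OF h], of a v]
      inner_form_sym[OF metric_at_inner_form[OF g], of "Dv f x a" "Dv f x v"] by simp
  have "ld V h x u v = ld V ?G x u v"
    unfolding ld_def using 1 2 u by simp
  also have "\<dots> = ld X g (f x) (Dv f x u) (Dv f x v)"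
    by (rule ld_related[OF f V X gb rel])
  finally show ?thesis .
qed

section \<open>Charts and tangent vectors\<close>

abbreviation tr :: "('a, 'e) chart \<Rightarrow> ('a, 'e) chart \<Rightarrow> 'e \<Rightarrow> 'e" where
  "tr c d \<equiv> (\<lambda>x. coord d (coord_inv c x))"

locale smooth_mfd =
  fixes M :: "('a::{t2_space,second_countable_topology}, 'e::finite_dimensional_inner) manifold"
  assumes smooth_manifold: "smooth_manifold M"
begin

lemma chart:
  assumes "c \<in> atlas M"
  shows open_cdom: "open (cdom c)" and open_coord_image: "open (coord c ` cdom c)"
    and inj_on_coord: "inj_on (coord c) (cdom c)"
    and continuous_on_coord: "continuous_on (cdom c) (coord c)"
    and continuous_on_coord_inv: "continuous_on (coord c ` cdom c) (coord_inv c)"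
  using smooth_manifold assms unfolding smooth_manifold_def by auto

lemma chart_at_atlas [simp]: "chart_at M p \<in> atlas M"
  and chart_at_cdom [simp]: "p \<in> cdom (chart_at M p)"
  using smooth_manifold unfolding smooth_manifold_def by auto

lemma coord_inv_coord [simp]: "c \<in> atlas M \<Longrightarrow> p \<in> cdom c \<Longrightarrow> coord_inv c (coord c p) = p"
  using inj_on_coord by (simp add: coord_inv_def)

lemma open_coord_image_Int:
  assumes "c \<in> atlas M" "open U"
  shows "open (coord c ` (cdom c \<inter> U))"
proof -
  have "coord c ` (cdom c \<inter> U) = coord c ` cdom c \<inter> coord_inv c -` U"
    using assms(1) by auto
  then show ?thesis
    using continuous_open_preimage[OF continuous_on_coord_inv open_coord_image] assms by auto
qed

lemma eventually_coord:
  assumes "c \<in> atlas M" "p \<in> cdom c" "\<forall>\<^sub>F x in nhds (coord c p). P x"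
  shows "\<forall>\<^sub>F q in nhds p. P (coord c q)"
proof -
  obtain V where V: "open V" "coord c p \<in> V" "\<forall>x\<in>V. P x"
    using assms(3) unfolding eventually_nhds by blast
  have "open (cdom c \<inter> coord c -` V)"
    using assms(1) V(1) continuous_open_preimage[OF continuous_on_coord open_cdom] by blast
  then show ?thesis
    unfolding eventually_nhds using V assms(2) by (intro exI[of _ "cdom c \<inter> coord c -` V"]) auto
qed

lemma eventually_coord_inv:
  assumes "c \<in> atlas M" "p \<in> cdom c" "\<forall>\<^sub>F q in nhds p. P q"
  shows "\<forall>\<^sub>F x in nhds (coord c p). x \<in> coord c ` cdom c \<and> P (coord_inv c x)"
proof -
  obtain U where U: "open U" "p \<in> U" "\<forall>q\<in>U. P q"
    using assms(3) unfolding eventually_nhds by blast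
  show ?thesis
    unfolding eventually_nhds using U assms open_coord_image_Int[OF assms(1) U(1)]
    by (intro exI[of _ "coord c ` (cdom c \<inter> U)"]) auto
qed

lemma eventually_coord_inv_open:
  assumes "c \<in> atlas M" "p \<in> cdom c" "open U" "p \<in> U"
  shows "\<forall>\<^sub>F x in nhds (coord c p). x \<in> coord c ` cdom c \<and> coord_inv c x \<in> U"
  using assms by (intro eventually_coord_inv) (auto simp: eventually_nhds)

lemma eventually_coord_domains:
  assumes "c \<in> atlas M" "p \<in> cdom c" "d \<in> atlas M" "p \<in> cdom d"
  shows "\<forall>\<^sub>F x in nhds (coord c p). x \<in> coord c ` cdom c \<and> coord_inv c x \<in> cdom d"
  using assms by (intro eventually_coord_inv_open open_cdom)

lemma smooth_at_tr:
  assumes "c \<in> atlas M" "p \<in> cdom c" "d \<in> atlas M" "p \<in> cdom d"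
  shows "smooth_at (coord c p) (tr c d)"
proof -
  have "smooth_on (coord c ` (cdom c \<inter> cdom d)) (coord d \<circ> coord_inv c)"
    using smooth_manifold assms unfolding smooth_manifold_def by blast
  then show ?thesis
    using smooth_on_iff_smooth_at[OF open_coord_image_Int[OF assms(1) open_cdom[OF assms(3)]]] assms
    unfolding o_def by blast
qed

text \<open>The chain rule for the cocycle identity of transition maps. With \<open>e = c\<close> it
  inverts the derivative of a transition map, which makes \<open>to_chart\<close> and
  \<open>from_chart\<close> mutually inverse.\<close>

lemma Dv_tr_tr:
  assumes "c \<in> atlas M" "p \<in> cdom c" "d \<in> atlas M" "p \<in> cdom d" "e \<in> atlas M" "p \<in> cdom e"
  shows "Dv (tr d e) (coord d p) (Dv (tr c d) (coord c p) u) = Dv (tr c e) (coord c p) u"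
proof -
  note d = smooth_at_differentiable[OF smooth_at_tr]
  have "\<forall>\<^sub>F x in nhds (coord c p). tr c e x = tr d e (tr c d x)"
    using eventually_coord_domains[OF assms(1-4)] by eventually_elim (use assms in auto)
  from fun_cong[OF Dv_cong[OF this], of u]
  show ?thesis
    using Dv_compose[of "tr c d" "coord c p" "tr d e" u] d[OF assms(1-4)] d[OF assms(3-6)] assms
    by simp
qed

lemma Dv_tr_self:
  assumes "c \<in> atlas M" "p \<in> cdom c"
  shows "Dv (tr c c) (coord c p) u = u"
proof -
  have "\<forall>\<^sub>F x in nhds (coord c p). tr c c x = x"
    using eventually_coord_domains[OF assms assms] by eventually_elim (use assms in auto)
  from fun_cong[OF Dv_cong[OF this], of u] show ?thesis by simp
qed

lemma to_chart_eq: "to_chart M c p = Dv (tr (chart_at M p) c) (coord (chart_at M p) p)"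
  by (simp add: to_chart_def o_def)

lemma from_chart_eq: "from_chart M c p = Dv (tr c (chart_at M p)) (coord c p)"
  by (simp add: from_chart_def o_def)

lemma linear_to_chart: "c \<in> atlas M \<Longrightarrow> p \<in> cdom c \<Longrightarrow> linear (to_chart M c p)"
  unfolding to_chart_eq by (intro smooth_at_linear_Dv smooth_at_tr) auto

lemma linear_from_chart: "c \<in> atlas M \<Longrightarrow> p \<in> cdom c \<Longrightarrow> linear (from_chart M c p)"
  unfolding from_chart_eq by (intro smooth_at_linear_Dv smooth_at_tr) auto

lemma to_chart_from_chart [simp]:
  "c \<in> atlas M \<Longrightarrow> p \<in> cdom c \<Longrightarrow> to_chart M c p (from_chart M c p u) = u"
  by (simp add: to_chart_eq from_chart_eq Dv_tr_tr Dv_tr_self)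

lemma from_chart_to_chart [simp]:
  "c \<in> atlas M \<Longrightarrow> p \<in> cdom c \<Longrightarrow> from_chart M c p (to_chart M c p u) = u"
  by (simp add: to_chart_eq from_chart_eq Dv_tr_tr Dv_tr_self)

lemma to_chart_self [simp]: "to_chart M (chart_at M p) p u = u"
  by (simp add: to_chart_eq Dv_tr_self)

lemma from_chart_self [simp]: "from_chart M (chart_at M p) p u = u"
  by (simp add: from_chart_eq Dv_tr_self)

lemma Dv_tr_to_chart:
  "c \<in> atlas M \<Longrightarrow> p \<in> cdom c \<Longrightarrow> d \<in> atlas M \<Longrightarrow> p \<in> cdom d \<Longrightarrow>
   Dv (tr c d) (coord c p) (to_chart M c p u) = to_chart M d p u"
  by (simp add: to_chart_eq Dv_tr_tr)

lemma from_chart_Dv_tr: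
  "c \<in> atlas M \<Longrightarrow> p \<in> cdom c \<Longrightarrow> d \<in> atlas M \<Longrightarrow> p \<in> cdom d \<Longrightarrow>
   from_chart M d p (Dv (tr c d) (coord c p) u) = from_chart M c p u"
  by (simp add: from_chart_eq Dv_tr_tr)

section \<open>Pointwise smoothness on manifolds\<close>

lemma smooth_at_change_chart:
  assumes c: "c \<in> atlas M" "p \<in> cdom c" and d: "d \<in> atlas M" "p \<in> cdom d"
    and "smooth_at (coord c p) (\<lambda>x. f (coord_inv c x))"
  shows "smooth_at (coord d p) (\<lambda>x. f (coord_inv d x))"
proof -
  have "\<forall>\<^sub>F x in nhds (coord d p). f (coord_inv c (tr d c x)) = f (coord_inv d x)"
    using eventually_coord_domains[OF d c] by eventually_elim (use c d in auto)
  moreover have "smooth_at (coord d p) (\<lambda>x. f (coord_inv c (tr d c x)))"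
    using smooth_at_compose[OF smooth_at_tr[OF d c]] assms by simp
  ultimately show ?thesis by (rule smooth_at_cong)
qed

definition smooth_fun_at :: "'a \<Rightarrow> ('a \<Rightarrow> real) \<Rightarrow> bool" where
  "smooth_fun_at p f \<longleftrightarrow>
     (\<forall>c\<in>atlas M. p \<in> cdom c \<longrightarrow> smooth_at (coord c p) (\<lambda>x. f (coord_inv c x)))"

lemma smooth_fun_atI:
  assumes "c \<in> atlas M" "p \<in> cdom c" "smooth_at (coord c p) (\<lambda>x. f (coord_inv c x))"
  shows "smooth_fun_at p f"
  unfolding smooth_fun_at_def using smooth_at_change_chart[OF assms(1,2) _ _ assms(3)] by blast

lemma smooth_fun_iff: "smooth_fun M f \<longleftrightarrow> (\<forall>p. smooth_fun_at p f)"
proof -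
  have "smooth_on (coord c ` cdom c) (f \<circ> coord_inv c) \<longleftrightarrow>
      (\<forall>p\<in>cdom c. smooth_at (coord c p) (\<lambda>x. f (coord_inv c x)))" if "c \<in> atlas M" for c
    using smooth_on_iff_smooth_at[OF open_coord_image[OF that]] by (simp add: o_def)
  then show ?thesis unfolding smooth_fun_def smooth_fun_at_def by blast
qed

lemma smooth_fun_at_cong:
  assumes "\<forall>\<^sub>F q in nhds p. f q = g q" "smooth_fun_at p f"
  shows "smooth_fun_at p g"
  unfolding smooth_fun_at_def
proof (intro ballI impI)
  fix c assume c: "c \<in> atlas M" "p \<in> cdom c"
  have "\<forall>\<^sub>F x in nhds (coord c p). f (coord_inv c x) = g (coord_inv c x)"
    using eventually_coord_inv[OF c assms(1)] by eventually_elim simp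
  then show "smooth_at (coord c p) (\<lambda>x. g (coord_inv c x))"
    by (rule smooth_at_cong) (use assms(2) c in \<open>simp add: smooth_fun_at_def\<close>)
qed

lemma smooth_fun_at_const: "smooth_fun_at p (\<lambda>_. r)"
  by (simp add: smooth_fun_at_def)

lemma smooth_fun_at_add:
  "smooth_fun_at p f \<Longrightarrow> smooth_fun_at p g \<Longrightarrow> smooth_fun_at p (\<lambda>q. f q + g q)"
  by (auto simp: smooth_fun_at_def intro!: smooth_at_add)

lemma smooth_fun_at_diff:
  "smooth_fun_at p f \<Longrightarrow> smooth_fun_at p g \<Longrightarrow> smooth_fun_at p (\<lambda>q. f q - g q)"
  by (auto simp: smooth_fun_at_def intro!: smooth_at_diff)

lemma smooth_fun_at_mult:
  "smooth_fun_at p f \<Longrightarrow> smooth_fun_at p g \<Longrightarrow> smooth_fun_at p (\<lambda>q. f q * g q)"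
  by (auto simp: smooth_fun_at_def intro!: smooth_at_mult)

definition smooth_vf_at :: "'a \<Rightarrow> ('a \<Rightarrow> 'e) \<Rightarrow> bool" where
  "smooth_vf_at p X \<longleftrightarrow> (\<forall>c\<in>atlas M. p \<in> cdom c \<longrightarrow> smooth_at (coord c p) (vf_rep M c X))"

lemma vf_rep_coord:
  "c \<in> atlas M \<Longrightarrow> p \<in> cdom c \<Longrightarrow> vf_rep M c X (coord c p) = to_chart M c p (X p)"
  by (simp add: vf_rep_def)

lemma vf_rep_tr:
  assumes "c \<in> atlas M" "p \<in> cdom c" "d \<in> atlas M" "p \<in> cdom d"
  shows "\<forall>\<^sub>F x in nhds (coord c p). Dv (tr c d) x (vf_rep M c X x) = vf_rep M d X (tr c d x)"
  using eventually_coord_domains[OF assms]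
  by eventually_elim (use assms in \<open>auto simp: vf_rep_coord Dv_tr_to_chart\<close>)

text \<open>One chart suffices: the components in another chart are the derivative of the transition
  map applied to the given components, a moving direction covered by
  \<open>smooth_at_Dv_family\<close>.\<close>

lemma smooth_vf_atI:
  assumes c: "c \<in> atlas M" "p \<in> cdom c" and X: "smooth_at (coord c p) (vf_rep M c X)"
  shows "smooth_vf_at p X"
  unfolding smooth_vf_at_def
proof (intro ballI impI)
  fix d assume d: "d \<in> atlas M" "p \<in> cdom d"
  have ev: "\<forall>\<^sub>F x in nhds (coord d p). Dv (tr c d) (tr d c x) (vf_rep M c X (tr d c x)) = vf_rep M d X x"
    using eventually_coord_domains[OF d c]
    by eventually_elim (use c d in \<open>auto simp: vf_rep_coord Dv_tr_to_chart\<close>)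
  have "smooth_at (coord c p) (\<lambda>x. Dv (tr c d) x (vf_rep M c X x))"
    by (rule smooth_at_Dv_family[OF smooth_at_tr[OF c d] X])
  then have "smooth_at (coord d p) (\<lambda>x. Dv (tr c d) (tr d c x) (vf_rep M c X (tr d c x)))"
    using smooth_at_compose[OF smooth_at_tr[OF d c],
        of "\<lambda>x. Dv (tr c d) x (vf_rep M c X x)"] c d by simp
  with ev show "smooth_at (coord d p) (vf_rep M d X)" by (rule smooth_at_cong)
qed

lemma smooth_vf_on_iff:
  assumes "open U"
  shows "smooth_vf_on M U X \<longleftrightarrow> (\<forall>p\<in>U. smooth_vf_at p X)"
proof -
  have "smooth_on (coord c ` (cdom c \<inter> U)) (vf_rep M c X) \<longleftrightarrow>
      (\<forall>p\<in>cdom c \<inter> U. smooth_at (coord c p) (vf_rep M c X))" if "c \<in> atlas M" for c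
    using smooth_on_iff_smooth_at[OF open_coord_image_Int[OF that assms]] by simp
  then show ?thesis unfolding smooth_vf_on_def smooth_vf_at_def by blast
qed

lemma vf_rep_cong:
  assumes c: "c \<in> atlas M" "p \<in> cdom c" and "\<forall>\<^sub>F q in nhds p. X q = Y q"
  shows "\<forall>\<^sub>F x in nhds (coord c p). vf_rep M c X x = vf_rep M c Y x"
  using eventually_coord_inv[OF c assms(3)] by eventually_elim (simp add: vf_rep_def)

lemma smooth_vf_at_cong:
  assumes "\<forall>\<^sub>F q in nhds p. X q = Y q" "smooth_vf_at p X"
  shows "smooth_vf_at p Y"
  unfolding smooth_vf_at_def
proof (intro ballI impI)
  fix c assume c: "c \<in> atlas M" "p \<in> cdom c"
  show "smooth_at (coord c p) (vf_rep M c Y)"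
    by (rule smooth_at_cong[OF vf_rep_cong[OF c assms(1)]])
      (use assms(2) c in \<open>simp add: smooth_vf_at_def\<close>)
qed

lemma vf_rep_zero:
  assumes c: "c \<in> atlas M" "p \<in> cdom c"
  shows "\<forall>\<^sub>F x in nhds (coord c p). vf_rep M c (\<lambda>_. 0) x = 0"
  using eventually_coord_domains[OF c c]
  by eventually_elim (auto simp: vf_rep_def linear_0[OF linear_to_chart] c)

lemma vf_rep_add:
  assumes c: "c \<in> atlas M" "p \<in> cdom c"
  shows "\<forall>\<^sub>F x in nhds (coord c p). vf_rep M c (\<lambda>q. X q + Y q) x = vf_rep M c X x + vf_rep M c Y x"
  using eventually_coord_domains[OF c c]
  by eventually_elim (auto simp: vf_rep_def linear_add[OF linear_to_chart] c)

lemma vf_rep_scale: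
  assumes c: "c \<in> atlas M" "p \<in> cdom c"
  shows "\<forall>\<^sub>F x in nhds (coord c p). vf_rep M c (\<lambda>q. f q *\<^sub>R X q) x = f (coord_inv c x) *\<^sub>R vf_rep M c X x"
  using eventually_coord_domains[OF c c]
  by eventually_elim (auto simp: vf_rep_def linear_scale[OF linear_to_chart] c)

lemma eventually_nhds_sym: "\<forall>\<^sub>F x in nhds a. f x = g x \<Longrightarrow> \<forall>\<^sub>F x in nhds a. g x = f x"
  by (simp add: eq_commute)

lemma smooth_vf_at_zero: "smooth_vf_at p (\<lambda>_. 0)"
  by (rule smooth_vf_atI[OF chart_at_atlas chart_at_cdom],
      rule smooth_at_cong[OF eventually_nhds_sym[OF vf_rep_zero]]) auto

lemma smooth_vf_at_add:
  assumes "smooth_vf_at p X" "smooth_vf_at p Y"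
  shows "smooth_vf_at p (\<lambda>q. X q + Y q)"
  by (rule smooth_vf_atI[OF chart_at_atlas chart_at_cdom],
      rule smooth_at_cong[OF eventually_nhds_sym[OF vf_rep_add]])
    (use assms in \<open>auto simp: smooth_vf_at_def intro!: smooth_at_add\<close>)

lemma smooth_vf_at_scale:
  assumes "smooth_fun_at p f" "smooth_vf_at p X"
  shows "smooth_vf_at p (\<lambda>q. f q *\<^sub>R X q)"
  by (rule smooth_vf_atI[OF chart_at_atlas chart_at_cdom],
      rule smooth_at_cong[OF eventually_nhds_sym[OF vf_rep_scale]])
    (use assms in \<open>auto simp: smooth_vf_at_def smooth_fun_at_def intro!: smooth_at_scaleR\<close>)

definition smooth_form_at :: "'a \<Rightarrow> ('a \<Rightarrow> 'e \<Rightarrow> real) \<Rightarrow> bool" where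
  "smooth_form_at p \<alpha> \<longleftrightarrow> (\<forall>c\<in>atlas M. p \<in> cdom c \<longrightarrow>
     (\<forall>u. smooth_at (coord c p) (\<lambda>x. \<alpha> (coord_inv c x) (from_chart M c (coord_inv c x) u))))"

lemma linear_form_rep:
  assumes c: "c \<in> atlas M" "p \<in> cdom c" and lin: "\<And>q. linear (\<alpha> q)"
  shows "\<forall>\<^sub>F x in nhds (coord c p). linear (\<lambda>u. \<alpha> (coord_inv c x) (from_chart M c (coord_inv c x) u))"
  using eventually_coord_domains[OF c c]
proof eventually_elim
  case (elim x)
  then show ?case
    using linear_compose[OF linear_from_chart lin, of c "coord_inv c x"] c by (simp add: o_def)
qed

text \<open>In the new chart the form is evaluated on the moving vector
  \<open>Dv (tr d c) x u\<close>, while smoothness is given for constant components; linearity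
  bridges the two.\<close>

lemma smooth_form_atI:
  assumes c: "c \<in> atlas M" "p \<in> cdom c" and lin: "\<And>q. linear (\<alpha> q)"
    and \<alpha>: "\<And>u. smooth_at (coord c p) (\<lambda>x. \<alpha> (coord_inv c x) (from_chart M c (coord_inv c x) u))"
  shows "smooth_form_at p \<alpha>"
  unfolding smooth_form_at_def
proof (intro ballI impI allI)
  fix d u assume d: "d \<in> atlas M" "p \<in> cdom d"
  let ?A = "\<lambda>x v. \<alpha> (coord_inv c x) (from_chart M c (coord_inv c x) v)"
  have ev: "\<forall>\<^sub>F x in nhds (coord d p). ?A (tr d c x) (Dv (tr d c) x u) =
      \<alpha> (coord_inv d x) (from_chart M d (coord_inv d x) u)"
    using eventually_coord_domains[OF d c]
    by eventually_elim (use c d in \<open>auto simp: from_chart_Dv_tr\<close>)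
  have trp: "tr d c (coord d p) = coord c p" using d by simp
  have 1: "smooth_at (coord d p) (\<lambda>x. ?A (tr d c x) v)" for v
    by (rule smooth_at_compose[OF smooth_at_tr[OF d c]]) (use \<alpha> d in simp)
  have 2: "\<forall>\<^sub>F x in nhds (coord d p). linear (?A (tr d c x))"
    by (rule smooth_at_eventually_compose[OF smooth_at_tr[OF d c]])
      (use linear_form_rep[OF c lin] in \<open>simp only: trp\<close>)
  have "smooth_at (coord d p) (\<lambda>x. ?A (tr d c x) (Dv (tr d c) x u))"
    by (rule smooth_at_linear_family[OF 2 1 smooth_at_Dv[OF smooth_at_tr[OF d c]]])
  with ev show "smooth_at (coord d p) (\<lambda>x. \<alpha> (coord_inv d x) (from_chart M d (coord_inv d x) u))"
    by (rule smooth_at_cong)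
qed

lemma smooth_one_form_iff:
  "smooth_one_form M \<alpha> \<longleftrightarrow> (\<forall>p. linear (\<alpha> p) \<and> smooth_form_at p \<alpha>)"
proof -
  have "smooth_on (coord c ` cdom c) (\<lambda>x. \<alpha> (coord_inv c x) (from_chart M c (coord_inv c x) u)) \<longleftrightarrow>
      (\<forall>p\<in>cdom c. smooth_at (coord c p) (\<lambda>x. \<alpha> (coord_inv c x) (from_chart M c (coord_inv c x) u)))"
    if "c \<in> atlas M" for c u
    using smooth_on_iff_smooth_at[OF open_coord_image[OF that]] by simp
  then show ?thesis unfolding smooth_one_form_def smooth_form_at_def by blast
qed

lemma smooth_form_at_cong:
  assumes "\<forall>\<^sub>F q in nhds p. \<alpha> q = \<beta> q" "smooth_form_at p \<alpha>"
  shows "smooth_form_at p \<beta>"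
  unfolding smooth_form_at_def
proof (intro ballI impI allI)
  fix c u assume c: "c \<in> atlas M" "p \<in> cdom c"
  have "\<forall>\<^sub>F x in nhds (coord c p). \<alpha> (coord_inv c x) (from_chart M c (coord_inv c x) u) =
      \<beta> (coord_inv c x) (from_chart M c (coord_inv c x) u)"
    using eventually_coord_inv[OF c assms(1)] by eventually_elim simp
  then show "smooth_at (coord c p) (\<lambda>x. \<beta> (coord_inv c x) (from_chart M c (coord_inv c x) u))"
    by (rule smooth_at_cong) (use assms(2) c in \<open>simp add: smooth_form_at_def\<close>)
qed

section \<open>Bump functions and supports\<close>

lemma supp_compactI:
  fixes f :: "'a \<Rightarrow> 'b::zero"
  assumes "compact K" "\<And>p. p \<notin> K \<Longrightarrow> f p = 0"
  shows "compact (supp f)" "supp f \<subseteq> K"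
proof -
  have "{p. f p \<noteq> 0} \<subseteq> K" using assms(2) by blast
  then show "supp f \<subseteq> K"
    unfolding supp_def using compact_imp_closed[OF assms(1)] by (rule closure_minimal)
  then show "compact (supp f)"
    using compact_Int_closed[OF assms(1), of "supp f"] by (simp add: supp_def inf.absorb2)
qed

lemma not_in_supp: "p \<notin> supp f \<Longrightarrow> f p = 0"
  using closure_subset[of "{p. f p \<noteq> 0}"] by (auto simp: supp_def)

lemma eventually_zero_off_supp:
  assumes "p \<notin> supp f"
  shows "\<forall>\<^sub>F q in nhds p. f q = 0"
proof -
  have "open (- supp f)" unfolding supp_def by (intro open_Compl closed_closure)
  then show ?thesis
    unfolding eventually_nhds using assms not_in_supp by (intro exI[of _ "- supp f"]) auto
qed

lemma Cc_smoothI: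
  assumes "smooth_fun M f" "compact K" "K \<subseteq> U" "\<And>p. p \<notin> K \<Longrightarrow> f p = 0"
  shows "f \<in> Cc_smooth M U"
  using assms(1,3) supp_compactI[OF assms(2), of f] assms(4) unfolding Cc_smooth_def by blast

lemma Cc_smoothD:
  assumes "f \<in> Cc_smooth M U"
  shows "smooth_fun M f" "compact (supp f)" "supp f \<subseteq> U"
  using assms by (auto simp: Cc_smooth_def)

lemma Cc_smooth_mono: "f \<in> Cc_smooth M U \<Longrightarrow> U \<subseteq> V \<Longrightarrow> f \<in> Cc_smooth M V"
  by (auto simp: Cc_smooth_def)

lemma Cc_smooth_zero: "(\<lambda>_. 0) \<in> Cc_smooth M U"
  by (rule Cc_smoothI[of _ "{}"]) (auto simp: smooth_fun_iff smooth_fun_at_const)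

lemma Cc_smooth_add:
  assumes "f \<in> Cc_smooth M U" "g \<in> Cc_smooth M U"
  shows "(\<lambda>p. f p + g p) \<in> Cc_smooth M U"
  by (rule Cc_smoothI[of _ "supp f \<union> supp g"])
    (use Cc_smoothD[OF assms(1)] Cc_smoothD[OF assms(2)] in
      \<open>auto simp: smooth_fun_iff smooth_fun_at_add not_in_supp\<close>)

lemma Cc_smooth_mult:
  assumes "f \<in> Cc_smooth M U" "smooth_fun M g"
  shows "(\<lambda>p. f p * g p) \<in> Cc_smooth M U"
  by (rule Cc_smoothI[of _ "supp f"])
    (use Cc_smoothD[OF assms(1)] assms(2) in \<open>auto simp: smooth_fun_iff smooth_fun_at_mult not_in_supp\<close>)

text \<open>A radial step function in a chart, extended by zero. Squared distances keep it smooth at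
  the centre.\<close>

lemma ex_bump_at:
  assumes "open U" "p \<in> U"
  shows "\<exists>b\<in>Cc_smooth M U. \<exists>V. open V \<and> p \<in> V \<and> (\<forall>q\<in>V. b q = 1)"
proof -
  define c where "c = chart_at M p"
  have c: "c \<in> atlas M" "p \<in> cdom c" by (auto simp: c_def)
  define x0 where "x0 = coord c p"
  have "open (coord c ` (cdom c \<inter> U))" "x0 \<in> coord c ` (cdom c \<inter> U)"
    using open_coord_image_Int[OF c(1) assms(1)] c(2) assms(2) by (auto simp: x0_def)
  then obtain r where r: "r > 0" "cball x0 (2 * r) \<subseteq> coord c ` (cdom c \<inter> U)"
    by (metis open_contains_cball field_sum_of_halves half_gt_zero mult_2)
  \<comment> \<open>The argument of the step is at least \<open>1\<close> within distance
    \<open>r\<close> of \<open>x0\<close> and at most \<open>0\<close> once the squared distance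
    reaches twice \<open>r\<^sup>2\<close>, in particular beyond distance
    \<open>2 * r\<close>.\<close>
  define s where "s x = smooth_step (2 - ((x - x0) \<bullet> (x - x0)) / r\<^sup>2)" for x
  have "smooth_at x s" for x
    unfolding s_def[abs_def]
    by (rule smooth_at_compose[OF _ smooth_at_smooth_step])
      (intro smooth_at_diff smooth_at_divide smooth_at_inner smooth_at_const smooth_at_ident,
        use r in auto)
  have s1: "s x = 1" if "x \<in> ball x0 r" for x
  proof -
    have "norm (x - x0) ^ 2 \<le> r ^ 2"
      using that by (intro power_mono) (auto simp: dist_norm norm_minus_commute)
    then show ?thesis
      using r(1) by (auto simp: s_def smooth_step_eq(2) power2_norm_eq_inner divide_le_eq)
  qed
  have s0: "s x = 0" if "x \<notin> cball x0 (2 * r)" for x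
  proof -
    have "(2 * r) ^ 2 \<le> norm (x - x0) ^ 2"
      using that r(1) by (intro power_mono) (auto simp: dist_norm norm_minus_commute)
    then have "4 * r ^ 2 \<le> (x - x0) \<bullet> (x - x0)"
      by (simp add: power_mult_distrib power2_norm_eq_inner)
    then have "2 * r ^ 2 \<le> (x - x0) \<bullet> (x - x0)" using zero_le_power2[of r] by linarith
    then show ?thesis
      using r(1) by (auto simp: s_def smooth_step_eq(1) le_divide_eq)
  qed
  define K where "K = coord_inv c ` cball x0 (2 * r)"
  have "cball x0 (2 * r) \<subseteq> coord c ` cdom c" using r(2) by blast
  then have K: "compact K" unfolding K_def
    using continuous_on_subset[OF continuous_on_coord_inv[OF c(1)]]
    by (intro compact_continuous_image compact_cball_finite_dimensional) blast
  have KU: "K \<subseteq> cdom c \<inter> U" using r(2) c(1) by (auto simp: K_def)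
  define b where "b q = (if q \<in> cdom c then s (coord c q) else 0)" for q
  have b0: "b q = 0" if "q \<notin> K" for q
  proof (cases "q \<in> cdom c")
    case True
    have "coord c q \<notin> cball x0 (2 * r)"
      using that True c(1) by (auto simp: K_def image_iff) (metis coord_inv_coord mem_cball)
    then show ?thesis by (simp add: b_def s0)
  qed (simp add: b_def)
  have "smooth_fun_at q b" for q
  proof (cases "q \<in> cdom c")
    case True
    have "\<forall>\<^sub>F x in nhds (coord c q). s x = b (coord_inv c x)"
      using eventually_coord_domains[OF c(1) True c(1) True]
      by eventually_elim (use c in \<open>auto simp: b_def\<close>)
    then show ?thesis
      by (intro smooth_fun_atI[OF c(1) True]) (rule smooth_at_cong, use \<open>\<And>x. smooth_at x s\<close> in auto)
  next
    case False
    then have "q \<in> - K" using KU by blast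
    \<comment> \<open>Compact sets are closed in a Hausdorff space; this makes the extension by zero
      smooth, also at points on the boundary of the chart domain.\<close>
    moreover have "open (- K)" using compact_imp_closed[OF K] by (simp add: open_Compl)
    ultimately have "\<forall>\<^sub>F q' in nhds q. 0 = b q'"
      unfolding eventually_nhds using b0 by (intro exI[of _ "- K"]) auto
    then show ?thesis by (rule smooth_fun_at_cong) (rule smooth_fun_at_const)
  qed
  then have "b \<in> Cc_smooth M U"
    using K KU b0 by (intro Cc_smoothI[of _ K]) (auto simp: smooth_fun_iff)
  moreover have "open (cdom c \<inter> coord c -` ball x0 r)"
    using continuous_open_preimage[OF continuous_on_coord[OF c(1)] open_cdom[OF c(1)]] by blast
  moreover have "p \<in> cdom c \<inter> coord c -` ball x0 r" using c r by (auto simp: x0_def)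
  moreover have "\<forall>q\<in>cdom c \<inter> coord c -` ball x0 r. b q = 1" using s1 by (auto simp: b_def)
  ultimately show ?thesis by blast
qed

text \<open>Induction over a finite subcover: \<open>b + f * (1 - b)\<close> equals
  \<open>1 - (1 - b) * (1 - f)\<close>, so it is 1 wherever one of the two functions is.\<close>

lemma ex_bump:
  assumes "open U" "compact K" "K \<subseteq> U"
  shows "\<exists>b\<in>Cc_smooth M U. \<forall>q\<in>K. b q = 1"
proof -
  have "\<forall>p\<in>U. \<exists>b V. b \<in> Cc_smooth M U \<and> open V \<and> p \<in> V \<and> (\<forall>q\<in>V. b q = 1)"
    using ex_bump_at[OF assms(1)] by blast
  then obtain b V where bV: "\<And>p. p \<in> U \<Longrightarrow> b p \<in> Cc_smooth M U" "\<And>p. p \<in> U \<Longrightarrow> open (V p)"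
    "\<And>p. p \<in> U \<Longrightarrow> p \<in> V p" "\<And>p q. p \<in> U \<Longrightarrow> q \<in> V p \<Longrightarrow> b p q = 1"
    by metis
  have "\<forall>p\<in>K. open (V p)" "K \<subseteq> (\<Union>p\<in>K. V p)" using bV(2,3) assms(3) by auto
  then obtain A where A: "A \<subseteq> K" "finite A" "K \<subseteq> (\<Union>p\<in>A. V p)"
    by (auto intro: compactE_image[OF assms(2), of K V])
  have "\<exists>f\<in>Cc_smooth M U. \<forall>q\<in>(\<Union>p\<in>A. V p). f q = 1"
    using A(2) order_trans[OF A(1) assms(3)]
  proof (induction A rule: finite_induct)
    case empty
    show ?case using Cc_smooth_zero by auto
  next
    case (insert p A)
    then obtain f where f: "f \<in> Cc_smooth M U" "\<forall>q\<in>(\<Union>p\<in>A. V p). f q = 1" by auto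
    have p: "p \<in> U" using insert.prems by blast
    have "smooth_fun M (\<lambda>q. 1 - b p q)"
      using Cc_smoothD(1)[OF bV(1)[OF p]] by (simp add: smooth_fun_iff smooth_fun_at_diff smooth_fun_at_const)
    then have "(\<lambda>q. b p q + f q * (1 - b p q)) \<in> Cc_smooth M U"
      by (rule Cc_smooth_add[OF bV(1)[OF p] Cc_smooth_mult[OF f(1)]])
    moreover have "\<forall>q\<in>(\<Union>p\<in>insert p A. V p). b p q + f q * (1 - b p q) = 1"
      using f(2) bV(4)[OF p] by auto
    ultimately show ?case by (intro bexI[of _ "\<lambda>q. b p q + f q * (1 - b p q)"])
  qed
  then obtain f where "f \<in> Cc_smooth M U" "\<forall>q\<in>(\<Union>p\<in>A. V p). f q = 1" ..
  with A(3) show ?thesis by (intro bexI[of _ f]) auto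
qed

text \<open>A partition of unity in the form of an induction rule. The summand \<open>b * f\<close>
  lives in a single chart, and the support of the remainder \<open>f * (1 - b)\<close> misses
  \<open>V p\<close>, so one set of the finite cover is disposed of. It serves to localise
  statements that are additive in \<open>f\<close>.\<close>

lemma Cc_smooth_chart_induct:
  assumes f: "f \<in> Cc_smooth M UNIV"
    and zero: "P (\<lambda>_. 0)"
    and add: "\<And>f g. P f \<Longrightarrow> P g \<Longrightarrow> P (\<lambda>p. f p + g p)"
    and chart: "\<And>f c. c \<in> atlas M \<Longrightarrow> f \<in> Cc_smooth M (cdom c) \<Longrightarrow> P f"
  shows "P f"
proof -
  have "\<exists>b V. b \<in> Cc_smooth M (cdom (chart_at M p)) \<and> open V \<and> p \<in> V \<and> (\<forall>q\<in>V. b q = 1)" for p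
    using ex_bump_at[OF open_cdom[OF chart_at_atlas] chart_at_cdom, of p] by blast
  then obtain b V where bV: "\<And>p. b p \<in> Cc_smooth M (cdom (chart_at M p))" "\<And>p. open (V p)"
    "\<And>p. p \<in> V p" "\<And>p q. q \<in> V p \<Longrightarrow> b p q = 1"
    by metis
  have "\<forall>p\<in>supp f. open (V p)" "supp f \<subseteq> (\<Union>p\<in>supp f. V p)" using bV(2,3) by auto
  then obtain A where A: "A \<subseteq> supp f" "finite A" "supp f \<subseteq> (\<Union>p\<in>A. V p)"
    by (auto intro: compactE_image[OF Cc_smoothD(2)[OF f], of "supp f" V])
  show ?thesis using A(2,3) f
  proof (induction A arbitrary: f rule: finite_induct)
    case empty
    then have "supp f = {}" by simp
    then have "f = (\<lambda>_. 0)" using not_in_supp[of _ f] by (intro ext) blast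
    then show ?case using zero by simp
  next
    case (insert p A)
    have sb: "smooth_fun M (b p)" and sf: "smooth_fun M f"
      using Cc_smoothD(1)[OF bV(1)] Cc_smoothD(1)[OF insert.prems(2)] by auto
    have 1: "(\<lambda>q. b p q * f q) \<in> Cc_smooth M (cdom (chart_at M p))"
      by (rule Cc_smooth_mult[OF bV(1) sf])
    have "smooth_fun M (\<lambda>q. 1 - b p q)"
      using sb by (simp add: smooth_fun_iff smooth_fun_at_diff smooth_fun_at_const)
    then have 2: "(\<lambda>q. f q * (1 - b p q)) \<in> Cc_smooth M UNIV"
      by (rule Cc_smooth_mult[OF insert.prems(2)])
    have "supp (\<lambda>q. f q * (1 - b p q)) \<subseteq> supp f \<inter> - V p"
      unfolding supp_def
    proof (rule closure_minimal)
      show "{q. f q * (1 - b p q) \<noteq> 0} \<subseteq> closure {p. f p \<noteq> 0} \<inter> - V p"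
        using bV(4) closure_subset[of "{p. f p \<noteq> 0}"] by auto
      show "closed (closure {p. f p \<noteq> 0} \<inter> - V p)" using bV(2) by (intro closed_Int) auto
    qed
    then have "supp (\<lambda>q. f q * (1 - b p q)) \<subseteq> (\<Union>p\<in>A. V p)" using insert.prems(1) by auto
    from insert.IH[OF this 2] have "P (\<lambda>q. f q * (1 - b p q))" .
    from add[OF chart[OF chart_at_atlas 1] this] show ?case by (simp add: algebra_simps)
  qed
qed

section \<open>Brackets, metrics and Lie derivatives in arbitrary charts\<close>

lemma vf_rep_lie_bracket:
  assumes c: "c \<in> atlas M" "p \<in> cdom c" and X: "smooth_vf_at p X" and Y: "smooth_vf_at p Y"
  shows "vf_rep M c (lie_bracket M X Y) (coord c p) = lb (vf_rep M c X) (vf_rep M c Y) (coord c p)"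
proof -
  let ?d = "chart_at M p"
  have d: "?d \<in> atlas M" "p \<in> cdom ?d" by auto
  have s: "smooth_at (coord e p) (vf_rep M e X)" "smooth_at (coord e p) (vf_rep M e Y)"
    if "e \<in> atlas M" "p \<in> cdom e" for e
    using X Y that by (auto simp: smooth_vf_at_def)
  have "lie_bracket M X Y p = lb (vf_rep M ?d X) (vf_rep M ?d Y) (coord ?d p)"
    by (simp add: lie_bracket_def lb_def Let_def)
  moreover have "tr ?d c (coord ?d p) = coord c p" using d by simp
  ultimately show ?thesis
    using lb_related[OF smooth_at_tr[OF d c] s[OF d] _ _ vf_rep_tr[OF d c] vf_rep_tr[OF d c]]
      s[OF c] c by (simp add: vf_rep_coord to_chart_eq)
qed

lemma smooth_vf_at_eventually:
  assumes "smooth_vf_at p X"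
  shows "\<forall>\<^sub>F q in nhds p. smooth_vf_at q X"
proof -
  let ?c = "chart_at M p"
  have "\<forall>\<^sub>F q in nhds p. smooth_at (coord ?c q) (vf_rep M ?c X)"
    using assms by (intro eventually_coord smooth_at_eventually) (auto simp: smooth_vf_at_def)
  moreover have "\<forall>\<^sub>F q in nhds p. q \<in> cdom ?c"
    using open_cdom[of ?c] by (auto simp: eventually_nhds)
  ultimately show ?thesis by eventually_elim (rule smooth_vf_atI[of ?c], auto)
qed

lemma smooth_vf_at_lie_bracket:
  assumes "smooth_vf_at p X" "smooth_vf_at p Y"
  shows "smooth_vf_at p (lie_bracket M X Y)"
proof -
  let ?c = "chart_at M p"
  have "\<forall>\<^sub>F q in nhds p. smooth_vf_at q X \<and> smooth_vf_at q Y"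
    by (intro eventually_conj smooth_vf_at_eventually assms)
  from eventually_coord_inv[OF chart_at_atlas chart_at_cdom this]
  have "\<forall>\<^sub>F x in nhds (coord ?c p). lb (vf_rep M ?c X) (vf_rep M ?c Y) x =
      vf_rep M ?c (lie_bracket M X Y) x"
    by eventually_elim (auto simp: vf_rep_lie_bracket)
  moreover have "smooth_at (coord ?c p) (lb (vf_rep M ?c X) (vf_rep M ?c Y))"
    using assms by (intro smooth_at_lb) (auto simp: smooth_vf_at_def)
  ultimately show ?thesis
    by (rule smooth_vf_atI[OF chart_at_atlas chart_at_cdom smooth_at_cong])
qed

lemma metric_rep_coord:
  "c \<in> atlas M \<Longrightarrow> p \<in> cdom c \<Longrightarrow>
   metric_rep M g c (coord c p) u v = g p (from_chart M c p u) (from_chart M c p v)"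
  by (simp add: metric_rep_def)

lemma metric_rep_to_chart:
  "c \<in> atlas M \<Longrightarrow> p \<in> cdom c \<Longrightarrow>
   metric_rep M g c (coord c p) (to_chart M c p u) (to_chart M c p v) = g p u v"
  by (simp add: metric_rep_def)

lemma metric_rep_tr:
  assumes "c \<in> atlas M" "p \<in> cdom c" "d \<in> atlas M" "p \<in> cdom d"
  shows "\<forall>\<^sub>F x in nhds (coord c p). \<forall>u v. metric_rep M g c x u v =
    metric_rep M g d (tr c d x) (Dv (tr c d) x u) (Dv (tr c d) x v)"
  using eventually_coord_domains[OF assms]
  by eventually_elim (use assms in \<open>auto simp: metric_rep_coord from_chart_Dv_tr\<close>)

text \<open>Independence of the chart is naturality under the transition map: the components of
  \<open>X\<close> are related by it, and the metric in one chart is the pullback of the metric in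
  the other.\<close>

lemma lie_deriv_metric_chart:
  assumes c: "c \<in> atlas M" "p \<in> cdom c" and X: "smooth_vf_at p X"
    and g: "bilin_at (coord c p) (metric_rep M g c)"
  shows "lie_deriv_metric M X g p a b =
    ld (vf_rep M c X) (metric_rep M g c) (coord c p) (to_chart M c p a) (to_chart M c p b)"
proof -
  let ?d = "chart_at M p"
  have d: "?d \<in> atlas M" "p \<in> cdom ?d" by auto
  have s: "smooth_at (coord e p) (vf_rep M e X)" if "e \<in> atlas M" "p \<in> cdom e" for e
    using X that by (auto simp: smooth_vf_at_def)
  have trp: "tr ?d c (coord ?d p) = coord c p" using d by simp
  have ev: "\<forall>\<^sub>F x in nhds (coord ?d p). \<forall>u v. metric_rep M g ?d x u v =
      metric_rep M g c (tr ?d c x) (Dv (tr ?d c) x u) (Dv (tr ?d c) x v)"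
    by (rule metric_rep_tr[OF d c])
  have "lie_deriv_metric M X g p a b = ld (vf_rep M ?d X) (metric_rep M g ?d) (coord ?d p) a b"
    by (simp add: lie_deriv_metric_def ld_def Let_def)
  also have "\<dots> = ld (vf_rep M ?d X)
      (\<lambda>x u v. metric_rep M g c (tr ?d c x) (Dv (tr ?d c) x u) (Dv (tr ?d c) x v)) (coord ?d p) a b"
  proof (rule ld_cong)
    show "\<forall>\<^sub>F x in nhds (coord ?d p). metric_rep M g ?d x a b =
        metric_rep M g c (tr ?d c x) (Dv (tr ?d c) x a) (Dv (tr ?d c) x b)"
      using ev by eventually_elim blast
    show "metric_rep M g ?d (coord ?d p) = (\<lambda>u v. metric_rep M g c (tr ?d c (coord ?d p))
        (Dv (tr ?d c) (coord ?d p) u) (Dv (tr ?d c) (coord ?d p) v))"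
      using eventually_nhds_x_imp_x[OF ev] by (intro ext) blast
  qed simp
  also have "\<dots> = ld (vf_rep M c X) (metric_rep M g c) (tr ?d c (coord ?d p))
      (Dv (tr ?d c) (coord ?d p) a) (Dv (tr ?d c) (coord ?d p) b)"
    by (rule ld_related[OF smooth_at_tr[OF d c] s[OF d] _ _ vf_rep_tr[OF d c]])
      (simp_all only: trp s[OF c] g)
  finally show ?thesis by (simp only: trp to_chart_eq)
qed

end

locale riem_mfd = smooth_mfd M
  for M :: "('a::{t2_space,second_countable_topology}, 'e::finite_dimensional_inner) manifold" +
  fixes g :: "'a \<Rightarrow> 'e \<Rightarrow> 'e \<Rightarrow> real"
  assumes riemannian: "riemannian_manifold M g"
begin

lemma inner_form_metric: "inner_form (g p)"
  using riemannian by (auto simp: riemannian_manifold_def inner_form_def)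

lemma inner_form_metric_rep:
  assumes c: "c \<in> atlas M" "p \<in> cdom c"
  shows "inner_form (metric_rep M g c (coord c p))"
proof -
  have "bilinear (\<lambda>u v. g p (from_chart M c p u) (from_chart M c p v))"
    by (rule bilinear_compose_linear[OF inner_form_bilinear[OF inner_form_metric] linear_from_chart[OF c]])
  moreover have "from_chart M c p u \<noteq> 0" if "u \<noteq> 0" for u
    using that c to_chart_from_chart[OF c, of u] linear_0[OF linear_to_chart[OF c]] by metis
  ultimately show ?thesis
    using inner_form_sym[OF inner_form_metric] inner_form_pos[OF inner_form_metric]
    unfolding inner_form_def by (simp add: metric_rep_coord[OF c, abs_def])
qed

lemma metric_at_rep:
  assumes c: "c \<in> atlas M" "p \<in> cdom c"
  shows "metric_at (coord c p) (metric_rep M g c)"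
proof -
  have "\<forall>\<^sub>F x in nhds (coord c p). inner_form (metric_rep M g c x)"
    using eventually_coord_domains[OF c c]
  proof eventually_elim
    case (elim x)
    then obtain q where "q \<in> cdom c" "x = coord c q" by blast
    then show ?case using inner_form_metric_rep[OF c(1)] by simp
  qed
  moreover have "smooth_at (coord c p) (\<lambda>x. metric_rep M g c x u v)" for u v
    using riemannian c smooth_on_iff_smooth_at[OF open_coord_image[OF c(1)]]
    unfolding riemannian_manifold_def by blast
  ultimately show ?thesis by (simp add: metric_at_def)
qed

lemmas bilin_at_rep = metric_at_bilin_at[OF metric_at_rep]

end

context smooth_mfd
begin

text \<open>\<open>X\<close> may be arbitrary outside \<open>U\<close>: near a point off the support
  of \<open>f\<close> the product is zero. This is how fields that are smooth only on
  \<open>U\<close>, such as local generators, become global.\<close>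

lemma smooth_vf_at_cutoff:
  assumes "f \<in> Cc_smooth M U" "\<And>p. p \<in> U \<Longrightarrow> smooth_vf_at p X"
  shows "smooth_vf_at p (\<lambda>q. f q *\<^sub>R X q)"
proof (cases "p \<in> supp f")
  case True
  then show ?thesis
    using assms Cc_smoothD[OF assms(1)] by (intro smooth_vf_at_scale) (auto simp: smooth_fun_iff)
next
  case False
  have "\<forall>\<^sub>F q in nhds p. 0 = f q *\<^sub>R X q"
    using eventually_zero_off_supp[OF False] by eventually_elim simp
  then show ?thesis by (rule smooth_vf_at_cong) (rule smooth_vf_at_zero)
qed

lemma Cc_smooth_cutoff:
  assumes f: "f \<in> Cc_smooth M U" and g: "\<And>p. p \<in> U \<Longrightarrow> smooth_fun_at p g"
  shows "(\<lambda>p. f p * g p) \<in> Cc_smooth M U"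
proof (rule Cc_smoothI[OF _ Cc_smoothD(2,3)[OF f]])
  have "smooth_fun_at p (\<lambda>p. f p * g p)" for p
  proof (cases "p \<in> supp f")
    case True
    then show ?thesis
      using g Cc_smoothD[OF f] by (intro smooth_fun_at_mult) (auto simp: smooth_fun_iff)
  next
    case False
    have "\<forall>\<^sub>F q in nhds p. 0 = f q * g q"
      using eventually_zero_off_supp[OF False] by eventually_elim simp
    then show ?thesis by (rule smooth_fun_at_cong) (rule smooth_fun_at_const)
  qed
  then show "smooth_fun M (\<lambda>p. f p * g p)" by (simp add: smooth_fun_iff)
qed (simp add: not_in_supp)

lemma smooth_one_form_cutoff:
  assumes f: "f \<in> Cc_smooth M U" and "\<And>p. p \<in> U \<Longrightarrow> smooth_form_at p \<alpha>" "\<And>p. linear (\<alpha> p)"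
  shows "smooth_one_form M (\<lambda>p u. f p * \<alpha> p u)"
proof -
  have lin: "linear (\<lambda>u. f p * \<alpha> p u)" for p
    using linear_compose_scale_right[OF assms(3), of "f p"] by simp
  have "smooth_form_at p (\<lambda>p u. f p * \<alpha> p u)" for p
  proof (cases "p \<in> supp f")
    case True
    then have p: "p \<in> U" using Cc_smoothD(3)[OF f] by auto
    let ?c = "chart_at M p"
    have "smooth_at (coord ?c p) (\<lambda>x. f (coord_inv ?c x))"
      using Cc_smoothD(1)[OF f] by (auto simp: smooth_fun_iff smooth_fun_at_def)
    moreover have "smooth_at (coord ?c p)
        (\<lambda>x. \<alpha> (coord_inv ?c x) (from_chart M ?c (coord_inv ?c x) u))" for u
      using assms(2)[OF p] by (auto simp: smooth_form_at_def)
    ultimately show ?thesis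
      by (intro smooth_form_atI[OF chart_at_atlas chart_at_cdom lin] smooth_at_mult)
  next
    case False
    have "\<forall>\<^sub>F q in nhds p. (\<lambda>u. 0) = (\<lambda>u. f q * \<alpha> q u)"
      using eventually_zero_off_supp[OF False] by eventually_elim simp
    then show ?thesis by (rule smooth_form_at_cong) (simp add: smooth_form_at_def)
  qed
  with lin show ?thesis by (simp add: smooth_one_form_iff)
qed

text \<open>The vector field with constant components \<open>u\<close> in the chart \<open>c\<close>.\<close>

lemma smooth_vf_at_from_chart:
  assumes c: "c \<in> atlas M" "p \<in> cdom c"
  shows "smooth_vf_at p (\<lambda>q. from_chart M c q u)"
proof (rule smooth_vf_atI[OF c], rule smooth_at_cong)
  show "\<forall>\<^sub>F x in nhds (coord c p). u = vf_rep M c (\<lambda>q. from_chart M c q u) x"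
    using eventually_coord_domains[OF c c]
    by eventually_elim (use c in \<open>auto simp: vf_rep_coord\<close>)
qed simp

lemma smooth_fun_at_component:
  assumes c: "c \<in> atlas M" "p \<in> cdom c" and X: "smooth_vf_at p X"
  shows "smooth_fun_at p (\<lambda>q. to_chart M c q (X q) \<bullet> b)"
proof (rule smooth_fun_atI[OF c])
  have "smooth_at (coord c p) (\<lambda>x. vf_rep M c X x \<bullet> b)"
    using X c by (intro smooth_at_inner smooth_at_const) (auto simp: smooth_vf_at_def)
  then show "smooth_at (coord c p) (\<lambda>x. to_chart M c (coord_inv c x) (X (coord_inv c x)) \<bullet> b)"
    by (simp add: vf_rep_def)
qed

subsection \<open>Differentials of functions and the Leibniz rules\<close>

definition cdiff :: "('a \<Rightarrow> real) \<Rightarrow> 'a \<Rightarrow> 'e \<Rightarrow> real" where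
  "cdiff f p = Dv (\<lambda>x. f (coord_inv (chart_at M p) x)) (coord (chart_at M p) p)"

lemma cdiff_chart:
  assumes c: "c \<in> atlas M" "p \<in> cdom c" and f: "smooth_fun_at p f"
  shows "cdiff f p u = Dv (\<lambda>x. f (coord_inv c x)) (coord c p) (to_chart M c p u)"
proof -
  let ?d = "chart_at M p"
  have d: "?d \<in> atlas M" "p \<in> cdom ?d" by auto
  have "\<forall>\<^sub>F x in nhds (coord ?d p). f (coord_inv ?d x) = f (coord_inv c (tr ?d c x))"
    using eventually_coord_domains[OF d c] by eventually_elim (use c in auto)
  then have "cdiff f p = Dv (\<lambda>x. f (coord_inv c (tr ?d c x))) (coord ?d p)"
    unfolding cdiff_def by (rule Dv_cong)
  moreover have "Dv (\<lambda>x. f (coord_inv c (tr ?d c x))) (coord ?d p) u =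
      Dv (\<lambda>x. f (coord_inv c x)) (tr ?d c (coord ?d p)) (Dv (tr ?d c) (coord ?d p) u)"
    using f c d
    by (intro Dv_compose[where g = "\<lambda>x. f (coord_inv c x)"] smooth_at_differentiable smooth_at_tr)
      (auto simp: smooth_fun_at_def)
  ultimately show ?thesis using d by (simp add: to_chart_eq)
qed

lemma smooth_fun_at_eventually:
  assumes "smooth_fun_at p f"
  shows "\<forall>\<^sub>F q in nhds p. smooth_fun_at q f"
proof -
  let ?c = "chart_at M p"
  have "\<forall>\<^sub>F q in nhds p. smooth_at (coord ?c q) (\<lambda>x. f (coord_inv ?c x))"
    using assms by (intro eventually_coord smooth_at_eventually) (auto simp: smooth_fun_at_def)
  moreover have "\<forall>\<^sub>F q in nhds p. q \<in> cdom ?c"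
    using open_cdom[of ?c] by (auto simp: eventually_nhds)
  ultimately show ?thesis by eventually_elim (rule smooth_fun_atI[of ?c], auto)
qed

lemma linear_cdiff: "smooth_fun_at p f \<Longrightarrow> linear (cdiff f p)"
  unfolding cdiff_def by (rule smooth_at_linear_Dv) (auto simp: smooth_fun_at_def)

lemma smooth_form_cdiff:
  assumes "smooth_fun M f"
  shows "smooth_one_form M (cdiff f)"
proof -
  have f: "smooth_fun_at p f" for p using assms by (simp add: smooth_fun_iff)
  have "smooth_form_at p (cdiff f)" for p
  proof (rule smooth_form_atI[OF chart_at_atlas chart_at_cdom linear_cdiff[OF f]])
    fix u
    let ?c = "chart_at M p"
    have c: "?c \<in> atlas M" "p \<in> cdom ?c" by auto
    have "\<forall>\<^sub>F x in nhds (coord ?c p). Dv (\<lambda>x. f (coord_inv ?c x)) x u =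
        cdiff f (coord_inv ?c x) (from_chart M ?c (coord_inv ?c x) u)"
      using eventually_coord_domains[OF c c]
      by eventually_elim (use c in \<open>auto simp: cdiff_chart[OF _ _ f, of ?c]\<close>)
    moreover have "smooth_at (coord ?c p) (\<lambda>x. Dv (\<lambda>x. f (coord_inv ?c x)) x u)"
      using f by (intro smooth_at_Dv) (auto simp: smooth_fun_at_def)
    ultimately show "smooth_at (coord ?c p)
        (\<lambda>x. cdiff f (coord_inv ?c x) (from_chart M ?c (coord_inv ?c x) u))"
      by (rule smooth_at_cong)
  qed
  with linear_cdiff f show ?thesis by (simp add: smooth_one_form_iff)
qed

lemma smooth_fun_at_cdiff:
  assumes f: "smooth_fun_at p f" and X: "smooth_vf_at p X"
  shows "smooth_fun_at p (\<lambda>q. cdiff f q (X q))"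
proof (rule smooth_fun_atI[OF chart_at_atlas chart_at_cdom])
  let ?c = "chart_at M p"
  have c: "?c \<in> atlas M" "p \<in> cdom ?c" by auto
  from eventually_coord_inv[OF c smooth_fun_at_eventually[OF f]]
  have "\<forall>\<^sub>F x in nhds (coord ?c p). Dv (\<lambda>x. f (coord_inv ?c x)) x (vf_rep M ?c X x) =
      cdiff f (coord_inv ?c x) (X (coord_inv ?c x))"
    by eventually_elim (use c in \<open>auto simp: cdiff_chart[of ?c] vf_rep_coord\<close>)
  moreover have "smooth_at (coord ?c p) (\<lambda>x. Dv (\<lambda>x. f (coord_inv ?c x)) x (vf_rep M ?c X x))"
    using f X by (intro smooth_at_Dv_family) (auto simp: smooth_fun_at_def smooth_vf_at_def)
  ultimately show "smooth_at (coord ?c p) (\<lambda>x. cdiff f (coord_inv ?c x) (X (coord_inv ?c x)))"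
    by (rule smooth_at_cong)
qed

lemma cdiff_off_supp:
  assumes "p \<notin> supp f"
  shows "cdiff f p u = 0"
proof -
  have "\<forall>\<^sub>F x in nhds (coord (chart_at M p) p). f (coord_inv (chart_at M p) x) = 0"
    using eventually_coord_inv[OF chart_at_atlas chart_at_cdom eventually_zero_off_supp[OF assms]]
    by eventually_elim simp
  from Dv_cong[OF this] show ?thesis by (simp add: cdiff_def)
qed

lemma lie_bracket_lb:
  "lie_bracket M X Y p =
    lb (vf_rep M (chart_at M p) X) (vf_rep M (chart_at M p) Y) (coord (chart_at M p) p)"
  by (simp add: lie_bracket_def lb_def Let_def)

lemma lb_cong:
  assumes "\<forall>\<^sub>F y in nhds x. V y = V' y" "\<forall>\<^sub>F y in nhds x. W y = W' y"
  shows "lb V W x = lb V' W' x"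
  unfolding lb_def using Dv_cong[OF assms(1)] Dv_cong[OF assms(2)]
    eventually_nhds_x_imp_x[OF assms(1)] eventually_nhds_x_imp_x[OF assms(2)] by simp

lemma lie_bracket_skew: "lie_bracket M X Y p = - lie_bracket M Y X p"
  by (simp add: lie_bracket_lb lb_def)

lemma lie_bracket_zero: "smooth_vf_at p Y \<Longrightarrow> lie_bracket M (\<lambda>_. 0) Y p = 0"
proof -
  let ?c = "chart_at M p"
  assume Y: "smooth_vf_at p Y"
  then have "linear (Dv (vf_rep M ?c Y) (coord ?c p))"
    by (intro smooth_at_linear_Dv) (auto simp: smooth_vf_at_def)
  moreover have "lie_bracket M (\<lambda>_. 0) Y p = lb (\<lambda>_. 0) (vf_rep M ?c Y) (coord ?c p)"
    unfolding lie_bracket_lb by (rule lb_cong[OF vf_rep_zero]) auto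
  ultimately show ?thesis by (simp add: lb_def linear_0)
qed

lemma lie_bracket_add:
  assumes X: "smooth_vf_at p X" and Z: "smooth_vf_at p Z" and Y: "smooth_vf_at p Y"
  shows "lie_bracket M (\<lambda>q. X q + Z q) Y p = lie_bracket M X Y p + lie_bracket M Z Y p"
proof -
  let ?c = "chart_at M p"
  have s: "smooth_at (coord ?c p) (vf_rep M ?c X)" "smooth_at (coord ?c p) (vf_rep M ?c Y)"
    "smooth_at (coord ?c p) (vf_rep M ?c Z)"
    using assms by (auto simp: smooth_vf_at_def)
  have "lie_bracket M (\<lambda>q. X q + Z q) Y p =
      lb (\<lambda>x. vf_rep M ?c X x + vf_rep M ?c Z x) (vf_rep M ?c Y) (coord ?c p)"
    unfolding lie_bracket_lb by (rule lb_cong[OF vf_rep_add]) auto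
  then show ?thesis
    using s linear_add[OF smooth_at_linear_Dv[OF s(2)]]
    by (simp add: lie_bracket_lb lb_def Dv_add smooth_at_differentiable)
qed

lemma lie_bracket_scale:
  assumes f: "smooth_fun_at p f" and X: "smooth_vf_at p X" and Y: "smooth_vf_at p Y"
  shows "lie_bracket M (\<lambda>q. f q *\<^sub>R X q) Y p = f p *\<^sub>R lie_bracket M X Y p - cdiff f p (Y p) *\<^sub>R X p"
proof -
  let ?c = "chart_at M p"
  have s: "smooth_at (coord ?c p) (vf_rep M ?c X)" "smooth_at (coord ?c p) (vf_rep M ?c Y)"
    "smooth_at (coord ?c p) (\<lambda>x. f (coord_inv ?c x))"
    using assms by (auto simp: smooth_vf_at_def smooth_fun_at_def)
  have "lie_bracket M (\<lambda>q. f q *\<^sub>R X q) Y p =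
      lb (\<lambda>x. f (coord_inv ?c x) *\<^sub>R vf_rep M ?c X x) (vf_rep M ?c Y) (coord ?c p)"
    unfolding lie_bracket_lb by (rule lb_cong[OF vf_rep_scale]) auto
  then show ?thesis
    using s linear_scale[OF smooth_at_linear_Dv[OF s(2)]]
    by (simp add: lie_bracket_lb lb_def Dv_scaleR smooth_at_differentiable cdiff_def vf_rep_coord
        algebra_simps)
qed

end

section \<open>Spans of vector fields over function rings\<close>

lemma fun_span_zero: "(\<lambda>_. 0) \<in> fun_span R S"
  unfolding fun_span_def by (auto intro!: exI[of _ "0::nat"])

lemma fun_span_Cons:
  assumes "f \<in> R" "X \<in> S" "Y \<in> fun_span R S"
  shows "(\<lambda>p. f p *\<^sub>R X p + Y p) \<in> fun_span R S"
proof -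
  obtain k :: nat and h Z where Y: "\<forall>i<k. h i \<in> R \<and> Z i \<in> S" "Y = (\<lambda>p. \<Sum>i<k. h i p *\<^sub>R Z i p)"
    using assms(3) unfolding fun_span_def by blast
  have "(\<lambda>p. f p *\<^sub>R X p + Y p) =
      (\<lambda>p. \<Sum>i<Suc k. (case i of 0 \<Rightarrow> f | Suc j \<Rightarrow> h j) p *\<^sub>R (case i of 0 \<Rightarrow> X | Suc j \<Rightarrow> Z j) p)"
    by (simp add: Y(2) sum.lessThan_Suc_shift del: sum.lessThan_Suc)
  moreover have "\<forall>i<Suc k. (case i of 0 \<Rightarrow> f | Suc j \<Rightarrow> h j) \<in> R \<and> (case i of 0 \<Rightarrow> X | Suc j \<Rightarrow> Z j) \<in> S"
    using Y(1) assms(1,2) by (auto split: nat.split)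
  ultimately show ?thesis unfolding fun_span_def by blast
qed

text \<open>Treats the span like a list of products, so that later inductions add one product at a
  time and never handle indexed sums.\<close>

lemma fun_span_induct [consumes 1, case_names zero step]:
  assumes "Y \<in> fun_span R S" "P (\<lambda>_. 0)"
    and step: "\<And>f X Y. f \<in> R \<Longrightarrow> X \<in> S \<Longrightarrow> Y \<in> fun_span R S \<Longrightarrow> P Y \<Longrightarrow> P (\<lambda>p. f p *\<^sub>R X p + Y p)"
  shows "P Y"
proof -
  obtain k :: nat and h Z where Y: "\<forall>i<k. h i \<in> R \<and> Z i \<in> S" "Y = (\<lambda>p. \<Sum>i<k. h i p *\<^sub>R Z i p)"
    using assms(1) unfolding fun_span_def by blast
  have "j \<le> k \<Longrightarrow> (\<lambda>p. \<Sum>i<j. h i p *\<^sub>R Z i p) \<in> fun_span R S \<and> P (\<lambda>p. \<Sum>i<j. h i p *\<^sub>R Z i p)" for j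
  proof (induction j)
    case 0
    then show ?case using assms(2) fun_span_zero by simp
  next
    case (Suc j)
    then have "(\<lambda>p. \<Sum>i<j. h i p *\<^sub>R Z i p) \<in> fun_span R S" "P (\<lambda>p. \<Sum>i<j. h i p *\<^sub>R Z i p)"
      "h j \<in> R" "Z j \<in> S" using Y(1) by auto
    then show ?case
      using step[of "h j" "Z j" "\<lambda>p. \<Sum>i<j. h i p *\<^sub>R Z i p"]
        fun_span_Cons[of "h j" R "Z j" S "\<lambda>p. \<Sum>i<j. h i p *\<^sub>R Z i p"]
      by (simp add: add.commute)
  qed
  then show ?thesis using Y(2) by auto
qed

lemma fun_span_single: "f \<in> R \<Longrightarrow> X \<in> S \<Longrightarrow> (\<lambda>p. f p *\<^sub>R X p) \<in> fun_span R S"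
  using fun_span_Cons[OF _ _ fun_span_zero, of f R X S] by simp

lemma fun_span_add:
  assumes "X \<in> fun_span R S" "Y \<in> fun_span R S"
  shows "(\<lambda>p. X p + Y p) \<in> fun_span R S"
  using assms(1)
proof (induction rule: fun_span_induct)
  case zero
  then show ?case using assms(2) by simp
next
  case (step f Z W)
  then show ?case using fun_span_Cons[of f R Z S "\<lambda>p. W p + Y p"] by (simp add: add.assoc)
qed

lemma fun_span_sum:
  assumes "finite I" "\<And>i. i \<in> I \<Longrightarrow> X i \<in> fun_span R S"
  shows "(\<lambda>p. \<Sum>i\<in>I. X i p) \<in> fun_span R S"
  using assms by (induction I rule: finite_induct) (auto intro: fun_span_zero fun_span_add)

lemma fun_span_scale:
  assumes "X \<in> fun_span R S" "\<And>f. f \<in> R \<Longrightarrow> (\<lambda>p. f p * \<phi> p) \<in> R'"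
  shows "(\<lambda>p. \<phi> p *\<^sub>R X p) \<in> fun_span R' S"
  using assms(1)
proof (induction rule: fun_span_induct)
  case zero
  then show ?case using fun_span_zero by simp
next
  case (step f Z W)
  then show ?case
    using fun_span_Cons[OF assms(2), of f Z S "\<lambda>p. \<phi> p *\<^sub>R W p"]
    by (simp add: scaleR_add_right mult.commute)
qed

section \<open>Horizontal lifts\<close>

abbreviation prj :: "('b \<Rightarrow> 'a) \<Rightarrow> ('b, 'f) chart \<Rightarrow> ('a, 'e) chart \<Rightarrow> 'f \<Rightarrow> 'e" where
  "prj \<pi> c d \<equiv> (\<lambda>x. coord d (\<pi> (coord_inv c x)))"

locale riem_subm = N: riem_mfd N h + M: riem_mfd M g
  for N :: "('b::{t2_space,second_countable_topology}, 'f::finite_dimensional_inner) manifold"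
    and h :: "'b \<Rightarrow> 'f \<Rightarrow> 'f \<Rightarrow> real"
    and M :: "('a::{t2_space,second_countable_topology}, 'e::finite_dimensional_inner) manifold"
    and g :: "'a \<Rightarrow> 'e \<Rightarrow> 'e \<Rightarrow> real" +
  fixes \<pi> :: "'b \<Rightarrow> 'a"
  assumes riemannian_submersion: "riemannian_submersion N h M g \<pi>"
begin

abbreviation d\<pi> :: "'b \<Rightarrow> 'f \<Rightarrow> 'e" where "d\<pi> \<equiv> differential N M \<pi>"

lemma continuous_pi: "continuous_on UNIV \<pi>"
  using riemannian_submersion
  by (simp add: riemannian_submersion_def smooth_submersion_def smooth_map_def)

lemma open_vimage_pi: "open U \<Longrightarrow> open (\<pi> -` U)"
  using continuous_pi by (simp add: continuous_on_open_vimage)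

lemma eventually_domains:
  assumes "c \<in> atlas N" "q \<in> cdom c" "d \<in> atlas M" "\<pi> q \<in> cdom d"
  shows "\<forall>\<^sub>F x in nhds (coord c q). x \<in> coord c ` cdom c \<and> \<pi> (coord_inv c x) \<in> cdom d"
proof -
  have "\<forall>\<^sub>F x in nhds (coord c q). x \<in> coord c ` cdom c \<and> coord_inv c x \<in> \<pi> -` cdom d"
    using assms by (intro N.eventually_coord_inv_open open_vimage_pi M.open_cdom) auto
  then show ?thesis by simp
qed

lemma smooth_at_prj:
  assumes "c \<in> atlas N" "q \<in> cdom c" "d \<in> atlas M" "\<pi> q \<in> cdom d"
  shows "smooth_at (coord c q) (prj \<pi> c d)"
proof -
  have "smooth_on (coord c ` (cdom c \<inter> \<pi> -` cdom d)) (coord d \<circ> \<pi> \<circ> coord_inv c)"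
    using riemannian_submersion assms
    unfolding riemannian_submersion_def smooth_submersion_def smooth_map_def by blast
  moreover have "open (coord c ` (cdom c \<inter> \<pi> -` cdom d))"
    by (intro N.open_coord_image_Int open_vimage_pi M.open_cdom assms)
  ultimately show ?thesis
    using assms smooth_on_iff_smooth_at unfolding o_def by blast
qed

lemma Dv_prj:
  assumes c: "c \<in> atlas N" "q \<in> cdom c" and d: "d \<in> atlas M" "\<pi> q \<in> cdom d"
  shows "Dv (prj \<pi> c d) (coord c q) (to_chart N c q u) = to_chart M d (\<pi> q) (d\<pi> q u)"
proof -
  let ?c = "chart_at N q" and ?d = "chart_at M (\<pi> q)"
  have c': "?c \<in> atlas N" "q \<in> cdom ?c" and d': "?d \<in> atlas M" "\<pi> q \<in> cdom ?d" by auto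
  note di = smooth_at_differentiable
  have "\<forall>\<^sub>F x in nhds (coord ?c q). tr ?d d (prj \<pi> ?c ?d x) = prj \<pi> c d (tr ?c c x)"
    using N.eventually_coord_domains[OF c' c] eventually_domains[OF c' d']
    by eventually_elim (use c d in auto)
  from fun_cong[OF Dv_cong[OF this], of u]
  have "Dv (tr ?d d) (coord ?d (\<pi> q)) (Dv (prj \<pi> ?c ?d) (coord ?c q) u) =
      Dv (prj \<pi> c d) (coord c q) (Dv (tr ?c c) (coord ?c q) u)"
    using Dv_compose[OF di[OF smooth_at_prj[OF c' d']], of "tr ?d d" u]
      Dv_compose[OF di[OF N.smooth_at_tr[OF c' c]], of "prj \<pi> c d" u]
      di[OF M.smooth_at_tr[OF d' d]] di[OF smooth_at_prj[OF c d]] c'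
    by simp
  then show ?thesis by (simp add: M.to_chart_eq N.to_chart_eq differential_def o_def)
qed

lemma linear_differential: "linear (d\<pi> q)"
  using smooth_at_linear_Dv[OF smooth_at_prj[OF N.chart_at_atlas N.chart_at_cdom M.chart_at_atlas
    M.chart_at_cdom]] by (simp add: differential_def o_def)

text \<open>The horizontal preimage of \<open>a\<close> is the required lift. An arbitrary
  \<open>w\<close> may be replaced by a horizontal \<open>w'\<close> with the same image, since the
  vertical difference is orthogonal to the lift; for horizontal vectors the isometry property
  applies.\<close>

lemma riem_sub_differential: "riem_sub (h q) (g (\<pi> q)) (d\<pi> q)"
  unfolding riem_sub_def
proof
  fix a
  let ?H = "horizontal_space N h M \<pi> q"
  have onto: "\<exists>u\<in>?H. d\<pi> q u = b" for b
    using riemannian_submersion unfolding riemannian_submersion_def by (metis UNIV_I image_iff)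
  have iso: "g (\<pi> q) (d\<pi> q u) (d\<pi> q v) = h q u v" if "u \<in> ?H" "v \<in> ?H" for u v
    using riemannian_submersion that unfolding riemannian_submersion_def by blast
  obtain u where u: "u \<in> ?H" "d\<pi> q u = a" using onto by blast
  have "h q u w = g (\<pi> q) a (d\<pi> q w)" for w
  proof -
    obtain w' where w': "w' \<in> ?H" "d\<pi> q w' = d\<pi> q w" using onto by blast
    have "d\<pi> q (w - w') = 0" using w' by (simp add: linear_diff[OF linear_differential])
    then have "h q u (w - w') = 0" using u by (simp add: horizontal_space_def)
    then have "h q u w = h q u w'"
      by (simp add: bilinear_rsub[OF inner_form_bilinear[OF N.inner_form_metric]])
    then show ?thesis using iso[OF u(1) w'(1)] u w' by simp
  qed
  with u show "\<exists>u. d\<pi> q u = a \<and> (\<forall>w. h q u w = g (\<pi> q) a (d\<pi> q w))" by blast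
qed

lemma riem_sub_prj:
  assumes c: "c \<in> atlas N" "q \<in> cdom c" and d: "d \<in> atlas M" "\<pi> q \<in> cdom d"
  shows "riem_sub (metric_rep N h c (coord c q)) (metric_rep M g d (coord d (\<pi> q)))
    (Dv (prj \<pi> c d) (coord c q))"
  unfolding riem_sub_def
proof
  fix a
  obtain u where u: "d\<pi> q u = from_chart M d (\<pi> q) a"
    "\<And>w. h q u w = g (\<pi> q) (from_chart M d (\<pi> q) a) (d\<pi> q w)"
    using riem_sub_differential unfolding riem_sub_def by blast
  have "Dv (prj \<pi> c d) (coord c q) (to_chart N c q u) = a"
    using u(1) d by (simp add: Dv_prj[OF c d])
  moreover have "metric_rep N h c (coord c q) (to_chart N c q u) w =
      metric_rep M g d (coord d (\<pi> q)) a (Dv (prj \<pi> c d) (coord c q) w)" for w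
  proof -
    define w' where "w' = from_chart N c q w"
    have w: "w = to_chart N c q w'" using c by (simp add: w'_def)
    show ?thesis
      unfolding w Dv_prj[OF c d] N.metric_rep_to_chart[OF c] M.metric_rep_coord[OF d]
      using u(2) d by simp
  qed
  ultimately show "\<exists>u. Dv (prj \<pi> c d) (coord c q) u = a \<and>
    (\<forall>w. metric_rep N h c (coord c q) u w =
      metric_rep M g d (coord d (\<pi> q)) a (Dv (prj \<pi> c d) (coord c q) w))" by blast
qed

lemma riem_sub_prj_eventually:
  assumes c: "c \<in> atlas N" "q \<in> cdom c" and d: "d \<in> atlas M" "\<pi> q \<in> cdom d"
  shows "\<forall>\<^sub>F x in nhds (coord c q). riem_sub (metric_rep N h c x)
    (metric_rep M g d (prj \<pi> c d x)) (Dv (prj \<pi> c d) x)"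
  using eventually_domains[OF c d]
proof eventually_elim
  case (elim x)
  then obtain r where r: "r \<in> cdom c" "x = coord c r" by blast
  with elim c have "\<pi> r \<in> cdom d" by simp
  from riem_sub_prj[OF c(1) r(1) d(1) this] show ?case using r c by simp
qed

lemma related_prj:
  assumes c: "c \<in> atlas N" "q \<in> cdom c" and d: "d \<in> atlas M" "\<pi> q \<in> cdom d"
    and "\<forall>\<^sub>F r in nhds q. d\<pi> r (V r) = X (\<pi> r)"
  shows "\<forall>\<^sub>F x in nhds (coord c q). Dv (prj \<pi> c d) x (vf_rep N c V x) = vf_rep M d X (prj \<pi> c d x)"
  using eventually_domains[OF c d] N.eventually_coord_inv[OF c assms(5)]
proof eventually_elim
  case (elim x)
  then obtain r where r: "r \<in> cdom c" "x = coord c r" by blast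
  with elim c have "\<pi> r \<in> cdom d" "d\<pi> r (V r) = X (\<pi> r)" by auto
  with r c d show ?case by (simp add: N.vf_rep_coord M.vf_rep_coord Dv_prj)
qed

text \<open>Written as the metric adjoint of the differential, so that smoothness comes from
  \<open>smooth_at_sharp\<close>; that it is the horizontal lift follows from
  \<open>riem_sub_differential\<close>.\<close>

definition hor :: "'b \<Rightarrow> 'e \<Rightarrow> 'f" where
  "hor q a = sharp (h q) (\<lambda>w. g (\<pi> q) a (d\<pi> q w))"

lemma hor: "d\<pi> q (hor q a) = a" "h q (hor q a) w = g (\<pi> q) a (d\<pi> q w)"
proof -
  obtain u where u: "d\<pi> q u = a" "\<And>w. h q u w = g (\<pi> q) a (d\<pi> q w)"
    using riem_sub_differential unfolding riem_sub_def by blast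
  have "hor q a = u" unfolding hor_def by (rule sharp_eqI[OF N.inner_form_metric u(2)])
  with u show "d\<pi> q (hor q a) = a" "h q (hor q a) w = g (\<pi> q) a (d\<pi> q w)" by auto
qed

lemma linear_hor: "linear (hor q)"
proof -
  note B = inner_form_bilinear[OF N.inner_form_metric, of q]
    and B' = inner_form_bilinear[OF M.inner_form_metric, of "\<pi> q"]
  show ?thesis
    by (rule linearI; rule inner_form_eqI[OF N.inner_form_metric[of q]])
      (simp_all add: hor bilinear_ladd[OF B] bilinear_lmul[OF B] bilinear_ladd[OF B'] bilinear_lmul[OF B'])
qed

text \<open>\<open>A\<close> is a field along \<open>\<pi>\<close>, not a field on \<open>M\<close>.
  This covers both the lift of a field of \<open>M\<close> and the horizontal part of a field on
  \<open>N\<close> that does not project.\<close>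

lemma smooth_vf_at_hor:
  assumes c: "c \<in> atlas N" "q \<in> cdom c" and d: "d \<in> atlas M" "\<pi> q \<in> cdom d"
    and A: "\<forall>\<^sub>F x in nhds (coord c q). to_chart M d (\<pi> (coord_inv c x)) (A (coord_inv c x)) = a x"
    and a: "smooth_at (coord c q) a"
  shows "N.smooth_vf_at q (\<lambda>r. hor r (A r))"
proof (rule N.smooth_vf_atI[OF c])
  let ?f = "prj \<pi> c d"
  let ?G = "\<lambda>x. metric_rep M g d (?f x)"
  have G: "bilin_at (coord c q) ?G"
    by (rule bilin_at_pullback[OF smooth_at_prj[OF c d]]) (use M.bilin_at_rep[OF d] c in simp)
  have f: "smooth_at (coord c q) ?f" by (rule smooth_at_prj[OF c d])
  have lin: "\<forall>\<^sub>F x in nhds (coord c q). linear (\<lambda>v. ?G x (a x) (Dv ?f x v))"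
    using smooth_at_eventually[OF f] bilin_at_linear(1)[OF G, of a]
  proof eventually_elim
    case (elim x)
    show ?case using linear_compose[OF smooth_at_linear_Dv[OF elim(1)] elim(2)] by (simp add: o_def)
  qed
  have "smooth_at (coord c q) (\<lambda>x. sharp (metric_rep N h c x) (\<lambda>v. ?G x (a x) (Dv ?f x v)))"
    by (rule smooth_at_sharp[OF N.metric_at_rep[OF c] lin])
      (rule smooth_at_bilin[OF G a smooth_at_Dv[OF f]])
  moreover have "\<forall>\<^sub>F x in nhds (coord c q). sharp (metric_rep N h c x) (\<lambda>v. ?G x (a x) (Dv ?f x v)) =
      vf_rep N c (\<lambda>r. hor r (A r)) x"
    using eventually_domains[OF c d] A
  proof eventually_elim
    case (elim x)
    then obtain r where r: "r \<in> cdom c" "x = coord c r" by blast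
    with elim c have r': "\<pi> r \<in> cdom d" "a x = to_chart M d (\<pi> r) (A r)" "?f x = coord d (\<pi> r)"
      by auto
    note cr = c(1) r(1) and dr = d(1) r'(1)
    show ?case
    proof (rule sharp_eqI)
      show "inner_form (metric_rep N h c x)" unfolding r(2) by (rule N.inner_form_metric_rep[OF cr])
      fix w
      define w' where "w' = from_chart N c r w"
      have w: "w = to_chart N c r w'" using cr by (simp add: w'_def)
      show "metric_rep N h c x (vf_rep N c (\<lambda>r. hor r (A r)) x) w = ?G x (a x) (Dv ?f x w)"
        unfolding r'(2,3) unfolding r(2) w Dv_prj[OF cr dr] N.vf_rep_coord[OF cr]
          N.metric_rep_to_chart[OF cr] M.metric_rep_to_chart[OF dr] by (rule hor(2))
    qed
  qed
  ultimately show "smooth_at (coord c q) (vf_rep N c (\<lambda>r. hor r (A r)))"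
    by (rule smooth_at_cong[rotated])
qed

definition hlift :: "('a \<Rightarrow> 'e) \<Rightarrow> 'b \<Rightarrow> 'f" where
  "hlift X q = hor q (X (\<pi> q))"

definition vert :: "'b \<Rightarrow> 'f \<Rightarrow> 'f" where
  "vert q u = u - hor q (d\<pi> q u)"

lemma differential_hlift: "d\<pi> q (hlift X q) = X (\<pi> q)"
  by (simp add: hlift_def hor)

lemma differential_vert: "d\<pi> q (vert q u) = 0"
  by (simp add: vert_def hor linear_diff[OF linear_differential])

lemma vert_eq_self: "d\<pi> q u = 0 \<Longrightarrow> vert q u = u"
  by (simp add: vert_def linear_0[OF linear_hor])

lemma hor_plus_vert: "u = hor q (d\<pi> q u) + vert q u"
  by (simp add: vert_def)

lemma linear_vert: "linear (vert q)"
  by (rule linearI) (simp_all add: vert_def linear_add[OF linear_hor] linear_scale[OF linear_hor]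
      linear_add[OF linear_differential] linear_scale[OF linear_differential] algebra_simps)

lemma smooth_vf_at_hlift:
  assumes "M.smooth_vf_at (\<pi> q) X"
  shows "N.smooth_vf_at q (hlift X)"
proof -
  let ?c = "chart_at N q" and ?d = "chart_at M (\<pi> q)"
  have c: "?c \<in> atlas N" "q \<in> cdom ?c" and d: "?d \<in> atlas M" "\<pi> q \<in> cdom ?d" by auto
  have 1: "\<forall>\<^sub>F x in nhds (coord ?c q). to_chart M ?d (\<pi> (coord_inv ?c x)) (X (\<pi> (coord_inv ?c x))) =
      vf_rep M ?d X (prj \<pi> ?c ?d x)"
    using eventually_domains[OF c d] by eventually_elim (use d in \<open>simp add: vf_rep_def\<close>)
  have 2: "smooth_at (coord ?c q) (\<lambda>x. vf_rep M ?d X (prj \<pi> ?c ?d x))"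
    by (rule smooth_at_compose[OF smooth_at_prj[OF c d]])
      (use assms c d in \<open>simp add: M.smooth_vf_at_def\<close>)
  have "N.smooth_vf_at q (\<lambda>r. hor r (X (\<pi> r)))" by (rule smooth_vf_at_hor[OF c d 1 2])
  then show ?thesis by (simp add: hlift_def[abs_def])
qed

lemma smooth_vf_at_vert:
  assumes V: "N.smooth_vf_at q V"
  shows "N.smooth_vf_at q (\<lambda>r. vert r (V r))"
proof -
  let ?c = "chart_at N q" and ?d = "chart_at M (\<pi> q)"
  have c: "?c \<in> atlas N" "q \<in> cdom ?c" and d: "?d \<in> atlas M" "\<pi> q \<in> cdom ?d" by auto
  have 1: "\<forall>\<^sub>F x in nhds (coord ?c q). to_chart M ?d (\<pi> (coord_inv ?c x))
      (d\<pi> (coord_inv ?c x) (V (coord_inv ?c x))) = Dv (prj \<pi> ?c ?d) x (vf_rep N ?c V x)"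
    using eventually_domains[OF c d]
    by eventually_elim (use c d in \<open>auto simp: N.vf_rep_coord Dv_prj\<close>)
  have 2: "smooth_at (coord ?c q) (\<lambda>x. Dv (prj \<pi> ?c ?d) x (vf_rep N ?c V x))"
    using V c by (intro smooth_at_Dv_family smooth_at_prj[OF c d]) (simp add: N.smooth_vf_at_def)
  have 3: "N.smooth_vf_at q (\<lambda>r. hor r (d\<pi> r (V r)))" by (rule smooth_vf_at_hor[OF c d 1 2])
  have "N.smooth_vf_at q (\<lambda>r. V r + (-1) *\<^sub>R hor r (d\<pi> r (V r)))"
    by (intro N.smooth_vf_at_add V N.smooth_vf_at_scale[OF N.smooth_fun_at_const] 3)
  then show ?thesis by (simp add: vert_def[abs_def])
qed

lemma smooth_fun_at_comp:
  assumes "M.smooth_fun_at (\<pi> q) f"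
  shows "N.smooth_fun_at q (\<lambda>r. f (\<pi> r))"
proof (rule N.smooth_fun_atI[OF N.chart_at_atlas N.chart_at_cdom])
  let ?c = "chart_at N q" and ?d = "chart_at M (\<pi> q)"
  have c: "?c \<in> atlas N" "q \<in> cdom ?c" and d: "?d \<in> atlas M" "\<pi> q \<in> cdom ?d" by auto
  have "\<forall>\<^sub>F x in nhds (coord ?c q). f (coord_inv ?d (prj \<pi> ?c ?d x)) = f (\<pi> (coord_inv ?c x))"
    using eventually_domains[OF c d] by eventually_elim (use d in simp)
  moreover have "smooth_at (coord ?c q) (\<lambda>x. f (coord_inv ?d (prj \<pi> ?c ?d x)))"
    by (rule smooth_at_compose[OF smooth_at_prj[OF c d]])
      (use assms c d in \<open>simp add: M.smooth_fun_at_def\<close>)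
  ultimately show "smooth_at (coord ?c q) (\<lambda>x. f (\<pi> (coord_inv ?c x)))" by (rule smooth_at_cong)
qed

lemma related_lie_bracket:
  assumes V: "N.smooth_vf_at q V" "M.smooth_vf_at (\<pi> q) X" "\<And>r. d\<pi> r (V r) = X (\<pi> r)"
    and W: "N.smooth_vf_at q W" "M.smooth_vf_at (\<pi> q) Y" "\<And>r. d\<pi> r (W r) = Y (\<pi> r)"
  shows "d\<pi> q (lie_bracket N V W q) = lie_bracket M X Y (\<pi> q)"
proof -
  let ?c = "chart_at N q" and ?d = "chart_at M (\<pi> q)"
  have c: "?c \<in> atlas N" "q \<in> cdom ?c" and d: "?d \<in> atlas M" "\<pi> q \<in> cdom ?d" by auto
  have p: "prj \<pi> ?c ?d (coord ?c q) = coord ?d (\<pi> q)" by simp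
  have "Dv (prj \<pi> ?c ?d) (coord ?c q) (lb (vf_rep N ?c V) (vf_rep N ?c W) (coord ?c q)) =
      lb (vf_rep M ?d X) (vf_rep M ?d Y) (prj \<pi> ?c ?d (coord ?c q))"
    by (rule lb_related[OF smooth_at_prj[OF c d] _ _ _ _ related_prj[OF c d] related_prj[OF c d]])
      (use V W in \<open>simp_all add: N.smooth_vf_at_def M.smooth_vf_at_def\<close>)
  then show ?thesis
    by (simp add: N.lie_bracket_lb M.lie_bracket_lb differential_def o_def)
qed

end

section \<open>The pullback foliation\<close>

context smooth_mfd
begin

lemma singular_foliationD:
  assumes "singular_foliation M F"
  shows "X \<in> F \<Longrightarrow> smooth_vf_at p X" and "X \<in> F \<Longrightarrow> compact (supp X)"
    and "(\<lambda>p. 0) \<in> F" and "X \<in> F \<Longrightarrow> Y \<in> F \<Longrightarrow> (\<lambda>p. X p + Y p) \<in> F"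
    and "smooth_fun M f \<Longrightarrow> X \<in> F \<Longrightarrow> (\<lambda>p. f p *\<^sub>R X p) \<in> F"
    and "X \<in> F \<Longrightarrow> Y \<in> F \<Longrightarrow> lie_bracket M X Y \<in> F"
    and "\<exists>U G. open U \<and> q \<in> U \<and> finite G \<and> (\<forall>X\<in>G. \<forall>p\<in>U. smooth_vf_at p X) \<and>
        {X\<in>F. supp X \<subseteq> U} = fun_span (Cc_smooth M U) G"
proof -
  note * = assms[unfolded singular_foliation_def]
  show "smooth_vf_at p X" "compact (supp X)" if "X \<in> F"
    using * that smooth_vf_on_iff[of UNIV X] by (auto simp: compact_vfs_def)
  show "(\<lambda>p. 0) \<in> F" "X \<in> F \<Longrightarrow> Y \<in> F \<Longrightarrow> (\<lambda>p. X p + Y p) \<in> F"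
    "smooth_fun M f \<Longrightarrow> X \<in> F \<Longrightarrow> (\<lambda>p. f p *\<^sub>R X p) \<in> F"
    "X \<in> F \<Longrightarrow> Y \<in> F \<Longrightarrow> lie_bracket M X Y \<in> F"
    using * by blast+
  obtain U G where "open U" "q \<in> U" "finite G" "\<forall>X\<in>G. smooth_vf_on M U X"
    "{X\<in>F. supp X \<subseteq> U} = fun_span (Cc_smooth M U) G" using * by meson
  then show "\<exists>U G. open U \<and> q \<in> U \<and> finite G \<and> (\<forall>X\<in>G. \<forall>p\<in>U. smooth_vf_at p X) \<and>
        {X\<in>F. supp X \<subseteq> U} = fun_span (Cc_smooth M U) G"
    by (intro exI[of _ U] exI[of _ G]) (simp add: smooth_vf_on_iff)
qed

end

locale foliated_riem_subm = riem_subm N h M g \<pi>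
  for N :: "('b::{t2_space,second_countable_topology}, 'f::finite_dimensional_inner) manifold"
    and h :: "'b \<Rightarrow> 'f \<Rightarrow> 'f \<Rightarrow> real"
    and M :: "('a::{t2_space,second_countable_topology}, 'e::finite_dimensional_inner) manifold"
    and g :: "'a \<Rightarrow> 'e \<Rightarrow> 'e \<Rightarrow> real"
    and \<pi> :: "'b \<Rightarrow> 'a" +
  fixes F :: "('a \<Rightarrow> 'e) set"
  assumes foliation: "singular_foliation M F"
begin

text \<open>The generators of \<open>PF\<close>. They include all smooth vertical fields, which
  project to the zero field, and their supports need not be compact.\<close>

definition projectable :: "('b \<Rightarrow> 'f) set" where
  "projectable =
     {V. smooth_vf_on N UNIV V \<and> (\<exists>X\<in>F. \<forall>q. d\<pi> q (V q) = X (\<pi> q))}"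

abbreviation PF :: "('b \<Rightarrow> 'f) set" where
  "PF \<equiv> pullback_foliation N M \<pi> F"

lemma PF_eq: "PF = fun_span (Cc_smooth N UNIV) projectable"
  by (simp add: pullback_foliation_def projectable_def)

lemmas F = M.singular_foliationD[OF foliation]

lemma projectableD:
  assumes "V \<in> projectable"
  shows "N.smooth_vf_at q V" "\<exists>X\<in>F. \<forall>q. d\<pi> q (V q) = X (\<pi> q)"
  using assms N.smooth_vf_on_iff[of UNIV V] by (auto simp: projectable_def)

lemma projectableI:
  assumes "\<And>q. N.smooth_vf_at q V" "X \<in> F" "\<And>q. d\<pi> q (V q) = X (\<pi> q)"
  shows "V \<in> projectable"
  using assms N.smooth_vf_on_iff[of UNIV V] by (auto simp: projectable_def)

lemma hlift_projectable: "X \<in> F \<Longrightarrow> hlift X \<in> projectable"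
  by (rule projectableI[of _ X]) (auto intro: smooth_vf_at_hlift F(1) simp: differential_hlift)

lemma vert_projectable: "(\<And>q. N.smooth_vf_at q V) \<Longrightarrow> (\<lambda>q. vert q (V q)) \<in> projectable"
  by (rule projectableI[OF _ F(3)]) (auto intro: smooth_vf_at_vert simp: differential_vert)

lemma PF_single: "f \<in> Cc_smooth N UNIV \<Longrightarrow> V \<in> projectable \<Longrightarrow> (\<lambda>q. f q *\<^sub>R V q) \<in> PF"
  unfolding PF_eq by (rule fun_span_single)

lemma PF_zero: "(\<lambda>q. 0) \<in> PF"
  unfolding PF_eq by (rule fun_span_zero)

lemma PF_add: "V \<in> PF \<Longrightarrow> W \<in> PF \<Longrightarrow> (\<lambda>q. V q + W q) \<in> PF"
  unfolding PF_eq by (rule fun_span_add)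

lemma PF_scale: "smooth_fun N f \<Longrightarrow> V \<in> PF \<Longrightarrow> (\<lambda>q. f q *\<^sub>R V q) \<in> PF"
  unfolding PF_eq by (rule fun_span_scale) (auto intro: N.Cc_smooth_mult)

lemma PF_minus:
  assumes "V \<in> PF" "W \<in> PF"
  shows "(\<lambda>q. V q - W q) \<in> PF"
proof -
  have "(\<lambda>q. (-1) *\<^sub>R W q) \<in> PF"
    by (rule PF_scale[OF _ assms(2)]) (simp add: N.smooth_fun_iff N.smooth_fun_at_const)
  from PF_add[OF assms(1) this] show ?thesis by simp
qed

lemma PF_smooth: "V \<in> PF \<Longrightarrow> N.smooth_vf_at q V"
  unfolding PF_eq
proof (induction rule: fun_span_induct)
  case zero
  show ?case by (rule N.smooth_vf_at_zero)
next
  case (step f X Y)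
  then show ?case
    by (intro N.smooth_vf_at_add N.smooth_vf_at_cutoff[OF step(1) projectableD(1)[OF step(2)]])
qed

lemma compact_supp_cutoff_add:
  fixes Y :: "'b \<Rightarrow> 'f"
  assumes "f \<in> Cc_smooth N U" "compact (supp Y)"
  shows "compact (supp (\<lambda>q. f q *\<^sub>R X q + Y q))" "supp (\<lambda>q. f q *\<^sub>R X q + Y q) \<subseteq> supp f \<union> supp Y"
  by (rule N.supp_compactI[of "supp f \<union> supp Y"]; use N.Cc_smoothD[OF assms(1)] assms(2) in
    \<open>auto simp: N.not_in_supp\<close>)+

lemma PF_compact: "V \<in> PF \<Longrightarrow> compact (supp V)"
  unfolding PF_eq
proof (induction rule: fun_span_induct)
  case zero
  show ?case by (simp add: supp_def)
next
  case (step f X Y)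
  then show ?case using compact_supp_cutoff_add(1) by blast
qed

lemma PF_subset_compact_vfs: "PF \<subseteq> compact_vfs N"
  using PF_smooth PF_compact N.smooth_vf_on_iff[of UNIV] by (auto simp: compact_vfs_def)

section \<open>Closure of the pullback under the bracket\<close>

lemma lie_bracket_projectable:
  assumes V: "V \<in> projectable" and W: "W \<in> projectable"
  shows "lie_bracket N V W \<in> projectable"
proof -
  obtain X Y where X: "X \<in> F" "\<And>q. d\<pi> q (V q) = X (\<pi> q)" and Y: "Y \<in> F" "\<And>q. d\<pi> q (W q) = Y (\<pi> q)"
    using projectableD(2)[OF V] projectableD(2)[OF W] by blast
  show ?thesis
    by (rule projectableI[OF N.smooth_vf_at_lie_bracket F(6)[OF X(1) Y(1)] related_lie_bracket])
      (auto intro: projectableD V W F(1) X Y)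
qed

text \<open>The Leibniz rule extracts functions from the first argument of the bracket only, so
  closure is shown in two rounds: first with a projectable second argument, then, by skew-symmetry,
  in general. The coefficient \<open>N.cdiff f q (V q)\<close> inherits compact support from
  \<open>f\<close>.\<close>

lemma lie_bracket_projectable_PF:
  assumes V: "V \<in> projectable" and W: "W \<in> PF"
  shows "(\<lambda>q. lie_bracket N W V q) \<in> PF"
  using W unfolding PF_eq
proof (induction rule: fun_span_induct)
  case zero
  have "(\<lambda>q. lie_bracket N (\<lambda>_. 0) V q) = (\<lambda>q. 0)"
    using N.lie_bracket_zero[OF projectableD(1)[OF V]] by blast
  then show ?case using fun_span_zero by metis
next
  case (step f X Y)
  note f = step(1) and X = step(2)
  have Y: "Y \<in> PF" using step(3) by (simp add: PF_eq)
  have sf: "smooth_fun N f" and sfq: "N.smooth_fun_at q f" for q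
    using N.Cc_smoothD(1)[OF f] by (auto simp: N.smooth_fun_iff)
  have eq: "lie_bracket N (\<lambda>q. f q *\<^sub>R X q + Y q) V q =
      f q *\<^sub>R lie_bracket N X V q - N.cdiff f q (V q) *\<^sub>R X q + lie_bracket N Y V q" for q
    using N.lie_bracket_add[OF N.smooth_vf_at_scale[OF sfq projectableD(1)[OF X]] PF_smooth[OF Y]
        projectableD(1)[OF V]]
      N.lie_bracket_scale[OF sfq projectableD(1)[OF X] projectableD(1)[OF V]] by simp
  have 1: "(\<lambda>q. f q *\<^sub>R lie_bracket N X V q) \<in> PF"
    by (rule PF_single[OF f lie_bracket_projectable[OF X V]])
  have "(\<lambda>q. N.cdiff f q (V q)) \<in> Cc_smooth N UNIV"
    by (rule N.Cc_smoothI[OF _ N.Cc_smoothD(2)[OF f]])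
      (auto simp: N.smooth_fun_iff N.cdiff_off_supp intro: N.smooth_fun_at_cdiff sfq projectableD(1) V)
  then have 2: "(\<lambda>q. N.cdiff f q (V q) *\<^sub>R X q) \<in> PF" by (rule PF_single[OF _ X])
  from PF_add[OF PF_minus[OF 1 2] step(4)[folded PF_eq]]
  show ?case unfolding eq PF_eq .
qed

lemma lie_bracket_PF:
  assumes V: "V \<in> PF" and W: "W \<in> PF"
  shows "(\<lambda>q. lie_bracket N V W q) \<in> PF"
  using V unfolding PF_eq
proof (induction rule: fun_span_induct)
  case zero
  have "(\<lambda>q. lie_bracket N (\<lambda>_. 0) W q) = (\<lambda>q. 0)"
    using N.lie_bracket_zero[OF PF_smooth[OF W]] by blast
  then show ?case using fun_span_zero by metis
next
  case (step f X Y)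
  note f = step(1) and X = step(2)
  have Y: "Y \<in> PF" using step(3) by (simp add: PF_eq)
  have sf: "smooth_fun N f" and sfq: "N.smooth_fun_at q f" for q
    using N.Cc_smoothD(1)[OF f] by (auto simp: N.smooth_fun_iff)
  have eq: "lie_bracket N (\<lambda>q. f q *\<^sub>R X q + Y q) W q =
      (- f q) *\<^sub>R lie_bracket N W X q - N.cdiff f q (W q) *\<^sub>R X q + lie_bracket N Y W q" for q
    using N.lie_bracket_add[OF N.smooth_vf_at_scale[OF sfq projectableD(1)[OF X]] PF_smooth[OF Y]
        PF_smooth[OF W]]
      N.lie_bracket_scale[OF sfq projectableD(1)[OF X] PF_smooth[OF W]]
      N.lie_bracket_skew[of X W q] by simp
  have "smooth_fun N (\<lambda>q. - f q)"
    using N.smooth_fun_at_diff[OF N.smooth_fun_at_const[of _ 0] sfq] by (simp add: N.smooth_fun_iff)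
  then have 1: "(\<lambda>q. (- f q) *\<^sub>R lie_bracket N W X q) \<in> PF"
    by (rule PF_scale[OF _ lie_bracket_projectable_PF[OF X W]])
  have "(\<lambda>q. N.cdiff f q (W q)) \<in> Cc_smooth N UNIV"
    by (rule N.Cc_smoothI[OF _ N.Cc_smoothD(2)[OF f]])
      (auto simp: N.smooth_fun_iff N.cdiff_off_supp intro: N.smooth_fun_at_cdiff sfq PF_smooth W)
  then have 2: "(\<lambda>q. N.cdiff f q (W q) *\<^sub>R X q) \<in> PF" by (rule PF_single[OF _ X])
  from PF_add[OF PF_minus[OF 1 2] step(4)[folded PF_eq]]
  show ?case unfolding eq PF_eq .
qed

text \<open>\<open>X\<close> is only a local generator and need not belong to \<open>F\<close>.
  Since \<open>\<pi>\<close> maps \<open>supp f\<close> onto a compact subset of \<open>U\<close>, a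
  bump function \<open>\<rho>\<close> that is 1 there puts \<open>\<rho> X\<close> into
  \<open>F\<close> and leaves the product with \<open>f\<close> unchanged.\<close>

lemma PF_hlift_cutoff:
  assumes f: "f \<in> Cc_smooth N (\<pi> -` U)" and "open U" "fun_span (Cc_smooth M U) G \<subseteq> F"
    and X: "X \<in> G"
  shows "(\<lambda>q. f q *\<^sub>R hlift X q) \<in> PF"
proof -
  have "compact (\<pi> ` supp f)"
    using N.Cc_smoothD(2)[OF f] continuous_on_subset[OF continuous_pi]
    by (intro compact_continuous_image) auto
  moreover have "\<pi> ` supp f \<subseteq> U" using N.Cc_smoothD(3)[OF f] by auto
  ultimately obtain \<rho> where \<rho>: "\<rho> \<in> Cc_smooth M U" "\<forall>p\<in>\<pi> ` supp f. \<rho> p = 1"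
    using M.ex_bump[OF assms(2)] by blast
  have "(\<lambda>p. \<rho> p *\<^sub>R X p) \<in> F" using fun_span_single[OF \<rho>(1) X] assms(3) by auto
  from PF_single[OF N.Cc_smooth_mono[OF f] hlift_projectable[OF this]]
  have "(\<lambda>q. f q *\<^sub>R hlift (\<lambda>p. \<rho> p *\<^sub>R X p) q) \<in> PF" by simp
  moreover have "f q *\<^sub>R hlift (\<lambda>p. \<rho> p *\<^sub>R X p) q = f q *\<^sub>R hlift X q" for q
    using \<rho>(2) N.not_in_supp[of q f]
    by (cases "q \<in> supp f") (auto simp: hlift_def linear_scale[OF linear_hor])
  ultimately show ?thesis by simp
qed

text \<open>The same device on \<open>N\<close>: \<open>\<phi>\<close> makes \<open>V\<close>
  globally smooth before it is projected, and is invisible behind the factor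
  \<open>f\<close>.\<close>

lemma PF_vert_cutoff:
  assumes f: "f \<in> Cc_smooth N U" and U: "open U" and V: "\<And>q. q \<in> U \<Longrightarrow> N.smooth_vf_at q V"
  shows "(\<lambda>q. f q *\<^sub>R vert q (V q)) \<in> PF"
proof -
  obtain \<phi> where \<phi>: "\<phi> \<in> Cc_smooth N U" "\<forall>q\<in>supp f. \<phi> q = 1"
    using N.ex_bump[OF U N.Cc_smoothD(2,3)[OF f]] by blast
  have "(\<lambda>q. vert q (\<phi> q *\<^sub>R V q)) \<in> projectable"
    by (intro vert_projectable N.smooth_vf_at_cutoff[OF \<phi>(1)] V)
  from PF_single[OF N.Cc_smooth_mono[OF f] this]
  have "(\<lambda>q. f q *\<^sub>R vert q (\<phi> q *\<^sub>R V q)) \<in> PF" by simp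
  moreover have "f q *\<^sub>R vert q (\<phi> q *\<^sub>R V q) = f q *\<^sub>R vert q (V q)" for q
    using \<phi>(2) N.not_in_supp[of q f] by (cases "q \<in> supp f") auto
  ultimately show ?thesis by simp
qed

text \<open>Lifting is linear over functions pulled back along \<open>\<pi>\<close>. The factor
  \<open>f\<close> supplies the compact support that the pulled back coefficients may lack.\<close>

lemma fun_span_hlift:
  assumes Z: "Z \<in> fun_span (Cc_smooth M U') G" and f: "f \<in> Cc_smooth N U"
    and GG: "hlift ` G \<subseteq> GG"
  shows "(\<lambda>q. f q *\<^sub>R hlift Z q) \<in> fun_span (Cc_smooth N U) GG"
  using Z
proof (induction rule: fun_span_induct)
  case zero
  then show ?case using fun_span_zero by (simp add: hlift_def linear_0[OF linear_hor])
next
  case (step a X Y)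
  have "smooth_fun N (\<lambda>q. a (\<pi> q))"
    using M.Cc_smoothD(1)[OF step(1)]
    by (simp add: N.smooth_fun_iff M.smooth_fun_iff smooth_fun_at_comp)
  then have "(\<lambda>q. f q * a (\<pi> q)) \<in> Cc_smooth N U" by (rule N.Cc_smooth_mult[OF f])
  moreover have "hlift X \<in> GG" using GG step(2) by blast
  ultimately have "(\<lambda>q. (f q * a (\<pi> q)) *\<^sub>R hlift X q + f q *\<^sub>R hlift Y q) \<in> fun_span (Cc_smooth N U) GG"
    using step(4) by (rule fun_span_Cons)
  then show ?case
    by (simp add: hlift_def linear_add[OF linear_hor] linear_scale[OF linear_hor] scaleR_add_right)
qed

text \<open>What remains is local finite generation. Over a set \<open>U'\<close> with finitely many
  generators of \<open>F\<close>, and inside a chart of \<open>N\<close>, the lifts of these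
  generators account for the horizontal part of a projectable field and finitely many vertical
  fields for the rest.\<close>

lemma singular_foliation_PF: "singular_foliation N PF"
proof -
  have local: "\<exists>U GG. open U \<and> q0 \<in> U \<and> finite GG \<and> (\<forall>X\<in>GG. smooth_vf_on N U X) \<and>
        {X\<in>PF. supp X \<subseteq> U} = fun_span (Cc_smooth N U) GG" for q0
  proof -
    obtain U' G where U': "open U'" "\<pi> q0 \<in> U'" and G: "finite G"
      "\<forall>X\<in>G. \<forall>p\<in>U'. M.smooth_vf_at p X" "{X\<in>F. supp X \<subseteq> U'} = fun_span (Cc_smooth M U') G"
      using F(7)[of "\<pi> q0"] by blast
    define c where "c = chart_at N q0"
    have c: "c \<in> atlas N" "q0 \<in> cdom c" by (auto simp: c_def)
    define U where "U = \<pi> -` U' \<inter> cdom c"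
    have U: "open U" "q0 \<in> U" "U \<subseteq> cdom c" "U \<subseteq> \<pi> -` U'"
      using open_vimage_pi[OF U'(1)] N.open_cdom[OF c(1)] U'(2) c(2) by (auto simp: U_def)
    \<comment> \<open>The vertical parts of the coordinate fields: they span the vertical space at
      each point of \<open>U\<close> but may be dependent.\<close>
    define E where "E b = (\<lambda>q. vert q (from_chart N c q b))" for b
    define GG where "GG = hlift ` G \<union> E ` onb"
    have sE: "N.smooth_vf_at q (E b)" if "q \<in> U" for q b
      unfolding E_def using that U(3) c(1) by (intro smooth_vf_at_vert N.smooth_vf_at_from_chart) auto
    have sG: "N.smooth_vf_at q X" if "X \<in> GG" "q \<in> U" for q X
    proof (cases "X \<in> hlift ` G")
      case True
      then obtain Z where "Z \<in> G" "X = hlift Z" by blast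
      moreover have "\<pi> q \<in> U'" using that(2) U(4) by blast
      ultimately show ?thesis using G(2) smooth_vf_at_hlift[of q Z] by simp
    next
      case False
      then show ?thesis using that sE by (auto simp: GG_def)
    qed
    have GF: "fun_span (Cc_smooth M U') G \<subseteq> F" using G(3) by blast
    have 1: "Y \<in> PF \<and> supp Y \<subseteq> U" if "Y \<in> fun_span (Cc_smooth N U) GG" for Y
      using that
    proof (induction rule: fun_span_induct)
      case zero
      show ?case using PF_zero by (simp add: supp_def)
    next
      case (step f X Y)
      have "(\<lambda>q. f q *\<^sub>R X q) \<in> PF"
      proof (cases "X \<in> hlift ` G")
        case True
        then obtain Z where "Z \<in> G" "X = hlift Z" by blast
        then show ?thesis
          using PF_hlift_cutoff[OF N.Cc_smooth_mono[OF step(1) U(4)] U'(1) GF] by simp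
      next
        case False
        then obtain b where "X = E b" using step(2) by (auto simp: GG_def)
        then show ?thesis
          unfolding E_def using U(3) c(1)
          by (simp, intro PF_vert_cutoff[OF step(1) U(1)] N.smooth_vf_at_from_chart) auto
      qed
      then have "(\<lambda>q. f q *\<^sub>R X q + Y q) \<in> PF" using PF_add step(4) by blast
      moreover have "compact (supp Y)" using step(4) PF_compact by blast
      ultimately show ?case
        using compact_supp_cutoff_add(2)[OF step(1), of Y X] N.Cc_smoothD(3)[OF step(1)] step(4) by blast
    qed
    have V: "(\<lambda>q. f q *\<^sub>R V q) \<in> fun_span (Cc_smooth N U) GG"
      if f: "f \<in> Cc_smooth N U" and V: "V \<in> projectable" for f V
    proof -
      obtain X where X: "X \<in> F" "\<And>q. d\<pi> q (V q) = X (\<pi> q)" using projectableD(2)[OF V] by blast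
      have "compact (\<pi> ` supp f)"
        using N.Cc_smoothD(2)[OF f] continuous_on_subset[OF continuous_pi]
        by (intro compact_continuous_image) auto
      moreover have "\<pi> ` supp f \<subseteq> U'" using N.Cc_smoothD(3)[OF f] U(4) by auto
      ultimately obtain \<rho> where \<rho>: "\<rho> \<in> Cc_smooth M U'" "\<forall>p\<in>\<pi> ` supp f. \<rho> p = 1"
        using M.ex_bump[OF U'(1)] by blast
      \<comment> \<open>\<open>X\<close> belongs to \<open>F\<close> but may leave
        \<open>U'\<close>; the cutoff brings it into the part of \<open>F\<close> that
        \<open>G\<close> generates.\<close>
      have "(\<lambda>p. \<rho> p *\<^sub>R X p) \<in> F" by (rule F(5)[OF M.Cc_smoothD(1)[OF \<rho>(1)] X(1)])
      moreover have "supp (\<lambda>p. \<rho> p *\<^sub>R X p) \<subseteq> U'"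
        using M.supp_compactI(2)[OF M.Cc_smoothD(2)[OF \<rho>(1)], of "\<lambda>p. \<rho> p *\<^sub>R X p"]
          M.Cc_smoothD(3)[OF \<rho>(1)] M.not_in_supp[of _ \<rho>] by auto
      ultimately have "(\<lambda>p. \<rho> p *\<^sub>R X p) \<in> fun_span (Cc_smooth M U') G" using G(3) by blast
      from fun_span_hlift[OF this f, of GG]
      have h: "(\<lambda>q. f q *\<^sub>R hlift (\<lambda>p. \<rho> p *\<^sub>R X p) q) \<in> fun_span (Cc_smooth N U) GG"
        by (simp add: GG_def)
      \<comment> \<open>The coefficients are the chart components of \<open>V\<close> itself: the
        expansion takes place before the projection to the vertical space.\<close>
      have v: "(\<lambda>q. \<Sum>b\<in>onb. (f q * (to_chart N c q (V q) \<bullet> b)) *\<^sub>R E b q) \<in> fun_span (Cc_smooth N U) GG"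
      proof (intro fun_span_sum fun_span_single)
        fix b :: 'f assume "b \<in> onb"
        show "(\<lambda>q. f q * (to_chart N c q (V q) \<bullet> b)) \<in> Cc_smooth N U"
          using U(3) c(1)
          by (intro N.Cc_smooth_cutoff[OF f] N.smooth_fun_at_component projectableD(1) V) auto
        show "E b \<in> GG" using \<open>b \<in> onb\<close> by (simp add: GG_def)
      qed simp
      have "f q *\<^sub>R hlift (\<lambda>p. \<rho> p *\<^sub>R X p) q
          + (\<Sum>b\<in>onb. (f q * (to_chart N c q (V q) \<bullet> b)) *\<^sub>R E b q) = f q *\<^sub>R V q" for q
      proof (cases "q \<in> supp f")
        case True
        then have q: "q \<in> cdom c" and \<rho>1: "\<rho> (\<pi> q) = 1"
          using N.Cc_smoothD(3)[OF f] U(3) \<rho>(2) by auto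
        note lin = linear_compose[OF N.linear_from_chart[OF c(1) q] linear_vert[of q]]
        have "vert q (V q) = (vert q \<circ> from_chart N c q) (to_chart N c q (V q))"
          using c(1) q by simp
        also have "\<dots> = (\<Sum>b\<in>onb. (to_chart N c q (V q) \<bullet> b) *\<^sub>R (vert q \<circ> from_chart N c q) b)"
          by (rule linear_onb_expand[OF lin])
        finally have v: "vert q (V q) = (\<Sum>b\<in>onb. (to_chart N c q (V q) \<bullet> b) *\<^sub>R E b q)"
          by (simp add: E_def)
        have "V q = hlift (\<lambda>p. \<rho> p *\<^sub>R X p) q + vert q (V q)"
          using hor_plus_vert[of "V q" q] X(2)[of q] \<rho>1 by (simp add: hlift_def)
        then have "f q *\<^sub>R V q = f q *\<^sub>R (hlift (\<lambda>p. \<rho> p *\<^sub>R X p) q + vert q (V q))" by simp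
        then show ?thesis unfolding v by (simp add: scaleR_add_right scaleR_sum_right)
      qed (simp add: N.not_in_supp)
      then show ?thesis using fun_span_add[OF h v] by simp
    qed
    have 2: "(\<lambda>q. \<psi> q *\<^sub>R Y q) \<in> fun_span (Cc_smooth N U) GG"
      if Y: "Y \<in> PF" and \<psi>: "\<psi> \<in> Cc_smooth N U" for Y \<psi>
      using Y unfolding PF_eq
    proof (induction rule: fun_span_induct)
      case zero
      then show ?case using fun_span_zero by simp
    next
      case (step f X Y)
      have "(\<lambda>q. \<psi> q * f q) \<in> Cc_smooth N U"
        by (rule N.Cc_smooth_mult[OF \<psi> N.Cc_smoothD(1)[OF step(1)]])
      from fun_span_add[OF V[OF this step(2)] step(4)] show ?case by (simp add: scaleR_add_right)
    qed
    \<comment> \<open>Members of \<open>PF\<close> have coefficients supported anywhere in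
      \<open>N\<close>. Multiplying by a function that is 1 on \<open>supp Y\<close> forces them
      into \<open>U\<close> without changing \<open>Y\<close>.\<close>
    have 3: "Y \<in> fun_span (Cc_smooth N U) GG" if Y: "Y \<in> PF" "supp Y \<subseteq> U" for Y
    proof -
      obtain \<psi> where \<psi>: "\<psi> \<in> Cc_smooth N U" "\<forall>q\<in>supp Y. \<psi> q = 1"
        using N.ex_bump[OF U(1) PF_compact[OF Y(1)] Y(2)] by blast
      have "\<psi> q *\<^sub>R Y q = Y q" for q
        using \<psi>(2) N.not_in_supp[of q Y] by (cases "q \<in> supp Y") auto
      then show ?thesis using 2[OF Y(1) \<psi>(1)] by simp
    qed
    have "finite GG" using G(1) by (simp add: GG_def)
    moreover have "\<forall>X\<in>GG. smooth_vf_on N U X" using sG by (simp add: N.smooth_vf_on_iff[OF U(1)])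
    moreover have "{X\<in>PF. supp X \<subseteq> U} = fun_span (Cc_smooth N U) GG" using 1 3 by blast
    ultimately show ?thesis using U(1,2) by (intro exI[of _ U] exI[of _ GG]) simp
  qed
  show ?thesis
    unfolding singular_foliation_def
    using PF_subset_compact_vfs PF_zero PF_add PF_scale lie_bracket_PF local
    by (intro conjI ballI allI impI) simp_all
qed

text \<open>The only fact on the leaves of the pullback that the geometric case uses; no flow on
  \<open>N\<close> is compared with one on \<open>M\<close>.\<close>

lemma leaf_tangent_PF: "u \<in> leaf_tangent PF q \<longleftrightarrow> d\<pi> q u \<in> leaf_tangent F (\<pi> q)"
proof
  assume "u \<in> leaf_tangent PF q"
  then obtain V where "V \<in> PF" "u = V q" by (auto simp: leaf_tangent_def)
  have "\<exists>X\<in>F. d\<pi> q (V q) = X (\<pi> q)"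
    using \<open>V \<in> PF\<close> unfolding PF_eq
  proof (induction rule: fun_span_induct)
    case zero
    then show ?case using F(3) by (intro bexI[of _ "\<lambda>_. 0"]) (auto simp: linear_0[OF linear_differential])
  next
    case (step f X Y)
    obtain Z where Z: "Z \<in> F" "\<And>q. d\<pi> q (X q) = Z (\<pi> q)" using projectableD(2)[OF step(2)] by blast
    obtain Z' where Z': "Z' \<in> F" "d\<pi> q (Y q) = Z' (\<pi> q)" using step(4) by blast
    \<comment> \<open>\<open>f\<close> lives on \<open>N\<close> and need not descend to
      \<open>M\<close>; at the single point \<open>q\<close> its value serves as a constant
      coefficient.\<close>
    have "(\<lambda>p. f q *\<^sub>R Z p + Z' p) \<in> F"
      by (intro F(4) F(5) Z Z') (simp add: M.smooth_fun_iff M.smooth_fun_at_const)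
    then show ?case
      by (rule bexI[rotated])
        (simp add: linear_add[OF linear_differential] linear_scale[OF linear_differential] Z Z')
  qed
  then show "d\<pi> q u \<in> leaf_tangent F (\<pi> q)" using \<open>u = V q\<close> by (auto simp: leaf_tangent_def)
next
  assume "d\<pi> q u \<in> leaf_tangent F (\<pi> q)"
  then obtain X where X: "X \<in> F" "d\<pi> q u = X (\<pi> q)" by (auto simp: leaf_tangent_def)
  let ?c = "chart_at N q"
  have c: "?c \<in> atlas N" "q \<in> cdom ?c" by auto
  obtain \<phi> where \<phi>: "\<phi> \<in> Cc_smooth N (cdom ?c)" "\<phi> q = 1"
    using N.ex_bump_at[OF N.open_cdom[OF c(1)] c(2)] by blast
  \<comment> \<open>A field in \<open>PF\<close> with value \<open>u\<close> at \<open>q\<close>: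
    the lift of \<open>X\<close> supplies the horizontal part, and the projected coordinate field
    with components \<open>u\<close> supplies the vertical part.\<close>
  have "(\<lambda>r. \<phi> r *\<^sub>R hlift X r + \<phi> r *\<^sub>R vert r (from_chart N ?c r u)) \<in> PF"
    by (intro PF_add PF_single[OF N.Cc_smooth_mono[OF \<phi>(1) subset_UNIV] hlift_projectable[OF X(1)]]
        PF_vert_cutoff[OF \<phi>(1) N.open_cdom[OF c(1)]] N.smooth_vf_at_from_chart[OF c(1)])
  moreover have "u = \<phi> q *\<^sub>R hlift X q + \<phi> q *\<^sub>R vert q (from_chart N ?c q u)"
    using hor_plus_vert[of u q] X \<phi>(2) by (simp add: hlift_def)
  ultimately show "u \<in> leaf_tangent PF q"
    unfolding leaf_tangent_def
    by (intro CollectI exI[of _ "\<lambda>r. \<phi> r *\<^sub>R hlift X r + \<phi> r *\<^sub>R vert r (from_chart N ?c r u)"] conjI)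
qed

end

section \<open>Module singular Riemannian foliations\<close>

context riem_mfd
begin

lemma lie_deriv_metric_ld:
  "lie_deriv_metric M X g p u v =
    ld (vf_rep M (chart_at M p) X) (metric_rep M g (chart_at M p)) (coord (chart_at M p) p) u v"
  by (simp add: lie_deriv_metric_def ld_def Let_def)

lemma lie_deriv_metric_zero: "lie_deriv_metric M (\<lambda>_. 0) g p u v = 0"
proof -
  let ?c = "chart_at M p"
  have c: "?c \<in> atlas M" "p \<in> cdom ?c" by auto
  have "lie_deriv_metric M (\<lambda>_. 0) g p u v = ld (\<lambda>_. 0) (metric_rep M g ?c) (coord ?c p) u v"
    unfolding lie_deriv_metric_ld by (rule ld_cong[OF vf_rep_zero[OF c]]) auto
  then show ?thesis using ld_zero[OF bilin_at_rep[OF c]] by simp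
qed

lemma lie_deriv_metric_add:
  assumes "smooth_vf_at p X" "smooth_vf_at p Y"
  shows "lie_deriv_metric M (\<lambda>q. X q + Y q) g p u v =
    lie_deriv_metric M X g p u v + lie_deriv_metric M Y g p u v"
proof -
  let ?c = "chart_at M p"
  have c: "?c \<in> atlas M" "p \<in> cdom ?c" by auto
  have "lie_deriv_metric M (\<lambda>q. X q + Y q) g p u v =
      ld (\<lambda>x. vf_rep M ?c X x + vf_rep M ?c Y x) (metric_rep M g ?c) (coord ?c p) u v"
    unfolding lie_deriv_metric_ld by (rule ld_cong[OF vf_rep_add[OF c]]) auto
  also have "\<dots> = ld (vf_rep M ?c X) (metric_rep M g ?c) (coord ?c p) u v +
      ld (vf_rep M ?c Y) (metric_rep M g ?c) (coord ?c p) u v"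
    using assms c by (intro ld_add bilin_at_rep[OF c]) (auto simp: smooth_vf_at_def)
  finally show ?thesis by (simp only: lie_deriv_metric_ld)
qed

lemma lie_deriv_metric_scale:
  assumes "smooth_fun_at p f" "smooth_vf_at p X"
  shows "lie_deriv_metric M (\<lambda>q. f q *\<^sub>R X q) g p u v =
    f p * lie_deriv_metric M X g p u v + cdiff f p u * g p (X p) v + cdiff f p v * g p (X p) u"
proof -
  let ?c = "chart_at M p"
  have c: "?c \<in> atlas M" "p \<in> cdom ?c" by auto
  have "lie_deriv_metric M (\<lambda>q. f q *\<^sub>R X q) g p u v =
      ld (\<lambda>x. f (coord_inv ?c x) *\<^sub>R vf_rep M ?c X x) (metric_rep M g ?c) (coord ?c p) u v"
    unfolding lie_deriv_metric_ld by (rule ld_cong[OF vf_rep_scale[OF c]]) auto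
  also have "\<dots> = f (coord_inv ?c (coord ?c p)) * ld (vf_rep M ?c X) (metric_rep M g ?c) (coord ?c p) u v
      + Dv (\<lambda>x. f (coord_inv ?c x)) (coord ?c p) u * metric_rep M g ?c (coord ?c p) (vf_rep M ?c X (coord ?c p)) v
      + Dv (\<lambda>x. f (coord_inv ?c x)) (coord ?c p) v * metric_rep M g ?c (coord ?c p) u (vf_rep M ?c X (coord ?c p))"
    using assms c
    by (intro ld_scale[where \<phi> = "\<lambda>x. f (coord_inv ?c x)"] bilin_at_rep[OF c])
      (auto simp: smooth_vf_at_def smooth_fun_at_def)
  finally show ?thesis
    using inner_form_sym[OF inner_form_metric, of p u]
    by (simp add: lie_deriv_metric_ld cdiff_def metric_rep_coord vf_rep_coord)
qed

lemma lie_deriv_metric_bilinear: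
  assumes "smooth_vf_at p X"
  shows "bilinear (lie_deriv_metric M X g p)"
proof -
  let ?c = "chart_at M p"
  have c: "?c \<in> atlas M" "p \<in> cdom ?c" by auto
  have "bilinear (ld (vf_rep M ?c X) (metric_rep M g ?c) (coord ?c p))"
    using assms c by (intro bilinear_ld bilin_at_rep) (auto simp: smooth_vf_at_def)
  then show ?thesis by (simp add: lie_deriv_metric_ld[abs_def])
qed

lemma lie_deriv_metric_sym: "lie_deriv_metric M X g p u v = lie_deriv_metric M X g p v u"
  unfolding lie_deriv_metric_ld
  by (rule ld_sym) (use metric_at_rep[OF chart_at_atlas chart_at_cdom] in \<open>simp add: metric_at_def\<close>)

lemma smooth_at_lie_deriv_metric:
  assumes c: "c \<in> atlas M" "p \<in> cdom c" and X: "\<And>q. smooth_vf_at q X"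
  shows "smooth_at (coord c p) (\<lambda>x. lie_deriv_metric M X g (coord_inv c x)
    (from_chart M c (coord_inv c x) u) (from_chart M c (coord_inv c x) v))"
proof -
  have "\<forall>\<^sub>F x in nhds (coord c p). ld (vf_rep M c X) (metric_rep M g c) x u v =
    lie_deriv_metric M X g (coord_inv c x)
    (from_chart M c (coord_inv c x) u) (from_chart M c (coord_inv c x) v)"
    using eventually_coord_domains[OF c c]
  proof eventually_elim
    case (elim x)
    then obtain q where q: "q \<in> cdom c" "x = coord c q" by blast
    show ?case
      using lie_deriv_metric_chart[OF c(1) q(1) X bilin_at_rep[OF c(1) q(1)]] c q by simp
  qed
  moreover have "smooth_at (coord c p) (\<lambda>x. ld (vf_rep M c X) (metric_rep M g c) x u v)"
    using X c by (intro smooth_at_ld bilin_at_rep) (auto simp: smooth_vf_at_def)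
  ultimately show ?thesis by (rule smooth_at_cong)
qed

lemma smooth_vf_at_sharp:
  assumes \<omega>: "smooth_form_at p \<omega>" and lin: "\<And>q. linear (\<omega> q)"
  shows "smooth_vf_at p (\<lambda>q. sharp (g q) (\<omega> q))"
proof -
  let ?c = "chart_at M p"
  have c: "?c \<in> atlas M" "p \<in> cdom ?c" by auto
  let ?w = "\<lambda>x u. \<omega> (coord_inv ?c x) (from_chart M ?c (coord_inv ?c x) u)"
  have "smooth_at (coord ?c p) (\<lambda>x. sharp (metric_rep M g ?c x) (?w x))"
    by (rule smooth_at_sharp[OF metric_at_rep[OF c] linear_form_rep[OF c lin]])
      (use \<omega> in \<open>simp add: smooth_form_at_def\<close>)
  moreover have "\<forall>\<^sub>F x in nhds (coord ?c p). sharp (metric_rep M g ?c x) (?w x) =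
      vf_rep M ?c (\<lambda>q. sharp (g q) (\<omega> q)) x"
    using eventually_coord_domains[OF c c]
  proof eventually_elim
    case (elim x)
    then obtain q where q: "q \<in> cdom ?c" "x = coord ?c q" by blast
    note cq = c(1) q(1)
    show ?case
    proof (rule sharp_eqI)
      show "inner_form (metric_rep M g ?c x)" unfolding q(2) by (rule inner_form_metric_rep[OF cq])
      fix w
      show "metric_rep M g ?c x (vf_rep M ?c (\<lambda>q. sharp (g q) (\<omega> q)) x) w = ?w x w"
        unfolding q(2) vf_rep_coord[OF cq] metric_rep_coord[OF cq]
        using cq sharp_works[OF inner_form_metric lin] by simp
    qed
  qed
  ultimately show ?thesis
    by (intro smooth_vf_atI[OF c]) (rule smooth_at_cong[rotated])
qed

end

context riem_subm
begin

text \<open>\<open>ld_horizontal\<close> in the preferred charts. It is used for fields over a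
  member of \<open>F\<close>, for vertical fields over the zero field, and for lifts of arbitrary
  smooth germs of fields.\<close>

lemma lie_deriv_metric_hor:
  assumes V: "N.smooth_vf_at q V" and X: "M.smooth_vf_at (\<pi> q) X"
    and rel: "\<forall>\<^sub>F r in nhds q. d\<pi> r (V r) = X (\<pi> r)"
  shows "lie_deriv_metric N V h q (hor q a) (hor q b) = lie_deriv_metric M X g (\<pi> q) a b"
proof -
  let ?c = "chart_at N q" and ?d = "chart_at M (\<pi> q)"
  have c: "?c \<in> atlas N" "q \<in> cdom ?c" and d: "?d \<in> atlas M" "\<pi> q \<in> cdom ?d" by auto
  have p: "prj \<pi> ?c ?d (coord ?c q) = coord ?d (\<pi> q)" by simp
  have D: "Dv (prj \<pi> ?c ?d) (coord ?c q) u = d\<pi> q u" for u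
    by (simp add: differential_def o_def)
  have hc: "metric_rep N h ?c (coord ?c q) u v = h q u v" for u v
    by (simp add: N.metric_rep_coord)
  have gd: "metric_rep M g ?d (coord ?d (\<pi> q)) u v = g (\<pi> q) u v" for u v
    by (simp add: M.metric_rep_coord)
  have "ld (vf_rep N ?c V) (metric_rep N h ?c) (coord ?c q) (hor q a) (hor q b) =
    ld (vf_rep M ?d X) (metric_rep M g ?d) (prj \<pi> ?c ?d (coord ?c q))
      (Dv (prj \<pi> ?c ?d) (coord ?c q) (hor q a)) (Dv (prj \<pi> ?c ?d) (coord ?c q) (hor q b))"
  proof (rule ld_horizontal[OF N.metric_at_rep[OF c] _ smooth_at_prj[OF c d]
        riem_sub_prj_eventually[OF c d] _ _ related_prj[OF c d rel]])
    show "metric_at (prj \<pi> ?c ?d (coord ?c q)) (metric_rep M g ?d)"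
      unfolding p by (rule M.metric_at_rep[OF d])
    show "smooth_at (coord ?c q) (vf_rep N ?c V)" using V c by (simp add: N.smooth_vf_at_def)
    show "smooth_at (prj \<pi> ?c ?d (coord ?c q)) (vf_rep M ?d X)"
      unfolding p using X d by (simp add: M.smooth_vf_at_def)
  qed (simp_all only: p hc gd D hor)
  then show ?thesis by (simp only: N.lie_deriv_metric_ld M.lie_deriv_metric_ld p D hor)
qed

lemma smooth_one_form_pullback:
  assumes "smooth_one_form M \<alpha>"
  shows "smooth_one_form N (\<lambda>q u. \<alpha> (\<pi> q) (d\<pi> q u))"
proof -
  have \<alpha>: "linear (\<alpha> p)" "M.smooth_form_at p \<alpha>" for p
    using assms by (auto simp: M.smooth_one_form_iff)
  have lin: "linear (\<lambda>u. \<alpha> (\<pi> q) (d\<pi> q u))" for q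
    using linear_compose[OF linear_differential \<alpha>(1)] by (simp add: o_def)
  have "N.smooth_form_at q (\<lambda>q u. \<alpha> (\<pi> q) (d\<pi> q u))" for q
  proof (rule N.smooth_form_atI[OF N.chart_at_atlas N.chart_at_cdom lin])
    fix u
    let ?c = "chart_at N q" and ?d = "chart_at M (\<pi> q)"
    have c: "?c \<in> atlas N" "q \<in> cdom ?c" and d: "?d \<in> atlas M" "\<pi> q \<in> cdom ?d" by auto
    let ?f = "prj \<pi> ?c ?d"
    let ?A = "\<lambda>y v. \<alpha> (coord_inv ?d y) (from_chart M ?d (coord_inv ?d y) v)"
    have f: "smooth_at (coord ?c q) ?f" by (rule smooth_at_prj[OF c d])
    have p: "?f (coord ?c q) = coord ?d (\<pi> q)" by simp
    have 1: "smooth_at (coord ?c q) (\<lambda>x. ?A (?f x) v)" for v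
      by (rule smooth_at_compose[OF f, where g = "\<lambda>y. ?A y v"])
        (use \<alpha>(2) d in \<open>simp add: M.smooth_form_at_def\<close>)
    have 2: "\<forall>\<^sub>F x in nhds (coord ?c q). linear (?A (?f x))"
      by (rule smooth_at_eventually_compose[OF f]) (use M.linear_form_rep[OF d \<alpha>(1)] in \<open>simp only: p\<close>)
    have "smooth_at (coord ?c q) (\<lambda>x. ?A (?f x) (Dv ?f x u))"
      by (rule smooth_at_linear_family[OF 2 1 smooth_at_Dv[OF f]])
    moreover have "\<forall>\<^sub>F x in nhds (coord ?c q). ?A (?f x) (Dv ?f x u) =
        \<alpha> (\<pi> (coord_inv ?c x)) (d\<pi> (coord_inv ?c x) (from_chart N ?c (coord_inv ?c x) u))"
      using eventually_domains[OF c d]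
    proof eventually_elim
      case (elim x)
      then obtain r where r: "r \<in> cdom ?c" "x = coord ?c r" by blast
      with elim c have r': "\<pi> r \<in> cdom ?d" by simp
      define u' where "u' = from_chart N ?c r u"
      have u: "u = to_chart N ?c r u'" using c(1) r(1) by (simp add: u'_def)
      have "Dv ?f (coord ?c r) u = to_chart M ?d (\<pi> r) (d\<pi> r u')"
        by (subst u) (rule Dv_prj[OF c(1) r(1) d(1) r'])
      then show ?case unfolding r(2) using r(1) r' by (simp add: u'_def)
    qed
    ultimately show "smooth_at (coord ?c q) (\<lambda>x. \<alpha> (\<pi> (coord_inv ?c x))
        (d\<pi> (coord_inv ?c x) (from_chart N ?c (coord_inv ?c x) u)))"
      by (rule smooth_at_cong[rotated])
  qed
  with lin show ?thesis by (simp add: N.smooth_one_form_iff)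
qed

end

context foliated_riem_subm
begin

text \<open>The module \<open>\<Omega>\<^sup>1(N) \<odot> h\<^sub>\<flat>(\<pi>\<^sup>-\<^sup>1F)\<close>.\<close>

definition sym_products :: "('b \<Rightarrow> 'f \<Rightarrow> 'f \<Rightarrow> real) set" where
  "sym_products = {\<tau>. \<exists>(k::nat) \<alpha> Y. (\<forall>i<k. smooth_one_form N (\<alpha> i) \<and> Y i \<in> PF) \<and>
     (\<forall>q u v. \<tau> q u v = (\<Sum>i<k. \<alpha> i q u * h q (Y i q) v + \<alpha> i q v * h q (Y i q) u))}"

lemma sym_products_zero: "(\<lambda>q u v. 0) \<in> sym_products"
  unfolding sym_products_def by (auto intro!: exI[of _ "0::nat"])

lemma sym_products_Cons:
  assumes "smooth_one_form N \<beta>" "Z \<in> PF" "\<tau> \<in> sym_products"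
  shows "(\<lambda>q u v. \<beta> q u * h q (Z q) v + \<beta> q v * h q (Z q) u + \<tau> q u v) \<in> sym_products"
proof -
  obtain k :: nat and \<alpha> Y where Y: "\<forall>i<k. smooth_one_form N (\<alpha> i) \<and> Y i \<in> PF"
    "\<And>q u v. \<tau> q u v = (\<Sum>i<k. \<alpha> i q u * h q (Y i q) v + \<alpha> i q v * h q (Y i q) u)"
    using assms(3) unfolding sym_products_def by blast
  let ?a = "\<lambda>i. case i of 0 \<Rightarrow> \<beta> | Suc j \<Rightarrow> \<alpha> j" and ?Y = "\<lambda>i. case i of 0 \<Rightarrow> Z | Suc j \<Rightarrow> Y j"
  have "\<beta> q u * h q (Z q) v + \<beta> q v * h q (Z q) u + \<tau> q u v =
      (\<Sum>i<Suc k. ?a i q u * h q (?Y i q) v + ?a i q v * h q (?Y i q) u)" for q u v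
    by (simp add: Y(2) sum.lessThan_Suc_shift del: sum.lessThan_Suc)
  moreover have "\<forall>i<Suc k. smooth_one_form N (?a i) \<and> ?Y i \<in> PF"
    using Y(1) assms(1,2) by (auto split: nat.split)
  ultimately show ?thesis
    unfolding sym_products_def
    by (intro CollectI exI[of _ "Suc k"] exI[of _ ?a] exI[of _ ?Y]) simp
qed

lemma sym_products_single:
  "smooth_one_form N \<beta> \<Longrightarrow> Z \<in> PF \<Longrightarrow> (\<lambda>q u v. \<beta> q u * h q (Z q) v + \<beta> q v * h q (Z q) u) \<in> sym_products"
  using sym_products_Cons[OF _ _ sym_products_zero, of \<beta> Z] by simp

lemma sym_products_add:
  assumes "\<tau> \<in> sym_products" "\<sigma> \<in> sym_products"
  shows "(\<lambda>q u v. \<tau> q u v + \<sigma> q u v) \<in> sym_products"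
proof -
  obtain k :: nat and \<alpha> Y where Y: "\<forall>i<k. smooth_one_form N (\<alpha> i) \<and> Y i \<in> PF"
    "\<And>q u v. \<tau> q u v = (\<Sum>i<k. \<alpha> i q u * h q (Y i q) v + \<alpha> i q v * h q (Y i q) u)"
    using assms(1) unfolding sym_products_def by blast
  have "j \<le> k \<Longrightarrow> (\<lambda>q u v. (\<Sum>i<j. \<alpha> i q u * h q (Y i q) v + \<alpha> i q v * h q (Y i q) u) + \<sigma> q u v)
      \<in> sym_products" for j
  proof (induction j)
    case 0
    then show ?case using assms(2) by simp
  next
    case (Suc j)
    then have "(\<lambda>q u v. \<alpha> j q u * h q (Y j q) v + \<alpha> j q v * h q (Y j q) u +
        ((\<Sum>i<j. \<alpha> i q u * h q (Y i q) v + \<alpha> i q v * h q (Y i q) u) + \<sigma> q u v)) \<in> sym_products"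
      using Y(1) by (intro sym_products_Cons) auto
    then show ?case by (simp add: add_ac)
  qed
  then show ?thesis unfolding Y(2) by blast
qed

lemma sym_products_sum:
  "finite I \<Longrightarrow> (\<And>i. i \<in> I \<Longrightarrow> \<tau> i \<in> sym_products) \<Longrightarrow> (\<lambda>q u v. \<Sum>i\<in>I. \<tau> i q u v) \<in> sym_products"
  by (induction I rule: finite_induct) (auto intro: sym_products_zero sym_products_add)

context
  fixes V :: "'b \<Rightarrow> 'f" and X :: "'a \<Rightarrow> 'e"
  assumes V: "\<And>q. N.smooth_vf_at q V" and X: "X \<in> F" and VX: "\<And>q. d\<pi> q (V q) = X (\<pi> q)"
begin

text \<open>The subtracted pullback is harmless: the module condition on \<open>M\<close> writes it
  with one-forms, which pull back, and fields of \<open>F\<close>, which lift. Only the defect has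
  to be treated by vertical fields.\<close>

definition defect :: "'b \<Rightarrow> 'f \<Rightarrow> 'f \<Rightarrow> real" where
  "defect q u v = lie_deriv_metric N V h q u v - lie_deriv_metric M X g (\<pi> q) (d\<pi> q u) (d\<pi> q v)"

text \<open>
  A form \<open>S\<close> with \<open>S(u, v) + S(v, u) = defect(u, v)\<close> which vanishes for horizontal \<open>u\<close>; the second
  term corrects for pairs of vertical vectors, which would be counted twice.
\<close>

definition half_defect :: "'b \<Rightarrow> 'f \<Rightarrow> 'f \<Rightarrow> real" where
  "half_defect q u v = defect q (vert q u) v - defect q (vert q u) (vert q v) / 2"

lemma bilinear_defect: "bilinear (defect q)"
proof -
  note B = N.lie_deriv_metric_bilinear[OF V, of q]
    and B' = bilinear_compose_linear[OF M.lie_deriv_metric_bilinear[OF F(1)[OF X]] linear_differential[of q]]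
  show ?thesis
    using B B' unfolding bilinear_def defect_def by (auto intro: linear_compose_sub)
qed

lemma defect_sym: "defect q u v = defect q v u"
  unfolding defect_def
  using N.lie_deriv_metric_sym[of V q u v] M.lie_deriv_metric_sym[of X "\<pi> q" "d\<pi> q u" "d\<pi> q v"] by simp

lemma defect_hor: "defect q (hor q a) (hor q b) = 0"
  using lie_deriv_metric_hor[OF V F(1)[OF X], of q a b] VX by (simp add: defect_def hor)

lemma defect_eq: "defect q u v = half_defect q u v + half_defect q v u"
proof -
  note B = bilinear_defect[of q]
  let ?P = "vert q" and ?H = "\<lambda>u. hor q (d\<pi> q u)"
  have "defect q u v = defect q (?H u + ?P u) (?H v + ?P v)" using hor_plus_vert by simp
  \<comment> \<open>Inclusion-exclusion over the four horizontal and vertical blocks: the purely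
    horizontal one vanishes, the purely vertical one occurs in both summands.\<close>
  also have "\<dots> = defect q (?P u) (?H v + ?P v) + defect q (?H u + ?P u) (?P v) - defect q (?P u) (?P v)"
    by (simp add: bilinear_ladd[OF B] bilinear_radd[OF B] defect_hor)
  also have "\<dots> = defect q (?P u) v + defect q u (?P v) - defect q (?P u) (?P v)"
    using hor_plus_vert by simp
  finally show ?thesis
    using defect_sym[of q u "?P v"] defect_sym[of q "?P u" "?P v"] by (simp add: half_defect_def)
qed

lemma half_defect_hor: "half_defect q (hor q a) v = 0"
  by (simp add: half_defect_def vert_def hor bilinear_lzero[OF bilinear_defect])

lemma bilinear_half_defect: "bilinear (half_defect q)"
  unfolding bilinear_def half_defect_def
  by (auto intro!: linearI simp: linear_add[OF linear_vert] linear_scale[OF linear_vert]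
      bilinear_ladd[OF bilinear_defect] bilinear_radd[OF bilinear_defect]
      bilinear_lmul[OF bilinear_defect] bilinear_rmul[OF bilinear_defect] field_simps)

text \<open>Stated for the family of forms in coordinates because \<open>half_defect\<close>
  evaluates it on vertical projections, which move with the point.\<close>

lemma bilin_at_defect:
  assumes c: "c \<in> atlas N" "q \<in> cdom c"
  shows "bilin_at (coord c q) (\<lambda>x u v. defect (coord_inv c x)
    (from_chart N c (coord_inv c x) u) (from_chart N c (coord_inv c x) v))"
proof -
  let ?d = "chart_at M (\<pi> q)"
  have d: "?d \<in> atlas M" "\<pi> q \<in> cdom ?d" by auto
  let ?f = "prj \<pi> c ?d"
  have f: "smooth_at (coord c q) ?f" by (rule smooth_at_prj[OF c d])
  have p: "?f (coord c q) = coord ?d (\<pi> q)" using c by simp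
  let ?L = "\<lambda>y. lie_deriv_metric M X g (coord_inv ?d y)"
  let ?L' = "\<lambda>y u v. ?L y (from_chart M ?d (coord_inv ?d y) u) (from_chart M ?d (coord_inv ?d y) v)"
  have "bilin_at (coord ?d (\<pi> q)) ?L'"
    unfolding bilin_at_def
  proof
    show "\<forall>\<^sub>F y in nhds (coord ?d (\<pi> q)). bilinear (?L' y)"
      using M.eventually_coord_domains[OF d d]
    proof eventually_elim
      case (elim y)
      then show ?case
        using bilinear_compose_linear[OF M.lie_deriv_metric_bilinear[OF F(1)[OF X]]
            M.linear_from_chart[OF d(1)]] by blast
    qed
  qed (use M.smooth_at_lie_deriv_metric[OF d F(1)[OF X]] in blast)
  then have 1: "bilin_at (coord c q) (\<lambda>x u v. ?L' (?f x) (Dv ?f x u) (Dv ?f x v))"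
    by (intro bilin_at_pullback_form[OF f]) (simp only: p)
  have 2: "\<forall>\<^sub>F x in nhds (coord c q). \<forall>u v. defect (coord_inv c x)
      (from_chart N c (coord_inv c x) u) (from_chart N c (coord_inv c x) v) =
      lie_deriv_metric N V h (coord_inv c x) (from_chart N c (coord_inv c x) u)
        (from_chart N c (coord_inv c x) v) - ?L' (?f x) (Dv ?f x u) (Dv ?f x v)"
    using eventually_domains[OF c d]
  proof eventually_elim
    case (elim x)
    then obtain r where r: "r \<in> cdom c" "x = coord c r" by blast
    with elim c have r': "\<pi> r \<in> cdom ?d" by simp
    have "from_chart M ?d (\<pi> r) (Dv ?f (coord c r) u) = d\<pi> r (from_chart N c r u)" for u
      using Dv_prj[OF c(1) r(1) d(1) r', of "from_chart N c r u"] c(1) r(1) r' by simp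
    then show ?case using r c(1) r' by (simp add: defect_def)
  qed
  show ?thesis
    unfolding bilin_at_def
  proof (intro conjI allI)
    show "\<forall>\<^sub>F x in nhds (coord c q). bilinear (\<lambda>u v. defect (coord_inv c x)
        (from_chart N c (coord_inv c x) u) (from_chart N c (coord_inv c x) v))"
      using N.eventually_coord_domains[OF c c]
    proof eventually_elim
      case (elim x)
      then show ?case
        using bilinear_compose_linear[OF bilinear_defect N.linear_from_chart[OF c(1)]] by blast
    qed
    fix u v
    have "smooth_at (coord c q) (\<lambda>x. lie_deriv_metric N V h (coord_inv c x) (from_chart N c (coord_inv c x) u)
        (from_chart N c (coord_inv c x) v) - ?L' (?f x) (Dv ?f x u) (Dv ?f x v))"
      using N.smooth_at_lie_deriv_metric[OF c V] 1 by (intro smooth_at_diff) (auto simp: bilin_at_def)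
    then show "smooth_at (coord c q) (\<lambda>x. defect (coord_inv c x)
        (from_chart N c (coord_inv c x) u) (from_chart N c (coord_inv c x) v))"
      by (rule smooth_at_cong[rotated]) (use 2 in \<open>eventually_elim, simp\<close>)
  qed
qed

text \<open>The metric dual of \<open>half_defect\<close> with a coordinate vector in its second
  slot. Since \<open>half_defect\<close> vanishes on horizontal vectors in the first slot, this dual
  is vertical and belongs to \<open>PF\<close> once it is cut off.\<close>

definition defect_field :: "('b, 'f) chart \<Rightarrow> 'f \<Rightarrow> 'b \<Rightarrow> 'f" where
  "defect_field c b q = sharp (h q) (\<lambda>u. half_defect q u (from_chart N c q b))"

lemma linear_half_defect: "linear (\<lambda>u. half_defect q u v)"
  using bilinear_half_defect by (simp add: bilinear_def)

lemma defect_field: "h q (defect_field c b q) u = half_defect q u (from_chart N c q b)"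
  unfolding defect_field_def by (rule sharp_works[OF N.inner_form_metric linear_half_defect])

lemma differential_defect_field: "d\<pi> q (defect_field c b q) = 0"
proof (rule inner_form_eqI[OF M.inner_form_metric[of "\<pi> q"]])
  fix a
  have "g (\<pi> q) a (d\<pi> q (defect_field c b q)) = h q (defect_field c b q) (hor q a)"
    using hor(2)[of q a "defect_field c b q"] inner_form_sym[OF N.inner_form_metric] by metis
  then show "g (\<pi> q) (d\<pi> q (defect_field c b q)) a = g (\<pi> q) 0 a"
    using inner_form_sym[OF M.inner_form_metric, of "\<pi> q" a]
    by (simp add: defect_field half_defect_hor bilinear_lzero[OF inner_form_bilinear[OF M.inner_form_metric]])
qed

lemma smooth_vf_at_defect_field:
  assumes c: "c \<in> atlas N" "q \<in> cdom c"
  shows "N.smooth_vf_at q (defect_field c b)"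
  unfolding defect_field_def[abs_def]
proof (rule N.smooth_vf_at_sharp[OF _ linear_half_defect], rule N.smooth_form_atI[OF c linear_half_defect])
  fix u
  let ?T = "\<lambda>x u v. defect (coord_inv c x) (from_chart N c (coord_inv c x) u) (from_chart N c (coord_inv c x) v)"
  let ?P = "\<lambda>w. vf_rep N c (\<lambda>r. vert r (from_chart N c r w))"
  have T: "bilin_at (coord c q) ?T" by (rule bilin_at_defect[OF c])
  have P: "smooth_at (coord c q) (?P w)" for w
    using smooth_vf_at_vert[OF N.smooth_vf_at_from_chart[OF c]] c by (simp add: N.smooth_vf_at_def)
  have "smooth_at (coord c q) (\<lambda>x. ?T x (?P u x) b - (1 / 2) * ?T x (?P u x) (?P b x))"
    by (intro smooth_at_diff smooth_at_mult smooth_at_const smooth_at_bilin[OF T P smooth_at_const]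
        smooth_at_bilin[OF T P P])
  moreover have "\<forall>\<^sub>F x in nhds (coord c q). ?T x (?P u x) b - (1 / 2) * ?T x (?P u x) (?P b x) =
      half_defect (coord_inv c x) (from_chart N c (coord_inv c x) u) (from_chart N c (coord_inv c x) b)"
    using N.eventually_coord_domains[OF c c]
    by eventually_elim (use c in \<open>auto simp: half_defect_def N.vf_rep_coord\<close>)
  ultimately show "smooth_at (coord c q) (\<lambda>x. half_defect (coord_inv c x)
      (from_chart N c (coord_inv c x) u) (from_chart N c (coord_inv c x) b))"
    by (rule smooth_at_cong[rotated])
qed

text \<open>Expansion in the coordinate one-forms of the chart: each term is a coordinate form
  applied to \<open>v\<close> times the metric dual of a vertical field applied to
  \<open>u\<close>.\<close>

lemma half_defect_expand:
  assumes c: "c \<in> atlas N" "q \<in> cdom c"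
  shows "half_defect q u v = (\<Sum>b\<in>onb. (to_chart N c q v \<bullet> b) * h q (defect_field c b q) u)"
proof -
  have "linear (half_defect q u)" using bilinear_half_defect by (simp add: bilinear_def)
  note lin = linear_compose[OF N.linear_from_chart[OF c] this]
  have "half_defect q u v = (half_defect q u \<circ> from_chart N c q) (to_chart N c q v)" using c by simp
  also have "\<dots> = (\<Sum>b\<in>onb. (to_chart N c q v \<bullet> b) *\<^sub>R (half_defect q u \<circ> from_chart N c q) b)"
    by (rule linear_onb_expand[OF lin])
  finally show ?thesis by (simp add: defect_field)
qed

text \<open>Both factors of each product must be global: \<open>f\<close> cuts off the vertical
  field and \<open>\<phi>\<close> the coordinate one-form. As \<open>\<phi>\<close> is 1 on
  \<open>supp f\<close>, the product of the two cutoffs is \<open>f\<close>.\<close>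

lemma defect_sym_products:
  assumes c: "c \<in> atlas N" and f: "f \<in> Cc_smooth N (cdom c)"
  shows "(\<lambda>q u v. f q * defect q u v) \<in> sym_products"
proof -
  obtain \<phi> where \<phi>: "\<phi> \<in> Cc_smooth N (cdom c)" "\<forall>q\<in>supp f. \<phi> q = 1"
    using N.ex_bump[OF N.open_cdom[OF c] N.Cc_smoothD(2,3)[OF f]] by blast
  \<comment> \<open>The value 0 outside the chart makes \<open>\<beta> b q\<close> linear at every
    point, which a one-form on \<open>N\<close> must be; \<open>to_chart\<close> guarantees nothing
    there.\<close>
  define \<beta> where "\<beta> b q v = (if q \<in> cdom c then to_chart N c q v \<bullet> b else 0)" for b q v
  have lin: "linear (\<beta> b q)" for b q
  proof (cases "q \<in> cdom c")
    case True
    then show ?thesis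
      using linear_compose[OF N.linear_to_chart[OF c True] bounded_linear.linear[OF bounded_linear_inner_left, of b]]
      by (simp add: \<beta>_def[abs_def] o_def)
  qed (simp add: \<beta>_def[abs_def] linear_zero)
  have form: "smooth_one_form N (\<lambda>q v. \<phi> q * \<beta> b q v)" for b
  proof (rule N.smooth_one_form_cutoff[OF \<phi>(1) _ lin])
    fix q assume q: "q \<in> cdom c"
    have "\<forall>\<^sub>F x in nhds (coord c q). u \<bullet> b = \<beta> b (coord_inv c x) (from_chart N c (coord_inv c x) u)" for u
      using N.eventually_coord_domains[OF c q c q]
      by eventually_elim (use c in \<open>auto simp: \<beta>_def\<close>)
    then show "N.smooth_form_at q (\<beta> b)"
      by (intro N.smooth_form_atI[OF c q lin]) (rule smooth_at_cong, auto)
  qed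
  have field: "(\<lambda>q. f q *\<^sub>R defect_field c b q) \<in> PF" for b
  proof -
    have "(\<lambda>q. f q *\<^sub>R vert q (defect_field c b q)) \<in> PF"
      by (rule PF_vert_cutoff[OF f N.open_cdom[OF c] smooth_vf_at_defect_field[OF c]])
    then show ?thesis by (simp add: vert_eq_self differential_defect_field)
  qed
  have "f q * defect q u v = (\<Sum>b\<in>onb. \<phi> q * \<beta> b q u * h q (f q *\<^sub>R defect_field c b q) v
      + \<phi> q * \<beta> b q v * h q (f q *\<^sub>R defect_field c b q) u)" for q u v
  proof (cases "q \<in> supp f")
    case True
    then have q: "q \<in> cdom c" "\<phi> q = 1" using N.Cc_smoothD(3)[OF f] \<phi>(2) by auto
    show ?thesis
      unfolding defect_eq half_defect_expand[OF c q(1)]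
      by (simp add: q \<beta>_def bilinear_lmul[OF inner_form_bilinear[OF N.inner_form_metric]]
          sum_distrib_left sum.distrib algebra_simps)
  next
    case False
    then show ?thesis
      by (simp add: N.not_in_supp bilinear_lzero[OF inner_form_bilinear[OF N.inner_form_metric]])
  qed
  moreover have "(\<lambda>q u v. \<Sum>b\<in>onb. \<phi> q * \<beta> b q u * h q (f q *\<^sub>R defect_field c b q) v
      + \<phi> q * \<beta> b q v * h q (f q *\<^sub>R defect_field c b q) u) \<in> sym_products"
    by (rule sym_products_sum[OF finite_onb]) (rule sym_products_single[OF form field])
  ultimately show ?thesis by simp
qed

text \<open>Three contributions: \<open>?A\<close> from differentiating \<open>f\<close>, the
  defect, and \<open>?B\<close> from the module condition on \<open>M\<close>. For
  \<open>?B\<close>, pairing the lift of \<open>Y i\<close> with a vector of \<open>N\<close> in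
  \<open>h\<close> is pairing \<open>Y i\<close> with its projection in \<open>g\<close>.\<close>

lemma lie_deriv_cutoff_sym_products:
  assumes mod: "\<forall>i<k. smooth_one_form M (\<alpha> i) \<and> Y i \<in> F"
    "\<And>p u v. lie_deriv_metric M X g p u v =
      (\<Sum>i<(k::nat). \<alpha> i p u * g p (Y i p) v + \<alpha> i p v * g p (Y i p) u)"
    and c: "c \<in> atlas N" and f: "f \<in> Cc_smooth N (cdom c)"
  shows "(\<lambda>q u v. lie_deriv_metric N (\<lambda>q. f q *\<^sub>R V q) h q u v) \<in> sym_products"
proof -
  note B = inner_form_bilinear[OF N.inner_form_metric]
  have fU: "f \<in> Cc_smooth N UNIV" by (rule N.Cc_smooth_mono[OF f]) simp
  have sf: "smooth_fun N f" by (rule N.Cc_smoothD(1)[OF f])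
  \<comment> \<open>\<open>V\<close> need not have compact support, so \<open>\<phi> V\<close>
    stands in for it in \<open>PF\<close>; the differential of \<open>f\<close> vanishes wherever
    \<open>\<phi>\<close> might differ from 1.\<close>
  obtain \<phi> where \<phi>: "\<phi> \<in> Cc_smooth N UNIV" "\<forall>q\<in>supp f. \<phi> q = 1"
    using N.ex_bump[OF open_UNIV N.Cc_smoothD(2,3)[OF fU]] by blast
  have Vp: "V \<in> projectable" by (rule projectableI[OF V X VX])
  let ?A = "\<lambda>q u v. N.cdiff f q u * h q (\<phi> q *\<^sub>R V q) v + N.cdiff f q v * h q (\<phi> q *\<^sub>R V q) u"
  let ?B = "\<lambda>i q u v. \<alpha> i (\<pi> q) (d\<pi> q u) * h q (f q *\<^sub>R hlift (Y i) q) v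
      + \<alpha> i (\<pi> q) (d\<pi> q v) * h q (f q *\<^sub>R hlift (Y i) q) u"
  have 1: "?A \<in> sym_products"
    by (rule sym_products_single[OF N.smooth_form_cdiff[OF sf] PF_single[OF \<phi>(1) Vp]])
  have 2: "(\<lambda>q u v. \<Sum>i<k. ?B i q u v) \<in> sym_products"
    using mod(1)
    by (intro sym_products_sum sym_products_single smooth_one_form_pullback PF_single[OF fU]
        hlift_projectable) auto
  have "lie_deriv_metric N (\<lambda>q. f q *\<^sub>R V q) h q u v =
      ?A q u v + (f q * defect q u v + (\<Sum>i<k. ?B i q u v))" for q u v
  proof -
    have A: "N.cdiff f q w * h q (\<phi> q *\<^sub>R V q) w' = N.cdiff f q w * h q (V q) w'" for w w'
      using \<phi>(2) N.cdiff_off_supp[of q f w] by (cases "q \<in> supp f") auto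
    have B: "(\<Sum>i<k. ?B i q u v) = f q * lie_deriv_metric M X g (\<pi> q) (d\<pi> q u) (d\<pi> q v)"
      unfolding mod(2) by (simp add: sum_distrib_left hlift_def hor bilinear_lmul[OF B] algebra_simps)
    have "N.smooth_fun_at q f" using sf by (simp add: N.smooth_fun_iff)
    from N.lie_deriv_metric_scale[OF this V] show ?thesis
      unfolding A B defect_def by (simp add: right_diff_distrib)
  qed
  then show ?thesis
    using sym_products_add[OF 1 sym_products_add[OF defect_sym_products[OF c f] 2]] by simp
qed

end

lemma lie_deriv_PF_sym_products:
  assumes "module_SRF M g F" and "W \<in> PF"
  shows "(\<lambda>q u v. lie_deriv_metric N W h q u v) \<in> sym_products"
  using assms(2) unfolding PF_eq
proof (induction rule: fun_span_induct)
  case zero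
  then show ?case using sym_products_zero by (simp add: N.lie_deriv_metric_zero)
next
  case (step f V Y)
  have V: "N.smooth_vf_at q V" for q by (rule projectableD(1)[OF step(2)])
  obtain X where X: "X \<in> F" "\<And>q. d\<pi> q (V q) = X (\<pi> q)" using projectableD(2)[OF step(2)] by blast
  have "\<exists>(k::nat) \<alpha> Z. (\<forall>i<k. smooth_one_form M (\<alpha> i) \<and> Z i \<in> F) \<and>
      (\<forall>p u v. lie_deriv_metric M X g p u v =
        (\<Sum>i<k. \<alpha> i p u * g p (Z i p) v + \<alpha> i p v * g p (Z i p) u))"
    using assms(1)[unfolded module_SRF_def, THEN conjunct2, THEN conjunct2] X(1) by (rule bspec)
  then obtain k :: nat and \<alpha> Z where mod: "\<forall>i<k. smooth_one_form M (\<alpha> i) \<and> Z i \<in> F"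
    and mod': "\<forall>p u v. lie_deriv_metric M X g p u v =
      (\<Sum>i<k. \<alpha> i p u * g p (Z i p) v + \<alpha> i p v * g p (Z i p) u)"
    by (elim exE conjE)
  \<comment> \<open>Smoothness of the coefficient is carried along because additivity of the Lie
    derivative in the field requires it.\<close>
  define Q where "Q f \<longleftrightarrow> (\<forall>q. N.smooth_fun_at q f) \<and>
    (\<lambda>q u v. lie_deriv_metric N (\<lambda>q. f q *\<^sub>R V q) h q u v) \<in> sym_products" for f
  have "Q f"
    using step(1)
  proof (rule N.Cc_smooth_chart_induct)
    show "Q (\<lambda>_. 0)"
      using sym_products_zero by (simp add: Q_def N.lie_deriv_metric_zero N.smooth_fun_at_const)
    show "Q (\<lambda>p. f p + f' p)" if Q: "Q f" "Q f'" for f f'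
    proof -
      have s: "N.smooth_fun_at q f" "N.smooth_fun_at q f'" for q using Q by (auto simp: Q_def)
      have eq: "lie_deriv_metric N (\<lambda>q. (f q + f' q) *\<^sub>R V q) h q u v =
          lie_deriv_metric N (\<lambda>q. f q *\<^sub>R V q) h q u v + lie_deriv_metric N (\<lambda>q. f' q *\<^sub>R V q) h q u v"
        for q u v
        unfolding scaleR_add_left
        by (rule N.lie_deriv_metric_add[OF N.smooth_vf_at_scale[OF s(1) V] N.smooth_vf_at_scale[OF s(2) V]])
      have "(\<lambda>q u v. lie_deriv_metric N (\<lambda>q. f q *\<^sub>R V q) h q u v
          + lie_deriv_metric N (\<lambda>q. f' q *\<^sub>R V q) h q u v) \<in> sym_products"
        using Q by (intro sym_products_add) (simp_all add: Q_def)
      then show ?thesis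
        unfolding Q_def eq by (intro conjI allI N.smooth_fun_at_add[OF s])
    qed
    show "Q f" if cf: "c \<in> atlas N" "f \<in> Cc_smooth N (cdom c)" for f c
      unfolding Q_def using lie_deriv_cutoff_sym_products[OF V X mod mod'[rule_format] cf] N.Cc_smoothD(1)[OF cf(2)]
      by (simp add: N.smooth_fun_iff)
  qed
  then have Q: "N.smooth_fun_at q f"
    "(\<lambda>q u v. lie_deriv_metric N (\<lambda>q. f q *\<^sub>R V q) h q u v) \<in> sym_products" for q
    by (auto simp: Q_def)
  have Y: "N.smooth_vf_at q Y" for q using step(3) PF_smooth by (simp add: PF_eq)
  show ?case
    unfolding N.lie_deriv_metric_add[OF N.smooth_vf_at_scale[OF Q(1) V] Y]
    by (rule sym_products_add[OF Q(2) step(4)])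
qed

lemma module_SRF_PF:
  assumes "module_SRF M g F"
  shows "module_SRF N h PF"
  unfolding module_SRF_def
proof (intro conjI ballI)
  fix W assume "W \<in> PF"
  from lie_deriv_PF_sym_products[OF assms this]
  show "\<exists>(k::nat) \<alpha> Y. (\<forall>i<k. smooth_one_form N (\<alpha> i) \<and> Y i \<in> PF) \<and>
        (\<forall>p u v. lie_deriv_metric N W h p u v =
           (\<Sum>i<k. \<alpha> i p u * h p (Y i p) v + \<alpha> i p v * h p (Y i p) u))"
    by (simp add: sym_products_def)
qed (fact N.riemannian singular_foliation_PF)+

end

section \<open>Geodesics\<close>

lemma vector_derivative_eq_Dv: "f differentiable (at t) \<Longrightarrow> vector_derivative f (at t) = Dv f t 1"
  by (simp add: Dv_eq_vector_derivative)

lemma Dv_real_has_real_derivative: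
  fixes f :: "real \<Rightarrow> real"
  assumes "smooth_at t f"
  shows "(f has_real_derivative Dv f t 1) (at t)"
proof -
  have "Dv f t = (*) (Dv f t 1)"
  proof
    show "Dv f t r = Dv f t 1 * r" for r
      using linear_scale[OF smooth_at_linear_Dv[OF assms], of r 1] by simp
  qed
  with smooth_at_has_derivative[OF assms] show ?thesis by (simp add: has_field_derivative_def)
qed

text \<open>
  The momentum of a curve along a vector field \<open>W\<close> changes at the rate \<open>(\<L>\<^sub>W h)(x', x') / 2\<close>, up to
  the covariant acceleration.
\<close>

lemma Dv_momentum:
  fixes x :: "real \<Rightarrow> 'a::finite_dimensional_inner"
  assumes x: "smooth_at t x" and h: "metric_at (x t) h" and W: "smooth_at (x t) W"
    and v: "v = Dv x t 1" and a: "a = Dv (\<lambda>s. Dv x s 1) t 1" and w: "w = W (x t)"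
  shows "Dv (\<lambda>s. h (x s) (Dv x s 1) (W (x s))) t 1 =
    ld W h (x t) v v / 2 + (h (x t) a w + Dv (\<lambda>y. h y v w) (x t) v - Dv (\<lambda>y. h y v v) (x t) w / 2)"
proof -
  have hb: "bilin_at (x t) h" by (rule metric_at_bilin_at[OF h])
  have hs: "smooth_at (x t) (\<lambda>y. h y p q)" for p q using hb by (simp add: bilin_at_def)
  note d = smooth_at_differentiable
  have "Dv (\<lambda>s. h (x s) (Dv x s 1) (W (x s))) t 1 =
      Dv (\<lambda>s. h (x s) v w) t 1 + h (x t) a w + h (x t) v (Dv (\<lambda>s. W (x s)) t 1)"
    unfolding v a w
    by (rule Dv_bilin[OF bilin_at_pullback[OF x hb] smooth_at_Dv[OF x] smooth_at_compose[OF x W]])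
  moreover have "Dv (\<lambda>s. h (x s) v w) t 1 = Dv (\<lambda>y. h y v w) (x t) v"
    unfolding v by (rule Dv_compose[OF d[OF x] d[OF hs]])
  moreover have "Dv (\<lambda>s. W (x s)) t 1 = Dv W (x t) v"
    unfolding v by (rule Dv_compose[OF d[OF x] d[OF W]])
  ultimately show ?thesis
    using inner_form_sym[OF metric_at_inner_form[OF h], of v] by (simp add: ld_def w add_divide_distrib)
qed

context smooth_mfd
begin

section \<open>Curves and their velocities in charts\<close>

lemma curve_domain:
  assumes "smooth_curve M I \<gamma>" "open I" "t \<in> I" "c \<in> atlas M" "\<gamma> t \<in> cdom c"
  shows "\<forall>\<^sub>F s in nhds t. s \<in> I \<and> \<gamma> s \<in> cdom c"
proof -
  have "open (I \<inter> \<gamma> -` cdom c)"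
    using assms(1,2) open_cdom[OF assms(4)]
    by (intro continuous_open_preimage) (auto simp: smooth_curve_def)
  then show ?thesis
    unfolding eventually_nhds using assms(3,5) by (intro exI[of _ "I \<inter> \<gamma> -` cdom c"]) auto
qed

lemma smooth_at_curve:
  assumes "smooth_curve M I \<gamma>" "open I" "t \<in> I" "c \<in> atlas M" "\<gamma> t \<in> cdom c"
  shows "smooth_at t (\<lambda>s. coord c (\<gamma> s))"
proof -
  have "{t\<in>I. \<gamma> t \<in> cdom c} = I \<inter> \<gamma> -` cdom c" by auto
  moreover have "open (I \<inter> \<gamma> -` cdom c)"
    using assms(1,2) open_cdom[OF assms(4)]
    by (intro continuous_open_preimage) (auto simp: smooth_curve_def)
  moreover have "smooth_on {t\<in>I. \<gamma> t \<in> cdom c} (coord c \<circ> \<gamma>)"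
    using assms(1,4) by (simp add: smooth_curve_def)
  ultimately show ?thesis
    using smooth_on_iff_smooth_at[of "I \<inter> \<gamma> -` cdom c" "coord c \<circ> \<gamma>"] assms(3,5) by (simp add: o_def)
qed

lemma smooth_curveI:
  assumes "continuous_on I \<gamma>" "open I"
    "\<And>t c. t \<in> I \<Longrightarrow> c \<in> atlas M \<Longrightarrow> \<gamma> t \<in> cdom c \<Longrightarrow> smooth_at t (\<lambda>s. coord c (\<gamma> s))"
  shows "smooth_curve M I \<gamma>"
  unfolding smooth_curve_def
proof (intro conjI ballI)
  fix c assume c: "c \<in> atlas M"
  have "{t\<in>I. \<gamma> t \<in> cdom c} = I \<inter> \<gamma> -` cdom c" by auto
  moreover have "open (I \<inter> \<gamma> -` cdom c)"
    using assms(1,2) open_cdom[OF c] by (intro continuous_open_preimage)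
  ultimately show "smooth_on {t\<in>I. \<gamma> t \<in> cdom c} (coord c \<circ> \<gamma>)"
    using smooth_on_iff_smooth_at[of "I \<inter> \<gamma> -` cdom c" "coord c \<circ> \<gamma>"] assms(3)[OF _ c]
    by (simp add: o_def)
qed (fact assms(1))

lemma to_chart_velocity:
  assumes "smooth_curve M I \<gamma>" "open I" "t \<in> I" and c: "c \<in> atlas M" "\<gamma> t \<in> cdom c"
  shows "to_chart M c (\<gamma> t) (velocity M \<gamma> t) = Dv (\<lambda>s. coord c (\<gamma> s)) t 1"
proof -
  let ?d = "chart_at M (\<gamma> t)"
  have d: "?d \<in> atlas M" "\<gamma> t \<in> cdom ?d" by auto
  note s = smooth_at_differentiable[OF smooth_at_curve[OF assms(1-3)]]
  have "\<forall>\<^sub>F s in nhds t. tr ?d c (coord ?d (\<gamma> s)) = coord c (\<gamma> s)"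
    using curve_domain[OF assms(1-3) d] by eventually_elim auto
  from fun_cong[OF Dv_cong[OF this], of 1]
  have "Dv (tr ?d c) (coord ?d (\<gamma> t)) (Dv (\<lambda>s. coord ?d (\<gamma> s)) t 1) = Dv (\<lambda>s. coord c (\<gamma> s)) t 1"
    using Dv_compose[OF s[OF d], of "tr ?d c" 1] smooth_at_differentiable[OF smooth_at_tr[OF d c]]
    by simp
  moreover have "velocity M \<gamma> t = Dv (\<lambda>s. coord ?d (\<gamma> s)) t 1"
    using vector_derivative_eq_Dv[OF s[OF d]] by (simp add: velocity_def o_def)
  ultimately show ?thesis by (simp add: to_chart_eq)
qed

end

context riem_mfd
begin

text \<open>The left-hand side of the geodesic equation in the chart \<open>c\<close>, i.e. the
  components of the covariant derivative of the velocity.\<close>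

definition acceleration :: "('a, 'e) chart \<Rightarrow> (real \<Rightarrow> 'a) \<Rightarrow> real \<Rightarrow> 'e" where
  "acceleration c \<gamma> t =
     (let x = coord c \<circ> \<gamma>; x' = (\<lambda>s. vector_derivative x (at s)) in
        vector_derivative x' (at t) + christoffel M g c (x t) (x' t) (x' t))"

lemma geodesic_iff:
  "geodesic M g I \<gamma> \<longleftrightarrow> open I \<and> is_interval I \<and> smooth_curve M I \<gamma> \<and>
     (\<forall>c\<in>atlas M. \<forall>t\<in>I. \<gamma> t \<in> cdom c \<longrightarrow> acceleration c \<gamma> t = 0)"
  by (simp add: geodesic_def acceleration_def Let_def)

text \<open>With the index lowered, the definite description in \<open>christoffel\<close> becomes
  an instance of \<open>sharp\<close>, whose existence is known. The diagonal case is all that the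
  geodesic equation contains.\<close>

lemma christoffel_metric:
  assumes c: "c \<in> atlas M" "p \<in> cdom c"
  shows "metric_rep M g c (coord c p) (christoffel M g c (coord c p) u u) w =
    Dv (\<lambda>y. metric_rep M g c y u w) (coord c p) u - Dv (\<lambda>y. metric_rep M g c y u u) (coord c p) w / 2"
proof -
  let ?x = "coord c p" and ?h = "metric_rep M g c"
  let ?r = "\<lambda>w. Dv (\<lambda>y. ?h y u w) ?x u - Dv (\<lambda>y. ?h y u u) ?x w / 2"
  have hs: "smooth_at ?x (\<lambda>y. ?h y a b)" for a b
    using bilin_at_rep[OF c] by (simp add: bilin_at_def)
  have z: "?h ?x 0 a = 0" "?h ?x a 0 = 0" for a
    using bilin_at_bilinear[OF bilin_at_rep[OF c]] by (simp_all add: bilinear_lzero bilinear_rzero)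
  \<comment> \<open>For a constant field \<open>ld\<close> reduces to the derivative of the metric
    along it, so linearity in \<open>w\<close> can be read off from
    \<open>bilinear_ld\<close>.\<close>
  have "bilinear (ld (\<lambda>_. u) ?h ?x)" by (intro bilinear_ld bilin_at_rep c) simp
  then have 1: "linear (\<lambda>w. Dv (\<lambda>y. ?h y u w) ?x u)"
    unfolding bilinear_def ld_def by (simp add: z)
  have 2: "linear (\<lambda>w. Dv (\<lambda>y. ?h y u u) ?x w / 2)"
    using linear_compose_scale_right[OF smooth_at_linear_Dv[OF hs], of "1 / 2" u u] by simp
  have "linear ?r" by (rule linear_compose_sub[OF 1 2])
  moreover have "christoffel M g c ?x u u = sharp (?h ?x) ?r"
    unfolding christoffel_def sharp_def
    by (rule arg_cong[where f = The]) (auto simp: fun_eq_iff field_simps)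
  ultimately show ?thesis
    using sharp_works[OF inner_form_metric_rep[OF c], of ?r w] by simp
qed

text \<open>Stated for arbitrary curves with the acceleration as error term: setting it to zero
  gives the momentum law of geodesics, and solving for it gives the converse
  \<open>geodesicI\<close>.\<close>

lemma momentum_derivative:
  assumes \<gamma>: "smooth_curve M I \<gamma>" "open I" "t \<in> I" and X: "smooth_vf_at (\<gamma> t) X"
    and c: "c \<in> atlas M" "\<gamma> t \<in> cdom c"
  shows "((\<lambda>s. g (\<gamma> s) (velocity M \<gamma> s) (X (\<gamma> s))) has_real_derivative
    lie_deriv_metric M X g (\<gamma> t) (velocity M \<gamma> t) (velocity M \<gamma> t) / 2
    + metric_rep M g c (coord c (\<gamma> t)) (acceleration c \<gamma> t) (to_chart M c (\<gamma> t) (X (\<gamma> t)))) (at t)"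
proof -
  let ?h = "metric_rep M g c" and ?x = "\<lambda>s. coord c (\<gamma> s)" and ?W = "vf_rep M c X"
  have x: "smooth_at t ?x" by (rule smooth_at_curve[OF \<gamma> c])
  have W: "smooth_at (?x t) ?W" using X c by (simp add: smooth_vf_at_def)
  have h: "metric_at (?x t) ?h" by (rule metric_at_rep[OF c])
  have ev: "\<forall>\<^sub>F s in nhds t. ?h (?x s) (Dv ?x s 1) (?W (?x s)) = g (\<gamma> s) (velocity M \<gamma> s) (X (\<gamma> s))"
    using curve_domain[OF \<gamma> c]
  proof eventually_elim
    case (elim s)
    then show ?case
      using to_chart_velocity[OF \<gamma>(1,2) _ c(1), of s] c(1)
      by (simp add: vf_rep_coord metric_rep_to_chart flip: to_chart_velocity[OF \<gamma>(1,2) _ c(1)])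
  qed
  have sm: "smooth_at t (\<lambda>s. ?h (?x s) (Dv ?x s 1) (?W (?x s)))"
    by (rule smooth_at_bilin[OF bilin_at_pullback[OF x metric_at_bilin_at[OF h]]
          smooth_at_Dv[OF x] smooth_at_compose[OF x W]])
  have vel: "to_chart M c (\<gamma> t) (velocity M \<gamma> t) = Dv ?x t 1" by (rule to_chart_velocity[OF \<gamma> c])
  have vd: "\<forall>\<^sub>F s in nhds t. Dv ?x s 1 = vector_derivative ?x (at s)"
    using smooth_at_eventually[OF x]
    by eventually_elim (simp add: vector_derivative_eq_Dv smooth_at_differentiable)
  have "vector_derivative (\<lambda>s. vector_derivative ?x (at s)) (at t) =
      Dv (\<lambda>s. vector_derivative ?x (at s)) t 1"
    by (intro vector_derivative_eq_Dv smooth_at_differentiable smooth_at_cong[OF vd] smooth_at_Dv x)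
  also have "\<dots> = Dv (\<lambda>s. Dv ?x s 1) t 1" by (rule fun_cong[OF Dv_cong[OF vd], symmetric])
  finally have acc: "acceleration c \<gamma> t = Dv (\<lambda>s. Dv ?x s 1) t 1
      + christoffel M g c (?x t) (Dv ?x t 1) (Dv ?x t 1)"
    using eventually_nhds_x_imp_x[OF vd] by (simp add: acceleration_def Let_def o_def)
  have "Dv (\<lambda>s. ?h (?x s) (Dv ?x s 1) (?W (?x s))) t 1 =
      ld ?W ?h (?x t) (Dv ?x t 1) (Dv ?x t 1) / 2 + ?h (?x t) (acceleration c \<gamma> t) (?W (?x t))"
    unfolding Dv_momentum[OF x h W refl refl refl] acc
      bilinear_ladd[OF bilin_at_bilinear[OF metric_at_bilin_at[OF h]]] christoffel_metric[OF c] by simp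
  also have "ld ?W ?h (?x t) (Dv ?x t 1) (Dv ?x t 1) =
      lie_deriv_metric M X g (\<gamma> t) (velocity M \<gamma> t) (velocity M \<gamma> t)"
    unfolding vel[symmetric] by (rule lie_deriv_metric_chart[OF c X bilin_at_rep[OF c], symmetric])
  finally have D: "Dv (\<lambda>s. ?h (?x s) (Dv ?x s 1) (?W (?x s))) t 1 =
      lie_deriv_metric M X g (\<gamma> t) (velocity M \<gamma> t) (velocity M \<gamma> t) / 2
      + ?h (?x t) (acceleration c \<gamma> t) (to_chart M c (\<gamma> t) (X (\<gamma> t)))"
    by (simp only: vf_rep_coord[OF c])
  have "smooth_at t (\<lambda>s. g (\<gamma> s) (velocity M \<gamma> s) (X (\<gamma> s)))" by (rule smooth_at_cong[OF ev sm])
  from Dv_real_has_real_derivative[OF this] show ?thesis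
    using fun_cong[OF Dv_cong[OF ev], of 1] D by simp
qed

lemma geodesic_momentum:
  assumes \<gamma>: "geodesic M g I \<gamma>" "t \<in> I" and X: "smooth_vf_at (\<gamma> t) X"
  shows "((\<lambda>s. g (\<gamma> s) (velocity M \<gamma> s) (X (\<gamma> s))) has_real_derivative
    lie_deriv_metric M X g (\<gamma> t) (velocity M \<gamma> t) (velocity M \<gamma> t) / 2) (at t)"
proof -
  let ?c = "chart_at M (\<gamma> t)"
  have c: "?c \<in> atlas M" "\<gamma> t \<in> cdom ?c" by auto
  have *: "smooth_curve M I \<gamma>" "open I" "acceleration ?c \<gamma> t = 0"
    using \<gamma> c by (auto simp: geodesic_iff)
  show ?thesis
    using momentum_derivative[OF *(1,2) \<gamma>(2) X c] *(3)
    by (simp add: bilinear_lzero[OF inner_form_bilinear[OF inner_form_metric_rep[OF c]]])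
qed

text \<open>The momentum law along the constant coordinate fields says that the acceleration pairs
  to zero with every vector. A projected curve can thus be recognised as a geodesic without
  computing its Christoffel terms.\<close>

lemma geodesicI:
  assumes \<gamma>: "smooth_curve M I \<gamma>" "open I" "is_interval I"
    and mom: "\<And>t X. t \<in> I \<Longrightarrow> smooth_vf_at (\<gamma> t) X \<Longrightarrow>
      ((\<lambda>s. g (\<gamma> s) (velocity M \<gamma> s) (X (\<gamma> s))) has_real_derivative
        lie_deriv_metric M X g (\<gamma> t) (velocity M \<gamma> t) (velocity M \<gamma> t) / 2) (at t)"
  shows "geodesic M g I \<gamma>"
  unfolding geodesic_iff
proof (intro conjI ballI impI)
  fix c t assume c: "c \<in> atlas M" and t: "t \<in> I" and d: "\<gamma> t \<in> cdom c"
  show "acceleration c \<gamma> t = 0"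
  proof (rule inner_form_eqI[OF inner_form_metric_rep[OF c d]])
    fix w
    have X: "smooth_vf_at (\<gamma> t) (\<lambda>q. from_chart M c q w)" by (rule smooth_vf_at_from_chart[OF c d])
    from DERIV_unique[OF momentum_derivative[OF \<gamma>(1,2) t X c d] mom[OF t X]] c d
    show "metric_rep M g c (coord c (\<gamma> t)) (acceleration c \<gamma> t) w =
        metric_rep M g c (coord c (\<gamma> t)) 0 w"
      by (simp add: bilinear_lzero[OF inner_form_bilinear[OF inner_form_metric_rep[OF c d]]])
  qed
qed (fact \<gamma>)+

end

subsection \<open>A vanishing lemma of Gronwall type\<close>

text \<open>\<open>u\<close> times \<open>exp (- (C * r))\<close> is nonincreasing and
  \<open>u\<close> times \<open>exp (C * r)\<close> is nondecreasing, so a zero of the nonnegative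
  \<open>u\<close> spreads in both directions.\<close>

lemma gronwall_zero:
  fixes u u' :: "real \<Rightarrow> real"
  assumes der: "\<And>r. a \<le> r \<Longrightarrow> r \<le> b \<Longrightarrow> (u has_real_derivative u' r) (at r)"
    and bound: "\<And>r. a \<le> r \<Longrightarrow> r \<le> b \<Longrightarrow> \<bar>u' r\<bar> \<le> C * u r"
    and nonneg: "\<And>r. u r \<ge> 0"
    and s: "a \<le> s" "s \<le> b" "u s = 0" and t: "a \<le> t" "t \<le> b"
  shows "u t = 0"
proof (cases "s \<le> t")
  case True
  have "u t * exp (- (C * t)) \<le> u s * exp (- (C * s))"
  proof (rule DERIV_nonpos_imp_nonincreasing[OF True])
    fix r assume r: "s \<le> r" "r \<le> t"
    have "((\<lambda>r. u r * exp (- (C * r))) has_real_derivative (u' r - C * u r) * exp (- (C * r))) (at r)"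
      using der[of r] r s t by (auto intro!: derivative_eq_intros simp: algebra_simps)
    moreover have "(u' r - C * u r) * exp (- (C * r)) \<le> 0"
      using bound[of r] r s t by (intro mult_nonpos_nonneg) (auto simp: abs_le_iff)
    ultimately show "\<exists>y. ((\<lambda>r. u r * exp (- (C * r))) has_real_derivative y) (at r) \<and> y \<le> 0" by blast
  qed
  then have "u t \<le> 0" using s by (simp add: mult_le_0_iff)
  then show ?thesis using nonneg[of t] by simp
next
  case False
  then have ts: "t \<le> s" by simp
  have "u t * exp (C * t) \<le> u s * exp (C * s)"
  proof (rule DERIV_nonneg_imp_nondecreasing[OF ts])
    fix r assume r: "t \<le> r" "r \<le> s"
    have "((\<lambda>r. u r * exp (C * r)) has_real_derivative (u' r + C * u r) * exp (C * r)) (at r)"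
      using der[of r] r s t by (auto intro!: derivative_eq_intros simp: algebra_simps)
    moreover have "(u' r + C * u r) * exp (C * r) \<ge> 0"
      using bound[of r] r s t by (intro mult_nonneg_nonneg) (auto simp: abs_le_iff)
    ultimately show "\<exists>y. ((\<lambda>r. u r * exp (C * r)) has_real_derivative y) (at r) \<and> y \<ge> 0" by blast
  qed
  then have "u t \<le> 0" using s by (simp add: mult_le_0_iff)
  then show ?thesis using nonneg[of t] by simp
qed

text \<open>Gronwall for the sum of squares: a common bound \<open>K\<close> of the coefficients on
  the compact interval bounds its derivative by a multiple of itself.\<close>

lemma linear_ode_zero:
  fixes m :: "'i \<Rightarrow> real \<Rightarrow> real" and A :: "'i \<Rightarrow> 'i \<Rightarrow> real \<Rightarrow> real"
  assumes B: "finite B"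
    and der: "\<And>i r. i \<in> B \<Longrightarrow> a \<le> r \<Longrightarrow> r \<le> b \<Longrightarrow>
      (m i has_real_derivative (\<Sum>j\<in>B. A i j r * m j r)) (at r)"
    and cont: "\<And>i j. i \<in> B \<Longrightarrow> j \<in> B \<Longrightarrow> continuous_on {a..b} (A i j)"
    and s: "a \<le> s" "s \<le> b" "\<And>i. i \<in> B \<Longrightarrow> m i s = 0" and t: "a \<le> t" "t \<le> b" and i: "i \<in> B"
  shows "m i t = 0"
proof -
  let ?S = "\<lambda>r. \<Sum>i\<in>B. \<Sum>j\<in>B. \<bar>A i j r\<bar>"
  have "continuous_on {a..b} ?S"
    by (intro continuous_on_sum continuous_on_rabs cont)
  then have "bounded (?S ` {a..b})"
    by (intro compact_imp_bounded compact_continuous_image compact_Icc)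
  then obtain K where "\<forall>y\<in>?S ` {a..b}. norm y \<le> K" unfolding bounded_iff ..
  then have K: "norm (?S r) \<le> K" if "r \<in> {a..b}" for r using that by simp
  have AK: "\<bar>A i j r\<bar> \<le> K" if "i \<in> B" "j \<in> B" "r \<in> {a..b}" for i j r
  proof -
    have "\<bar>A i j r\<bar> \<le> (\<Sum>j\<in>B. \<bar>A i j r\<bar>)" using that B by (intro member_le_sum) auto
    also have "\<dots> \<le> ?S r" using that B by (intro member_le_sum) (auto intro: sum_nonneg)
    also have "\<dots> \<le> K" using K[OF that(3)] by simp
    finally show ?thesis .
  qed
  define u where "u r = (\<Sum>i\<in>B. (m i r)\<^sup>2)" for r
  define u' where "u' r = (\<Sum>i\<in>B. \<Sum>j\<in>B. 2 * (m i r * (A i j r * m j r)))" for r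
  have "u t = 0"
  proof (rule gronwall_zero[OF _ _ _ s(1,2) _ t])
    fix r assume r: "a \<le> r" "r \<le> b"
    have "((\<lambda>r. (m i r)\<^sup>2) has_real_derivative (\<Sum>j\<in>B. 2 * (m i r * (A i j r * m j r)))) (at r)"
      if "i \<in> B" for i
      using DERIV_power[OF der[OF that r], of 2] by (simp add: sum_distrib_left mult_ac)
    then show "(u has_real_derivative u' r) (at r)"
      unfolding u_def[abs_def] u'_def by (intro DERIV_sum)
    have "\<bar>u' r\<bar> \<le> (\<Sum>i\<in>B. \<Sum>j\<in>B. \<bar>2 * (m i r * (A i j r * m j r))\<bar>)"
      unfolding u'_def by (rule order_trans[OF sum_abs sum_mono[OF sum_abs]])
    also have "\<dots> \<le> (\<Sum>i\<in>B. \<Sum>j\<in>B. K * ((m i r)\<^sup>2 + (m j r)\<^sup>2))"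
    proof (intro sum_mono)
      fix i j assume ij: "i \<in> B" "j \<in> B"
      have "\<bar>2 * (m i r * (A i j r * m j r))\<bar> = \<bar>A i j r\<bar> * (2 * \<bar>m i r\<bar> * \<bar>m j r\<bar>)"
        by (simp add: abs_mult)
      also have "\<dots> \<le> K * ((m i r)\<^sup>2 + (m j r)\<^sup>2)"
        using AK[OF ij, of r] r sum_squares_bound[of "\<bar>m i r\<bar>" "\<bar>m j r\<bar>"]
        by (intro mult_mono) auto
      finally show "\<bar>2 * (m i r * (A i j r * m j r))\<bar> \<le> K * ((m i r)\<^sup>2 + (m j r)\<^sup>2)" .
    qed
    \<comment> \<open>Each of the two squares contributes \<open>card B\<close> copies of
      \<open>u r\<close> to the double sum.\<close>
    also have "\<dots> = (2 * K * card B) * u r"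
      by (simp add: u_def sum.distrib sum_distrib_left[symmetric] algebra_simps)
    finally show "\<bar>u' r\<bar> \<le> (2 * K * card B) * u r" .
  next
    show "u r \<ge> 0" for r by (simp add: u_def sum_nonneg)
    show "u s = 0" using s(3) by (simp add: u_def)
  qed
  then show ?thesis using B i by (simp add: u_def sum_nonneg_eq_0_iff)
qed

section \<open>Horizontal geodesics\<close>

context riem_subm
begin

lemma smooth_curve_comp:
  assumes \<gamma>: "smooth_curve N I \<gamma>" "open I"
  shows "smooth_curve M I (\<pi> \<circ> \<gamma>)"
    and "t \<in> I \<Longrightarrow> velocity M (\<pi> \<circ> \<gamma>) t = d\<pi> (\<gamma> t) (velocity N \<gamma> t)"
proof -
  have ev: "\<forall>\<^sub>F s in nhds t. prj \<pi> c d (coord c (\<gamma> s)) = coord d (\<pi> (\<gamma> s))"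
    and sm: "smooth_at t (\<lambda>s. prj \<pi> c d (coord c (\<gamma> s)))"
    if t: "t \<in> I" and c: "c \<in> atlas N" "\<gamma> t \<in> cdom c" and d: "d \<in> atlas M" "\<pi> (\<gamma> t) \<in> cdom d" for t c d
  proof -
    show "\<forall>\<^sub>F s in nhds t. prj \<pi> c d (coord c (\<gamma> s)) = coord d (\<pi> (\<gamma> s))"
      using N.curve_domain[OF \<gamma> t c] by eventually_elim (use c in auto)
    show "smooth_at t (\<lambda>s. prj \<pi> c d (coord c (\<gamma> s)))"
      using smooth_at_compose[OF N.smooth_at_curve[OF \<gamma> t c], of "prj \<pi> c d"] smooth_at_prj[OF c d]
      by simp
  qed
  show "smooth_curve M I (\<pi> \<circ> \<gamma>)"
  proof (rule M.smooth_curveI[OF _ \<gamma>(2)])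
    show "continuous_on I (\<pi> \<circ> \<gamma>)"
      using \<gamma>(1) continuous_on_subset[OF continuous_pi]
      by (intro continuous_on_compose) (auto simp: smooth_curve_def)
    fix t d assume t: "t \<in> I" and d: "d \<in> atlas M" "(\<pi> \<circ> \<gamma>) t \<in> cdom d"
    then have d': "\<pi> (\<gamma> t) \<in> cdom d" by simp
    show "smooth_at t (\<lambda>s. coord d ((\<pi> \<circ> \<gamma>) s))"
      using smooth_at_cong[OF ev sm, OF t N.chart_at_atlas N.chart_at_cdom d(1) d'
          t N.chart_at_atlas N.chart_at_cdom d(1) d'] by simp
  qed
  assume t: "t \<in> I"
  let ?c = "chart_at N (\<gamma> t)" and ?d = "chart_at M (\<pi> (\<gamma> t))"
  have c: "?c \<in> atlas N" "\<gamma> t \<in> cdom ?c" and d: "?d \<in> atlas M" "\<pi> (\<gamma> t) \<in> cdom ?d" by auto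
  have x: "smooth_at t (\<lambda>s. coord ?c (\<gamma> s))" by (rule N.smooth_at_curve[OF \<gamma> t c])
  note di = smooth_at_differentiable
  have "velocity M (\<pi> \<circ> \<gamma>) t = vector_derivative (\<lambda>s. coord ?d (\<pi> (\<gamma> s))) (at t)"
    by (simp add: velocity_def o_def)
  also have "\<dots> = Dv (\<lambda>s. coord ?d (\<pi> (\<gamma> s))) t 1"
    by (rule vector_derivative_eq_Dv[OF di[OF smooth_at_cong[OF ev[OF t c d] sm[OF t c d]]]])
  also have "\<dots> = Dv (\<lambda>s. prj \<pi> ?c ?d (coord ?c (\<gamma> s))) t 1"
    by (rule fun_cong[OF Dv_cong[OF ev[OF t c d]], symmetric])
  also have "\<dots> = Dv (prj \<pi> ?c ?d) (coord ?c (\<gamma> t)) (Dv (\<lambda>s. coord ?c (\<gamma> s)) t 1)"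
    by (rule Dv_compose[OF di[OF x] di[OF smooth_at_prj[OF c d]]])
  also have "\<dots> = d\<pi> (\<gamma> t) (velocity N \<gamma> t)"
    using N.to_chart_velocity[OF \<gamma> t c] Dv_prj[OF c d, of "velocity N \<gamma> t"] by simp
  finally show "velocity M (\<pi> \<circ> \<gamma>) t = d\<pi> (\<gamma> t) (velocity N \<gamma> t)" .
qed

text \<open>\<open>vert\<close> is the \<open>h\<close>-orthogonal projection, hence self-adjoint.
  Momenta along vertical fields therefore see only the vertical part of the velocity.\<close>

lemma metric_vert: "h q u (vert q v) = h q (vert q u) v"
proof -
  note B = inner_form_bilinear[OF N.inner_form_metric, of q]
  have "h q u (hor q (d\<pi> q v)) = h q (hor q (d\<pi> q u)) v"
    using hor(2)[of q "d\<pi> q v" u] hor(2)[of q "d\<pi> q u" v] inner_form_sym[OF N.inner_form_metric, of q u]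
      inner_form_sym[OF M.inner_form_metric, of "\<pi> q" "d\<pi> q u"] by simp
  then show ?thesis by (simp add: vert_def bilinear_lsub[OF B] bilinear_rsub[OF B])
qed

text \<open>A vertical field is related to the zero field, so its Lie derivative of \<open>h\<close>
  vanishes on pairs of horizontal vectors. Expanding this for the horizontal part
  \<open>u - vert q u\<close> leaves a term with a factor \<open>vert q u\<close>, and this factor
  is what closes the system of equations for the momenta.\<close>

lemma lie_deriv_metric_vertical:
  assumes W: "N.smooth_vf_at q W" and "\<And>r. d\<pi> r (W r) = 0"
  shows "lie_deriv_metric N W h q u u = lie_deriv_metric N W h q (2 *\<^sub>R u - vert q u) (vert q u)"
proof -
  note B = N.lie_deriv_metric_bilinear[OF W]
  let ?H = "hor q (d\<pi> q u)" and ?L = "lie_deriv_metric N W h q"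
  have "?L ?H ?H = 0"
    using lie_deriv_metric_hor[OF W M.smooth_vf_at_zero] assms(2) by (simp add: M.lie_deriv_metric_zero)
  moreover have "?H = u - vert q u" by (simp add: vert_def)
  ultimately have "?L (u - vert q u) (u - vert q u) = 0" by simp
  then show ?thesis
    using N.lie_deriv_metric_sym[of W q u "vert q u"]
    by (simp add: bilinear_lsub[OF B] bilinear_rsub[OF B] bilinear_lmul[OF B])
qed

text \<open>Formulated symmetrically in \<open>s\<close> and \<open>t\<close> over a neighbourhood
  of \<open>t0\<close>, so that connectedness can spread it over \<open>I\<close>. The work takes
  place in one chart, where the momenta solve a linear system with continuous coefficients.\<close>

lemma horizontal_locally:
  assumes geo: "geodesic N h I \<gamma>" and t0: "t0 \<in> I"
  shows "\<exists>e>0. \<forall>s t. \<bar>s - t0\<bar> \<le> e \<longrightarrow> \<bar>t - t0\<bar> \<le> e \<longrightarrow>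
    vert (\<gamma> s) (velocity N \<gamma> s) = 0 \<longrightarrow> vert (\<gamma> t) (velocity N \<gamma> t) = 0"
proof -
  have \<gamma>: "smooth_curve N I \<gamma>" "open I" using geo by (auto simp: geodesic_def)
  define c where "c = chart_at N (\<gamma> t0)"
  have c: "c \<in> atlas N" "\<gamma> t0 \<in> cdom c" by (auto simp: c_def)
  obtain e' where e': "e' > 0" "\<And>s. dist s t0 < e' \<Longrightarrow> s \<in> I \<and> \<gamma> s \<in> cdom c"
    using N.curve_domain[OF \<gamma> t0 c] unfolding eventually_nhds_metric by blast
  \<comment> \<open>The closed interval of radius \<open>e\<close> stays in the chart, and its
    compactness bounds the coefficients \<open>A\<close>.\<close>
  define e where "e = e' / 2"
  have e: "e > 0" using e'(1) by (simp add: e_def)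
  have dom: "r \<in> I" "\<gamma> r \<in> cdom c" if "t0 - e \<le> r" "r \<le> t0 + e" for r
    using e'(2)[of r] e'(1) that by (auto simp: e_def dist_real_def abs_less_iff)
  txt \<open>
    In the chart \<open>c\<close>, the vertical part \<open>n\<close> of the velocity is recovered from the momenta \<open>m b\<close> along
    the vertical fields \<open>W b\<close> as \<open>n = (\<Sum>b. m b *\<^sub>R R b)\<close>.
  \<close>
  define x where "x = (\<lambda>s. coord c (\<gamma> s))"
  define W where "W b = (\<lambda>q. vert q (from_chart N c q b))" for b
  define Wc where "Wc b = vf_rep N c (W b)" for b
  \<comment> \<open>\<open>R b\<close> is the metric dual of the coordinate form of
    \<open>b\<close>. It recovers a vector from its pairings with the coordinate vectors, which the
    possibly dependent fields \<open>W b\<close> could not do uniquely.\<close>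
  define R where "R b y = sharp (metric_rep N h c y) (\<lambda>u. u \<bullet> b)" for b y
  define n where "n s = (\<Sum>b\<in>onb. (Dv x s 1 \<bullet> b) *\<^sub>R Wc b (x s))" for s
  define m where "m b s = h (\<gamma> s) (velocity N \<gamma> s) (W b (\<gamma> s))" for b s
  \<comment> \<open>The coefficients of \<open>lie_deriv_metric_vertical\<close> after its factor
    \<open>vert q u\<close> is replaced by the combination of the \<open>R b'\<close> with weights
    \<open>m b'\<close>; they involve the curve itself, but along a given curve the system is
    linear.\<close>
  define A where "A b b' s = ld (Wc b) (metric_rep N h c) (x s) (2 *\<^sub>R Dv x s 1 - n s) (R b' (x s)) / 2"
    for b b' s
  have dW: "d\<pi> q (W b q) = 0" for q b by (simp add: W_def differential_vert)
  have lin_b: "linear (\<lambda>u. u \<bullet> b)" for b :: 'f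
    by (rule bounded_linear.linear[OF bounded_linear_inner_left])
  have main: "N.smooth_vf_at (\<gamma> s) (W b)" "smooth_at (x s) (Wc b)" "smooth_at s x" "smooth_at s n"
    "smooth_at (x s) (R b)" "smooth_at s (A b b')"
    "vert (\<gamma> s) (velocity N \<gamma> s) = from_chart N c (\<gamma> s) (n s)"
    "n s = (\<Sum>b\<in>onb. m b s *\<^sub>R R b (x s))"
    "m b s = h (\<gamma> s) (vert (\<gamma> s) (velocity N \<gamma> s)) (from_chart N c (\<gamma> s) b)"
    "(m b has_real_derivative (\<Sum>b'\<in>onb. A b b' s * m b' s)) (at s)"
    if s: "t0 - e \<le> s" "s \<le> t0 + e" for s b b'
  proof -
    note ds = dom[OF s]
    note cs = c(1) ds(2)
    have sW: "N.smooth_vf_at (\<gamma> s) (W b)" for b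
      unfolding W_def by (intro smooth_vf_at_vert N.smooth_vf_at_from_chart cs)
    have sWc: "smooth_at (x s) (Wc b)" for b
      using sW cs by (simp add: N.smooth_vf_at_def x_def Wc_def)
    have sx: "smooth_at s x" unfolding x_def by (rule N.smooth_at_curve[OF \<gamma> ds(1) cs])
    have sn: "smooth_at s n"
      unfolding n_def[abs_def]
      by (intro smooth_at_sum smooth_at_scaleR smooth_at_inner smooth_at_const smooth_at_Dv sx
          smooth_at_compose[OF sx sWc])
    have met: "metric_at (x s) (metric_rep N h c)" unfolding x_def by (rule N.metric_at_rep[OF cs])
    have ipx: "inner_form (metric_rep N h c (x s))" unfolding x_def by (rule N.inner_form_metric_rep[OF cs])
    have sR: "smooth_at (x s) (R b)" for b
      unfolding R_def[abs_def] by (rule smooth_at_sharp[OF met]) (auto simp: lin_b)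
    have ldb: "bilin_at (x s) (ld (Wc b) (metric_rep N h c))" for b
    proof -
      have "\<forall>\<^sub>F y in nhds (x s). bilin_at y (metric_rep N h c) \<and> smooth_at y (Wc b)"
      proof -
        have "\<forall>\<^sub>F y in nhds (x s). bilin_at y (metric_rep N h c)"
          unfolding x_def using N.eventually_coord_domains[OF cs cs]
        proof eventually_elim
          case (elim y)
          then show ?case using N.bilin_at_rep[OF c(1)] by auto
        qed
        with smooth_at_eventually[OF sWc[of b]] show ?thesis by eventually_elim simp
      qed
      then have "\<forall>\<^sub>F y in nhds (x s). bilinear (ld (Wc b) (metric_rep N h c) y)"
        by eventually_elim (simp add: bilinear_ld)
      moreover have "smooth_at (x s) (\<lambda>y. ld (Wc b) (metric_rep N h c) y u v)" for u v
        by (rule smooth_at_ld[OF sWc metric_at_bilin_at[OF met]])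
      ultimately show ?thesis by (simp add: bilin_at_def)
    qed
    have "smooth_at s (\<lambda>s. (1 / 2) * ld (Wc b) (metric_rep N h c) (x s) (2 *\<^sub>R Dv x s 1 - n s) (R b' (x s)))" for b b'
      by (intro smooth_at_mult smooth_at_const smooth_at_bilin[OF bilin_at_pullback[OF sx ldb]]
          smooth_at_diff smooth_at_scaleR smooth_at_Dv sx sn smooth_at_compose[OF sx sR])
    then have sA: "smooth_at s (A b b')" for b b' by (simp add: A_def[abs_def])
    have vel: "to_chart N c (\<gamma> s) (velocity N \<gamma> s) = Dv x s 1"
      unfolding x_def by (rule N.to_chart_velocity[OF \<gamma> ds(1) cs])
    note lin = linear_compose[OF linear_compose[OF N.linear_from_chart[OF cs] linear_vert[of "\<gamma> s"]]
        N.linear_to_chart[OF cs]]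
    have nv: "n s = to_chart N c (\<gamma> s) (vert (\<gamma> s) (velocity N \<gamma> s))"
    proof -
      have "to_chart N c (\<gamma> s) (vert (\<gamma> s) (velocity N \<gamma> s)) =
          (to_chart N c (\<gamma> s) \<circ> (vert (\<gamma> s) \<circ> from_chart N c (\<gamma> s))) (Dv x s 1)"
        unfolding vel[symmetric] using cs by simp
      also have "\<dots> = (\<Sum>b\<in>onb. (Dv x s 1 \<bullet> b) *\<^sub>R
          (to_chart N c (\<gamma> s) \<circ> (vert (\<gamma> s) \<circ> from_chart N c (\<gamma> s))) b)"
        by (rule linear_onb_expand[OF lin])
      also have "\<dots> = n s" by (simp add: n_def Wc_def x_def W_def N.vf_rep_coord[OF cs])
      finally show ?thesis by simp
    qed
    then have vn: "vert (\<gamma> s) (velocity N \<gamma> s) = from_chart N c (\<gamma> s) (n s)" using cs by simp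
    have mb: "m b s = h (\<gamma> s) (vert (\<gamma> s) (velocity N \<gamma> s)) (from_chart N c (\<gamma> s) b)" for b
      by (simp add: m_def W_def metric_vert)
    have hm: "metric_rep N h c (x s) (n s) b = m b s" for b
      unfolding x_def N.metric_rep_coord[OF cs] mb vn ..
    note Bx = inner_form_bilinear[OF ipx]
    \<comment> \<open>Both sides have the same pairing with every \<open>u\<close>:
      \<open>R b\<close> pairs with \<open>u\<close> to \<open>u \<bullet> b\<close>, and
      \<open>m b s\<close> is the pairing of \<open>n s\<close> with \<open>b\<close>.\<close>
    have nR: "n s = (\<Sum>b\<in>onb. m b s *\<^sub>R R b (x s))"
    proof (rule inner_form_eqI[OF ipx])
      fix u
      have l1: "linear (metric_rep N h c (x s) (n s))" and l2: "linear (\<lambda>v. metric_rep N h c (x s) v u)"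
        using Bx by (auto simp: bilinear_def)
      have "metric_rep N h c (x s) (n s) u = (\<Sum>b\<in>onb. (u \<bullet> b) * m b s)"
        by (subst linear_onb_expand[OF l1]) (simp add: hm)
      also have "\<dots> = (\<Sum>b\<in>onb. m b s * metric_rep N h c (x s) (R b (x s)) u)"
        by (simp add: R_def sharp_works[OF ipx lin_b] mult.commute)
      also have "\<dots> = metric_rep N h c (x s) (\<Sum>b\<in>onb. m b s *\<^sub>R R b (x s)) u"
        by (simp add: linear_sum[OF l2] linear_scale[OF l2])
      finally show "metric_rep N h c (x s) (n s) u =
          metric_rep N h c (x s) (\<Sum>b\<in>onb. m b s *\<^sub>R R b (x s)) u" .
    qed
    have "lie_deriv_metric N (W b) h (\<gamma> s) (velocity N \<gamma> s) (velocity N \<gamma> s) / 2 =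
        (\<Sum>b'\<in>onb. A b b' s * m b' s)" for b
    proof -
      let ?L = "ld (Wc b) (metric_rep N h c) (x s)"
      have l: "linear (?L u)" for u
        using bilin_at_bilinear[OF ldb] by (simp add: bilinear_def)
      have "lie_deriv_metric N (W b) h (\<gamma> s) (velocity N \<gamma> s) (velocity N \<gamma> s) =
          lie_deriv_metric N (W b) h (\<gamma> s) (2 *\<^sub>R velocity N \<gamma> s - vert (\<gamma> s) (velocity N \<gamma> s))
            (vert (\<gamma> s) (velocity N \<gamma> s))"
        by (rule lie_deriv_metric_vertical[OF sW dW])
      also have "\<dots> = ?L (2 *\<^sub>R Dv x s 1 - n s) (n s)"
        unfolding N.lie_deriv_metric_chart[OF cs sW N.bilin_at_rep[OF cs]]
          linear_diff[OF N.linear_to_chart[OF cs]] linear_scale[OF N.linear_to_chart[OF cs]] vel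
          nv[symmetric] x_def Wc_def ..
      also have "\<dots> = ?L (2 *\<^sub>R Dv x s 1 - n s) (\<Sum>b\<in>onb. m b s *\<^sub>R R b (x s))"
        by (rule arg_cong[OF nR])
      also have "\<dots> = (\<Sum>b'\<in>onb. m b' s * ?L (2 *\<^sub>R Dv x s 1 - n s) (R b' (x s)))"
        by (simp add: linear_sum[OF l] linear_scale[OF l])
      finally show ?thesis by (simp add: A_def sum_divide_distrib mult.commute)
    qed
    with N.geodesic_momentum[OF geo ds(1) sW]
    have dm: "(m b has_real_derivative (\<Sum>b'\<in>onb. A b b' s * m b' s)) (at s)" for b
      by (simp add: m_def[abs_def])
    show "N.smooth_vf_at (\<gamma> s) (W b)" "smooth_at (x s) (Wc b)" "smooth_at s x" "smooth_at s n"
      "smooth_at (x s) (R b)" "smooth_at s (A b b')"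
      "vert (\<gamma> s) (velocity N \<gamma> s) = from_chart N c (\<gamma> s) (n s)"
      "n s = (\<Sum>b\<in>onb. m b s *\<^sub>R R b (x s))"
      "m b s = h (\<gamma> s) (vert (\<gamma> s) (velocity N \<gamma> s)) (from_chart N c (\<gamma> s) b)"
      "(m b has_real_derivative (\<Sum>b'\<in>onb. A b b' s * m b' s)) (at s)"
      by (fact sW sWc sx sn sR sA vn nR mb dm)+
  qed
  have "vert (\<gamma> t) (velocity N \<gamma> t) = 0"
    if s: "\<bar>s - t0\<bar> \<le> e" and t: "\<bar>t - t0\<bar> \<le> e" and z: "vert (\<gamma> s) (velocity N \<gamma> s) = 0" for s t
  proof -
    have s': "t0 - e \<le> s" "s \<le> t0 + e" and t': "t0 - e \<le> t" "t \<le> t0 + e" using s t by linarith+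
    have ms: "m b s = 0" for b
      unfolding main(9)[OF s'] z by (rule bilinear_lzero[OF inner_form_bilinear[OF N.inner_form_metric]])
    have "continuous_on {t0 - e..t0 + e} (A b b')" for b b'
      using smooth_at_isCont[OF main(6)] by (intro continuous_at_imp_continuous_on) auto
    then have "m b t = 0" if "b \<in> onb" for b
      using linear_ode_zero[OF finite_onb main(10) _ s' ms t' that] by blast
    then have "n t = 0" unfolding main(8)[OF t'] by simp
    then show ?thesis
      unfolding main(7)[OF t'] using linear_0[OF N.linear_from_chart[OF c(1) dom(2)[OF t']]] by simp
  qed
  with e show ?thesis by blast
qed

text \<open>The local equivalence says that being horizontal is locally constant along the geodesic,
  and \<open>I\<close> is an interval.\<close>

lemma horizontal_geodesic:
  assumes geo: "geodesic N h I \<gamma>" and "s \<in> I" "t \<in> I" "vert (\<gamma> s) (velocity N \<gamma> s) = 0"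
  shows "vert (\<gamma> t) (velocity N \<gamma> t) = 0"
proof (rule connected_induction_simple[where S = I and P = "\<lambda>t. vert (\<gamma> t) (velocity N \<gamma> t) = 0",
      OF _ assms(2,3,4)])
  show "connected I" using geo is_interval_connected by (auto simp: geodesic_def)
  fix t0 assume t0: "t0 \<in> I"
  obtain e where e: "e > 0" "\<forall>s t. \<bar>s - t0\<bar> \<le> e \<longrightarrow> \<bar>t - t0\<bar> \<le> e \<longrightarrow>
      vert (\<gamma> s) (velocity N \<gamma> s) = 0 \<longrightarrow> vert (\<gamma> t) (velocity N \<gamma> t) = 0"
    using horizontal_locally[OF geo t0] by blast
  show "\<exists>T. openin (top_of_set I) T \<and> t0 \<in> T \<and>
      (\<forall>x\<in>T. \<forall>y\<in>T. vert (\<gamma> x) (velocity N \<gamma> x) = 0 \<longrightarrow> vert (\<gamma> y) (velocity N \<gamma> y) = 0)"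
  proof (intro exI[of _ "I \<inter> ball t0 e"] conjI ballI)
    show "openin (top_of_set I) (I \<inter> ball t0 e)" by (rule openin_open_Int[OF open_ball])
    show "t0 \<in> I \<inter> ball t0 e" using t0 e(1) by simp
    fix x y assume "x \<in> I \<inter> ball t0 e" "y \<in> I \<inter> ball t0 e"
    then have "\<bar>x - t0\<bar> \<le> e" "\<bar>y - t0\<bar> \<le> e" by (auto simp: dist_real_def abs_minus_commute)
    then show "vert (\<gamma> x) (velocity N \<gamma> x) = 0 \<longrightarrow> vert (\<gamma> y) (velocity N \<gamma> y) = 0" using e(2) by blast
  qed
qed

lemma geodesic_comp:
  assumes geo: "geodesic N h I \<gamma>" and hz: "\<And>t. t \<in> I \<Longrightarrow> vert (\<gamma> t) (velocity N \<gamma> t) = 0"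
  shows "geodesic M g I (\<pi> \<circ> \<gamma>)"
proof -
  have \<gamma>: "smooth_curve N I \<gamma>" "open I" and iv: "is_interval I" using geo by (auto simp: geodesic_def)
  show ?thesis
  proof (rule M.geodesicI[OF smooth_curve_comp(1)[OF \<gamma>] \<gamma>(2) iv])
    fix t X assume t: "t \<in> I" and X: "M.smooth_vf_at ((\<pi> \<circ> \<gamma>) t) X"
    let ?v = "velocity N \<gamma> t"
    have X': "M.smooth_vf_at (\<pi> (\<gamma> t)) X" using X by simp
    have H: "N.smooth_vf_at (\<gamma> t) (hlift X)" by (rule smooth_vf_at_hlift[OF X'])
    have vh: "?v = hor (\<gamma> t) (d\<pi> (\<gamma> t) ?v)" using hor_plus_vert[of ?v "\<gamma> t"] hz[OF t] by simp
    have "lie_deriv_metric N (hlift X) h (\<gamma> t) ?v ?v =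
        lie_deriv_metric M X g (\<pi> (\<gamma> t)) (d\<pi> (\<gamma> t) ?v) (d\<pi> (\<gamma> t) ?v)"
      using lie_deriv_metric_hor[OF H X', of "d\<pi> (\<gamma> t) ?v" "d\<pi> (\<gamma> t) ?v"] vh
      by (simp add: differential_hlift)
    with N.geodesic_momentum[OF geo t H]
    have D: "((\<lambda>s. h (\<gamma> s) (velocity N \<gamma> s) (hlift X (\<gamma> s))) has_real_derivative
        lie_deriv_metric M X g (\<pi> (\<gamma> t)) (d\<pi> (\<gamma> t) ?v) (d\<pi> (\<gamma> t) ?v) / 2) (at t)"
      by simp
    have eq: "h (\<gamma> s) (velocity N \<gamma> s) (hlift X (\<gamma> s)) =
        g ((\<pi> \<circ> \<gamma>) s) (velocity M (\<pi> \<circ> \<gamma>) s) (X ((\<pi> \<circ> \<gamma>) s))" if "s \<in> I" for s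
      using hor(2)[of "\<gamma> s" "X (\<pi> (\<gamma> s))" "velocity N \<gamma> s"] smooth_curve_comp(2)[OF \<gamma> that]
        inner_form_sym[OF N.inner_form_metric, of "\<gamma> s" "velocity N \<gamma> s"]
        inner_form_sym[OF M.inner_form_metric, of "\<pi> (\<gamma> s)" "X (\<pi> (\<gamma> s))"]
      by (simp add: hlift_def)
    show "((\<lambda>s. g ((\<pi> \<circ> \<gamma>) s) (velocity M (\<pi> \<circ> \<gamma>) s) (X ((\<pi> \<circ> \<gamma>) s))) has_real_derivative
        lie_deriv_metric M X g ((\<pi> \<circ> \<gamma>) t) (velocity M (\<pi> \<circ> \<gamma>) t) (velocity M (\<pi> \<circ> \<gamma>) t) / 2) (at t)"
      using has_field_derivative_transform_within_open[OF D \<gamma>(2) t eq] smooth_curve_comp(2)[OF \<gamma> t]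
      by simp
  qed
qed

end

context foliated_riem_subm
begin

lemma geometric_SRF_PF:
  assumes "geometric_SRF M g F"
  shows "geometric_SRF N h PF"
  unfolding geometric_SRF_def
proof (intro conjI allI impI ballI)
  fix I \<gamma> L' s
  assume geo: "geodesic N h I \<gamma>"
    and ex: "\<exists>L\<in>leaves N PF. \<exists>t\<in>I. orthogonal_to_leaf_at N h PF \<gamma> L t"
    and L': "L' \<in> leaves N PF" and s: "s \<in> I" and sL: "\<gamma> s \<in> L'"
  obtain t where t: "t \<in> I" and orth: "\<And>v. v \<in> leaf_tangent PF (\<gamma> t) \<Longrightarrow> h (\<gamma> t) (velocity N \<gamma> t) v = 0"
    using ex by (auto simp: orthogonal_to_leaf_at_def)
  have \<gamma>: "smooth_curve N I \<gamma>" "open I" using geo by (auto simp: geodesic_def)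
  have zero: "0 \<in> leaf_tangent F p" for p using F(3) by (auto simp: leaf_tangent_def)
  let ?v = "velocity N \<gamma> t"
  \<comment> \<open>The zero vector is tangent to every leaf of \<open>F\<close>, so all vertical
    vectors are tangent to the leaves of the pullback. Testing against the vertical part of the
    velocity shows that this part vanishes.\<close>
  have "h (\<gamma> t) ?v (vert (\<gamma> t) ?v) = 0"
    by (rule orth) (simp add: leaf_tangent_PF differential_vert zero)
  then have "h (\<gamma> t) (vert (\<gamma> t) ?v) (vert (\<gamma> t) ?v) = 0"
    using metric_vert[of "\<gamma> t" ?v "vert (\<gamma> t) ?v"] by (simp add: vert_eq_self differential_vert)
  then have "vert (\<gamma> t) ?v = 0" using inner_form_pos[OF N.inner_form_metric, of "vert (\<gamma> t) ?v" "\<gamma> t"] by force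
  then have hz: "vert (\<gamma> r) (velocity N \<gamma> r) = 0" if "r \<in> I" for r
    using horizontal_geodesic[OF geo t that] by blast
  have hv: "h (\<gamma> r) (velocity N \<gamma> r) w = g (\<pi> (\<gamma> r)) (velocity M (\<pi> \<circ> \<gamma>) r) (d\<pi> (\<gamma> r) w)"
    if "r \<in> I" for r w
    using hor(2)[of "\<gamma> r" "d\<pi> (\<gamma> r) (velocity N \<gamma> r)" w] hor_plus_vert[of "velocity N \<gamma> r" "\<gamma> r"]
      hz[OF that] smooth_curve_comp(2)[OF \<gamma> that] by simp
  have geoM: "geodesic M g I (\<pi> \<circ> \<gamma>)" by (rule geodesic_comp[OF geo hz])
  \<comment> \<open>Orthogonality depends on a leaf only through membership of the point, so on
    \<open>M\<close> the leaf through the point itself serves, and leaves of \<open>N\<close> and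
    \<open>M\<close> never have to be compared as sets.\<close>
  have own: "p \<in> leaf M F p" for p by (simp add: leaf_def)
  have "orthogonal_to_leaf_at M g F (\<pi> \<circ> \<gamma>) (leaf M F (\<pi> (\<gamma> t))) t"
    unfolding orthogonal_to_leaf_at_def
  proof (intro conjI ballI)
    fix a assume "a \<in> leaf_tangent F ((\<pi> \<circ> \<gamma>) t)"
    then have "hor (\<gamma> t) a \<in> leaf_tangent PF (\<gamma> t)" by (simp add: leaf_tangent_PF hor)
    from orth[OF this] show "g ((\<pi> \<circ> \<gamma>) t) (velocity M (\<pi> \<circ> \<gamma>) t) a = 0"
      using hv[OF t, of "hor (\<gamma> t) a"] by (simp add: hor)
  qed (simp add: own)
  then have exM: "\<exists>L\<in>leaves M F. \<exists>t\<in>I. orthogonal_to_leaf_at M g F (\<pi> \<circ> \<gamma>) L t"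
    unfolding leaves_def using t by blast
  have "orthogonal_to_leaf_at M g F (\<pi> \<circ> \<gamma>) (leaf M F (\<pi> (\<gamma> s))) s"
    using assms[unfolded geometric_SRF_def, THEN conjunct2, THEN conjunct2, rule_format, OF geoM exM]
      s own[of "\<pi> (\<gamma> s)"] by (simp add: leaves_def)
  then have "g (\<pi> (\<gamma> s)) (velocity M (\<pi> \<circ> \<gamma>) s) a = 0" if "a \<in> leaf_tangent F (\<pi> (\<gamma> s))" for a
    using that by (simp add: orthogonal_to_leaf_at_def)
  then show "orthogonal_to_leaf_at N h PF \<gamma> L' s"
    unfolding orthogonal_to_leaf_at_def using sL hv[OF s] by (simp add: leaf_tangent_PF)
qed (fact N.riemannian singular_foliation_PF)+

end

theorem proposition3p12:
  fixes N :: "('b::{t2_space,second_countable_topology}, 'f::finite_dimensional_inner) manifold"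
    and M :: "('a::{t2_space,second_countable_topology}, 'e::finite_dimensional_inner) manifold"
    and h :: "'b \<Rightarrow> 'f \<Rightarrow> 'f \<Rightarrow> real"
    and g :: "'a \<Rightarrow> 'e \<Rightarrow> 'e \<Rightarrow> real"
    and \<pi> :: "'b \<Rightarrow> 'a"
    and F :: "('a \<Rightarrow> 'e) set"
  assumes "riemannian_submersion N h M g \<pi>"
  shows "(module_SRF M g F \<longrightarrow> module_SRF N h (pullback_foliation N M \<pi> F)) \<and>
         (geometric_SRF M g F \<longrightarrow> geometric_SRF N h (pullback_foliation N M \<pi> F))"
proof -
  have *: "riemannian_manifold N h" "riemannian_manifold M g"
    using assms by (auto simp: riemannian_submersion_def)
  interpret N: riem_mfd N h
    by unfold_locales (use * in \<open>auto simp: riemannian_manifold_def\<close>)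
  interpret M: riem_mfd M g
    by unfold_locales (use * in \<open>auto simp: riemannian_manifold_def\<close>)
  interpret riem_subm N h M g \<pi>
    by unfold_locales (rule assms)
  \<comment> \<open>Each of the two premises contains that \<open>F\<close> is a singular foliation,
    so the locale is entered separately under each of them.\<close>
  have loc: "foliated_riem_subm N h M g \<pi> F" if "singular_foliation M F"
    by unfold_locales (rule that)
  show ?thesis
    using foliated_riem_subm.module_SRF_PF[OF loc] foliated_riem_subm.geometric_SRF_PF[OF loc]
    by (auto simp: module_SRF_def[of M] geometric_SRF_def[of M])
qed

end
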